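(* Let $f: M \to M$ be a continuous map on a compact Riemannian manifold $M$. Then the following conditions are equivalent: (i) There exists an $f$-invariant probability measure $\mu_1$ that is globally empirically stochastically stable. (ii) There exists an $f$-invariant probability measure $\mu_2$ that is physical and such that its strong basin of statistical attraction has full Lebesgue measure. (iii) There exists a unique $f$-invariant probability measure $\mu_3$ that is pseudo-physical. Besides, if (i), (ii) or (iii) holds, then $\mu_1=\mu_2=\mu_3$, this measure is the unique empirically stochastically stable measure, and the set $\{\mu_1\}$ is the unique weak$^*$-compact set in the space of probability measures that is empirically stochastically stable.
   Context: Setting. $M$ is a compact finite-dimensional Riemannian manifold, with or without boundary; $m$ is the Lebesgue measure on $M$, i.e. the finite Borel measure obtained from the Riemannian volume; $B_\epsilon(x)$ is the open ball of radius $\epsilon$ centered at $x$. For sets $A,B\subset M$, "$A\subset B$ Lebesgue-a.e." means $m(A\setminus B)=0$. $\mathcal{M}$ is the space of Borel probability measures on $M$ with the weak$^*$ topology, and $\mathrm{dist}^*$ is a fixed metric on $\mathcal{M}$ inducing that topology; the distance from a measure to a set, or between two sets, of measures is the infimum of the pairwise distances. $\mathcal{M}_f\subset\mathcal{M}$ is the set of $f$-invariant probability measures. $\mathbb{N}^+=\{1,2,\dots\}$. Noise. For $\epsilon>0$, $x\in M$ and a Borel set $A$, let $p_\epsilon(x,A)=\dfrac{m(A\cap B_\epsilon(f(x)))}{m(B_\epsilon(f(x)))}$. The transfer operator $\mathcal{L}_\epsilon$ on the space $C^0(M,\mathbb{C})$ of continuous functions is $(\mathcal{L}_\epsilon\varphi)(x)=\int\varphi(y)\,p_\epsilon(x,dy)$;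 the dual operator $\mathcal{L}_\epsilon^*:\mathcal{M}\to\mathcal{M}$ is defined by $\int\varphi\,d(\mathcal{L}^*_\epsilon\mu)=\int(\mathcal{L}_\epsilon\varphi)\,d\mu$ for all $\varphi\in C^0(M,\mathbb{C})$. The empiric stochastic probability is $\sigma_{\epsilon,n,x}=\frac1n\sum_{j=1}^n(\mathcal{L}_\epsilon^* )^j\delta_x$, where $\delta_x$ is the Dirac measure at $x$. Empiric stochastic stability of a measure. A measure $\mu\in\mathcal{M}_f$ is empirically stochastically stable if there is a measurable set $\widehat A\subset M$ with $m(\widehat A)>0$ such that for every $\rho>0$ and every large enough $n\in\mathbb{N}^+$ (how large may depend on $\rho$) there exists $\epsilon_0>0$ (which may depend on $\rho$ and $n$ but not on $x$) with $\mathrm{dist}^*(\sigma_{\epsilon,n,x},\mu)<\rho$ for all $0<\epsilon\le\epsilon_0$ and for Lebesgue-a.e. $x\in\widehat A$. The basin of empiric stochastic stability $\widehat A_\mu$ is the set of $x\in M$ such that for every $\rho>0$ there is $N=N(\rho)$ such that for every $n\ge N$ there is $\epsilon_0=\epsilon_0(\rho,n)>0$ with $\mathrm{dist}^*(\sigma_{\epsilon,n,x},\mu)<\rho$ for all $0<\epsilon\le\epsilon_0$. The measure $\mu$ is globally empirically stochastically stable if it is empirically stochastically stable and $\widehat A_\mu$ has full Lebesgue measure. Empiric stochastic stability of sets. For a nonempty weak$^*$-compact set $\mathcal{K}\subset\mathcal{M}$, its basin $\widehat A_{\mathcal{K}}$ is defined as $\widehat A_\mu$ with $\mathrm{dist}^*(\sigma_{\epsilon,n,x},\mathcal{K})$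 in place of $\mathrm{dist}^*(\sigma_{\epsilon,n,x},\mu)$. A nonempty weak$^*$-compact set $\mathcal{K}\subset\mathcal{M}_f$ is empirically stochastically stable if: (1) there is a measurable set $\widehat A\subset M$ with $m(\widehat A)>0$ such that for every $\rho>0$ and every large enough $n$ (how large may depend on $\rho$) there is $\epsilon_0>0$ (which may depend on $\rho$ and $n$ but not on $x$) with $\mathrm{dist}^*(\sigma_{\epsilon,n,x},\mathcal{K})<\rho$ for all $0<\epsilon\le\epsilon_0$ and all $x\in\widehat A$; and (2) if $\mathcal{K}'\subset\mathcal{M}_f$ is nonempty and weak$^*$-compact and $\widehat A_{\mathcal{K}}\subset\widehat A_{\mathcal{K}'}$ Lebesgue-a.e., then $\mathcal{K}\subset\mathcal{K}'$. Physical and pseudo-physical measures. Let $\sigma_{n,x}=\frac1n\sum_{j=1}^n\delta_{f^j(x)}$ and let $p\omega_x\subset\mathcal{M}$ be the set of all weak$^*$ limits of convergent subsequences $\sigma_{n_i,x}$ with $n_i\to+\infty$. For $\mu\in\mathcal{M}_f$ and $\rho>0$, the strong basin of statistical attraction is $A_\mu=\{x\in M:p\omega_x=\{\mu\}\}$ and the $\rho$-weak basin is $A_\mu^\rho=\{x\in M:\mathrm{dist}^*(p\omega_x,\{\mu\})<\rho\}$. The measure $\mu\in\mathcal{M}_f$ is physical if $m(A_\mu)>0$, and pseudo-physical if $m(A_\mu^\rho)>0$ for every $\rho>0$. *)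

theory Defs
  imports "HOL-Analysis.Analysis" "HOL-Probability.Probability"
begin

section \<open>Compact Riemannian manifolds with or without boundary\<close>

text \<open>The points of the manifold are the elements of a topological type \<open>'a\<close>, the dimension is
  the cardinality of the index type \<open>'n\<close>. A chart is its domain together with its coordinate map,
  whose values outside the domain are irrelevant. A Riemannian metric is given by its coordinate
  matrices: \<open>g (U, \<phi>) y\<close> is the Gram matrix of the coordinate vector fields of the chart
  \<open>(U, \<phi>)\<close> at the point with coordinates \<open>y \<in> \<phi> ` U\<close>.\<close>

type_synonym ('a, 'n) chart = "'a set \<times> ('a \<Rightarrow> real ^ 'n)"
type_synonym ('a, 'n) metric_matrices = "('a, 'n) chart \<Rightarrow> real ^ 'n \<Rightarrow> real ^ 'n ^ 'n"

text \<open>Only meant for open sets \<open>S\<close>.\<close>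

primrec Ck_on :: "nat \<Rightarrow> ('v::euclidean_space \<Rightarrow> 'w::euclidean_space) \<Rightarrow> 'v set \<Rightarrow> bool" where
  "Ck_on 0 h S \<longleftrightarrow> continuous_on S h"
| "Ck_on (Suc k) h S \<longleftrightarrow>
     h differentiable_on S \<and> (\<forall>v. Ck_on k (\<lambda>x. frechet_derivative h (at x) v) S)"

text \<open>Smoothness on an arbitrary set, such as a relatively open subset of a half-space, means local
  extendability to smooth maps on open sets.\<close>

definition smooth_on :: "'v::euclidean_space set \<Rightarrow> ('v \<Rightarrow> 'w::euclidean_space) \<Rightarrow> bool" where
  "smooth_on S h \<longleftrightarrow>
     (\<forall>x\<in>S. \<exists>W H. open W \<and> x \<in> W \<and> (\<forall>k. Ck_on k H W) \<and> (\<forall>y\<in>W \<inter> S. H y = h y))"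

text \<open>Chart images are relatively open in the whole space or in a closed coordinate half-space.\<close>

definition is_chart :: "('a::topological_space, 'n::finite) chart \<Rightarrow> bool" where
  "is_chart C \<longleftrightarrow> (case C of (U, \<phi>) \<Rightarrow>
     open U \<and> homeomorphism U (\<phi> ` U) \<phi> (inv_into U \<phi>) \<and>
     (\<exists>H. (H = UNIV \<or> (\<exists>k. H = {v. 0 \<le> v $ k})) \<and> openin (top_of_set H) (\<phi> ` U)))"

definition smooth_atlas :: "('a::topological_space, 'n::finite) chart set \<Rightarrow> bool" where
  "smooth_atlas \<A> \<longleftrightarrow>
     (\<forall>C\<in>\<A>. is_chart C) \<and> (\<Union>(U, \<phi>)\<in>\<A>. U) = UNIV \<and>
     (\<forall>(U, \<phi>)\<in>\<A>. \<forall>(V, \<psi>)\<in>\<A>. smooth_on (\<phi> ` (U \<inter> V)) (\<psi> \<circ> inv_into U \<phi>))"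

text \<open>The last clause says that the coordinate matrices represent one and the same
  inner product on each tangent space, including at boundary points, where the derivative of the
  transition map is taken within the chart image.\<close>

definition riemannian_metric ::
  "('a::topological_space, 'n::finite) chart set \<Rightarrow> ('a, 'n) metric_matrices \<Rightarrow> bool" where
  "riemannian_metric \<A> g \<longleftrightarrow>
     (\<forall>(U, \<phi>)\<in>\<A>. smooth_on (\<phi> ` U) (g (U, \<phi>)) \<and>
        (\<forall>y\<in>\<phi> ` U. transpose (g (U, \<phi>) y) = g (U, \<phi>) y \<and>
           (\<forall>v. v \<noteq> 0 \<longrightarrow> 0 < v \<bullet> (g (U, \<phi>) y *v v)))) \<and>
     (\<forall>(U, \<phi>)\<in>\<A>. \<forall>(V, \<psi>)\<in>\<A>. \<forall>y\<in>\<phi> ` (U \<inter> V). \<forall>D.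
        ((\<psi> \<circ> inv_into U \<phi>) has_derivative D) (at y within \<phi> ` (U \<inter> V)) \<longrightarrow>
        (\<forall>v w. v \<bullet> (g (U, \<phi>) y *v w) = D v \<bullet> (g (V, \<psi>) (\<psi> (inv_into U \<phi> y)) *v D w)))"

definition compact_riemannian_manifold ::
  "('a::{t2_space, second_countable_topology}, 'n::finite) chart set \<Rightarrow>
     ('a, 'n) metric_matrices \<Rightarrow> bool" where
  "compact_riemannian_manifold \<A> g \<longleftrightarrow>
     compact (UNIV :: 'a set) \<and> smooth_atlas \<A> \<and> riemannian_metric \<A> g"

text \<open>A piecewise continuously differentiable curve is a finite concatenation of continuously
  differentiable arcs, each of which may be taken to lie in the domain of one chart and to be
  parametrised over the unit interval. The relation \<open>curve_length \<A> g x y l\<close> says that some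
  such curve from \<open>x\<close> to \<open>y\<close> has length \<open>l\<close>; in the second rule \<open>c\<close> is the coordinate expression
  of the last arc and \<open>c'\<close> its velocity.\<close>

inductive curve_length ::
  "('a::topological_space, 'n::finite) chart set \<Rightarrow> ('a, 'n) metric_matrices \<Rightarrow>
     'a \<Rightarrow> 'a \<Rightarrow> real \<Rightarrow> bool" for \<A> g where
  const: "curve_length \<A> g x x 0"
| arc: "curve_length \<A> g x z
          (l + integral {0..1} (\<lambda>t. sqrt (c' t \<bullet> (g (U, \<phi>) (c t) *v c' t))))"
  if "curve_length \<A> g x y l" and "(U, \<phi>) \<in> \<A>" and "y \<in> U" and "z \<in> U"
    and "c 0 = \<phi> y" and "c 1 = \<phi> z" and "c ` {0..1} \<subseteq> \<phi> ` U"
    and "\<forall>t\<in>{0..1}. (c has_vector_derivative c' t) (at t within {0..1})"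
    and "continuous_on {0..1} c'"

text \<open>The distance of points in different components is infinite.\<close>

definition riem_dist ::
  "('a::topological_space, 'n::finite) chart set \<Rightarrow> ('a, 'n) metric_matrices \<Rightarrow> 'a \<Rightarrow> 'a \<Rightarrow> ereal"
  where "riem_dist \<A> g x y = (INF l\<in>{l. curve_length \<A> g x y l}. ereal l)"

definition riem_ball ::
  "('a::topological_space, 'n::finite) chart set \<Rightarrow> ('a, 'n) metric_matrices \<Rightarrow> real \<Rightarrow> 'a \<Rightarrow> 'a set"
  where "riem_ball \<A> g \<epsilon> x = {y. riem_dist \<A> g x y < ereal \<epsilon>}"

text \<open>The Riemannian volume is the Borel measure with density \<open>sqrt (det g)\<close> in every chart; this
  determines it uniquely.\<close>

definition riemannian_volume ::
  "('a::topological_space, 'n::finite) chart set \<Rightarrow> ('a, 'n) metric_matrices \<Rightarrow> 'a measure \<Rightarrow> bool"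
  where
  "riemannian_volume \<A> g m \<longleftrightarrow> sets m = sets borel \<and>
     (\<forall>(U, \<phi>)\<in>\<A>. \<forall>S\<in>sets borel. S \<subseteq> U \<longrightarrow>
        emeasure m S = (\<integral>\<^sup>+y\<in>\<phi> ` S. ennreal (sqrt (det (g (U, \<phi>) y))) \<partial>lborel))"

section \<open>Probability measures and the weak-star topology\<close>

definition prob_measures :: "'a::topological_space measure set" where
  "prob_measures = {\<mu>. sets \<mu> = sets borel \<and> prob_space \<mu>}"

definition invariant_measures :: "('a::topological_space \<Rightarrow> 'a) \<Rightarrow> 'a measure set" where
  "invariant_measures f = {\<mu> \<in> prob_measures. distr \<mu> borel f = \<mu>}"

definition weak_star :: "'a::topological_space measure topology" where
  "weak_star = topology_generated_by
     {{\<mu> \<in> prob_measures. (\<integral>x. \<phi> x \<partial>\<mu>) \<in> V} | (\<phi> :: 'a \<Rightarrow> complex) V.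
        continuous_on UNIV \<phi> \<and> open V}"

definition weak_star_metric ::
  "('a::topological_space measure \<Rightarrow> 'a measure \<Rightarrow> real) \<Rightarrow> bool" where
  "weak_star_metric d \<longleftrightarrow>
     Metric_space prob_measures d \<and> Metric_space.mtopology prob_measures d = weak_star"

definition set_dist :: "('b \<Rightarrow> 'b \<Rightarrow> real) \<Rightarrow> 'b set \<Rightarrow> 'b set \<Rightarrow> real" where
  "set_dist d K L = (INF (\<mu>, \<nu>)\<in>K \<times> L. d \<mu> \<nu>)"

text \<open>\<open>average n \<mu>\<close> is the arithmetic mean of the measures \<open>\<mu> 1, \<dots>, \<mu> n\<close>, for \<open>n \<ge> 1\<close>.\<close>

definition average :: "nat \<Rightarrow> (nat \<Rightarrow> 'a::topological_space measure) \<Rightarrow> 'a measure" where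
  "average n \<mu> = measure_of UNIV (sets borel) (\<lambda>A. (\<Sum>j=1..n. emeasure (\<mu> j) A) / of_nat n)"

section \<open>Noise\<close>

text \<open>From here on \<open>m\<close> is the reference measure and \<open>B \<epsilon> x\<close> the ball of radius \<open>\<epsilon>\<close> around \<open>x\<close>.\<close>

type_synonym 'a balls = "real \<Rightarrow> 'a \<Rightarrow> 'a set"

definition transition ::
  "'a::topological_space measure \<Rightarrow> 'a balls \<Rightarrow> ('a \<Rightarrow> 'a) \<Rightarrow> real \<Rightarrow> 'a \<Rightarrow> 'a measure" where
  "transition m B f \<epsilon> x = uniform_measure m (B \<epsilon> (f x))"

definition transfer ::
  "'a::topological_space measure \<Rightarrow> 'a balls \<Rightarrow> ('a \<Rightarrow> 'a) \<Rightarrow> real \<Rightarrow>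
     ('a \<Rightarrow> complex) \<Rightarrow> 'a \<Rightarrow> complex" where
  "transfer m B f \<epsilon> \<phi> x = (\<integral>y. \<phi> y \<partial>transition m B f \<epsilon> x)"

definition dual_transfer ::
  "'a::topological_space measure \<Rightarrow> 'a balls \<Rightarrow> ('a \<Rightarrow> 'a) \<Rightarrow> real \<Rightarrow> 'a measure \<Rightarrow> 'a measure"
  where
  "dual_transfer m B f \<epsilon> \<mu> = (THE \<nu>. \<nu> \<in> prob_measures \<and>
     (\<forall>\<phi>. continuous_on UNIV \<phi> \<longrightarrow> (\<integral>x. \<phi> x \<partial>\<nu>) = (\<integral>x. transfer m B f \<epsilon> \<phi> x \<partial>\<mu>)))"

definition empiric_stochastic ::
  "'a::topological_space measure \<Rightarrow> 'a balls \<Rightarrow> ('a \<Rightarrow> 'a) \<Rightarrow> real \<Rightarrow> nat \<Rightarrow> 'a \<Rightarrow> 'a measure"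
  where
  "empiric_stochastic m B f \<epsilon> n x =
     average n (\<lambda>j. (dual_transfer m B f \<epsilon> ^^ j) (return borel x))"

section \<open>Empiric stochastic stability\<close>

definition stable_measure ::
  "'a::topological_space measure \<Rightarrow> 'a balls \<Rightarrow> ('a \<Rightarrow> 'a) \<Rightarrow>
     ('a measure \<Rightarrow> 'a measure \<Rightarrow> real) \<Rightarrow> 'a measure \<Rightarrow> bool" where
  "stable_measure m B f d \<mu> \<longleftrightarrow> \<mu> \<in> invariant_measures f \<and>
     (\<exists>A\<in>sets m. 0 < emeasure m A \<and>
        (\<forall>\<rho>>0. \<exists>N. \<forall>n\<ge>N. 1 \<le> n \<longrightarrow> (\<exists>\<epsilon>\<^sub>0>0. \<forall>\<epsilon>. 0 < \<epsilon> \<and> \<epsilon> \<le> \<epsilon>\<^sub>0 \<longrightarrow>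
           (AE x in m. x \<in> A \<longrightarrow> d (empiric_stochastic m B f \<epsilon> n x) \<mu> < \<rho>))))"

definition stability_basin ::
  "'a::topological_space measure \<Rightarrow> 'a balls \<Rightarrow> ('a \<Rightarrow> 'a) \<Rightarrow>
     ('a measure \<Rightarrow> 'a measure \<Rightarrow> real) \<Rightarrow> 'a measure \<Rightarrow> 'a set" where
  "stability_basin m B f d \<mu> =
     {x. \<forall>\<rho>>0. \<exists>N. \<forall>n\<ge>N. 1 \<le> n \<longrightarrow> (\<exists>\<epsilon>\<^sub>0>0. \<forall>\<epsilon>. 0 < \<epsilon> \<and> \<epsilon> \<le> \<epsilon>\<^sub>0 \<longrightarrow>
        d (empiric_stochastic m B f \<epsilon> n x) \<mu> < \<rho>)}"

definition globally_stable_measure ::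
  "'a::topological_space measure \<Rightarrow> 'a balls \<Rightarrow> ('a \<Rightarrow> 'a) \<Rightarrow>
     ('a measure \<Rightarrow> 'a measure \<Rightarrow> real) \<Rightarrow> 'a measure \<Rightarrow> bool" where
  "globally_stable_measure m B f d \<mu> \<longleftrightarrow>
     stable_measure m B f d \<mu> \<and> (AE x in m. x \<in> stability_basin m B f d \<mu>)"

definition set_stability_basin ::
  "'a::topological_space measure \<Rightarrow> 'a balls \<Rightarrow> ('a \<Rightarrow> 'a) \<Rightarrow>
     ('a measure \<Rightarrow> 'a measure \<Rightarrow> real) \<Rightarrow> 'a measure set \<Rightarrow> 'a set" where
  "set_stability_basin m B f d K =
     {x. \<forall>\<rho>>0. \<exists>N. \<forall>n\<ge>N. 1 \<le> n \<longrightarrow> (\<exists>\<epsilon>\<^sub>0>0. \<forall>\<epsilon>. 0 < \<epsilon> \<and> \<epsilon> \<le> \<epsilon>\<^sub>0 \<longrightarrow>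
        set_dist d {empiric_stochastic m B f \<epsilon> n x} K < \<rho>)}"

definition stable_set ::
  "'a::topological_space measure \<Rightarrow> 'a balls \<Rightarrow> ('a \<Rightarrow> 'a) \<Rightarrow>
     ('a measure \<Rightarrow> 'a measure \<Rightarrow> real) \<Rightarrow> 'a measure set \<Rightarrow> bool" where
  "stable_set m B f d K \<longleftrightarrow>
     K \<noteq> {} \<and> K \<subseteq> invariant_measures f \<and> compactin weak_star K \<and>
     (\<exists>A\<in>sets m. 0 < emeasure m A \<and>
        (\<forall>\<rho>>0. \<exists>N. \<forall>n\<ge>N. 1 \<le> n \<longrightarrow> (\<exists>\<epsilon>\<^sub>0>0. \<forall>\<epsilon>. 0 < \<epsilon> \<and> \<epsilon> \<le> \<epsilon>\<^sub>0 \<longrightarrow>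
           (\<forall>x\<in>A. set_dist d {empiric_stochastic m B f \<epsilon> n x} K < \<rho>)))) \<and>
     (\<forall>K'. K' \<noteq> {} \<and> K' \<subseteq> invariant_measures f \<and> compactin weak_star K' \<and>
        (AE x in m. x \<in> set_stability_basin m B f d K \<longrightarrow> x \<in> set_stability_basin m B f d K')
        \<longrightarrow> K \<subseteq> K')"

section \<open>Physical and pseudo-physical measures\<close>

definition empiric :: "('a::topological_space \<Rightarrow> 'a) \<Rightarrow> nat \<Rightarrow> 'a \<Rightarrow> 'a measure" where
  "empiric f n x = average n (\<lambda>j. return borel ((f ^^ j) x))"

definition p_omega :: "('a::topological_space \<Rightarrow> 'a) \<Rightarrow> 'a \<Rightarrow> 'a measure set" where
  "p_omega f x = {\<mu>. \<exists>r. strict_mono r \<and> limitin weak_star (\<lambda>i. empiric f (r i) x) \<mu> sequentially}"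

definition strong_basin :: "('a::topological_space \<Rightarrow> 'a) \<Rightarrow> 'a measure \<Rightarrow> 'a set" where
  "strong_basin f \<mu> = {x. p_omega f x = {\<mu>}}"

definition weak_basin ::
  "('a::topological_space \<Rightarrow> 'a) \<Rightarrow> ('a measure \<Rightarrow> 'a measure \<Rightarrow> real) \<Rightarrow>
     real \<Rightarrow> 'a measure \<Rightarrow> 'a set" where
  "weak_basin f d \<rho> \<mu> = {x. set_dist d (p_omega f x) {\<mu>} < \<rho>}"

definition physical ::
  "'a::topological_space measure \<Rightarrow> ('a \<Rightarrow> 'a) \<Rightarrow> 'a measure \<Rightarrow> bool" where
  "physical m f \<mu> \<longleftrightarrow> \<mu> \<in> invariant_measures f \<and> 0 < emeasure m (strong_basin f \<mu>)"

definition pseudo_physical ::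
  "'a::topological_space measure \<Rightarrow> ('a \<Rightarrow> 'a) \<Rightarrow>
     ('a measure \<Rightarrow> 'a measure \<Rightarrow> real) \<Rightarrow> 'a measure \<Rightarrow> bool" where
  "pseudo_physical m f d \<mu> \<longleftrightarrow>
     \<mu> \<in> invariant_measures f \<and> (\<forall>\<rho>>0. 0 < emeasure m (weak_basin f d \<rho> \<mu>))"

end

theory Submission
  imports Defs
begin

text \<open>
  All the conditions say the same thing: for Lebesgue-almost every \<open>x\<close> the noiseless empiric
  probabilities \<open>\<sigma>\<^sub>n\<^sub>,\<^sub>x\<close> converge to one measure \<open>\<mu>\<close>.

  Noise is negligible at any fixed time. Since a ball of radius \<open>\<epsilon>\<close> is small uniformly in its
  centre, the \<open>j\<close>-th iterate of the dual transfer operator at a Dirac measure stays near the Dirac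
  measure at \<open>f\<^sup>j(x)\<close>, uniformly in \<open>x\<close>; a compactness argument turns this into
  \<open>sup\<^sub>x dist(\<sigma>\<^sub>\<epsilon>\<^sub>,\<^sub>n\<^sub>,\<^sub>x, \<sigma>\<^sub>n\<^sub>,\<^sub>x) \<rightarrow> 0\<close> as \<open>\<epsilon> \<rightarrow> 0\<close> for each \<open>n\<close>
  (\<open>empiric_stochastic_uniformly_near_empiric\<close>). As stability lets \<open>\<epsilon>\<^sub>0\<close> depend on \<open>n\<close>, one
  may replace the noisy averages by the noiseless ones in every stability condition: the basin of
  empiric stochastic stability of \<open>\<mu>\<close> is the set of points with \<open>\<sigma>\<^sub>n\<^sub>,\<^sub>x \<rightarrow> \<mu>\<close>, and so is the strong
  basin of statistical attraction. The uniformity over a set of positive measure that stability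
  asks for is supplied by Egorov's theorem.

  For the pseudo-physical condition, the space of probability measures is compact, hence separable.
  If \<open>\<mu>\<close> is the only pseudo-physical measure, every other invariant measure has a neighbourhood
  that the limit sets \<open>p\<omega>\<^sub>x\<close> avoid for almost every \<open>x\<close>; countably many balls cover all these
  measures, so \<open>p\<omega>\<^sub>x = {\<mu>}\<close> almost everywhere (\<open>unique_pseudo_physical_imp_attracted\<close>).
  The uniqueness claims follow because two almost everywhere limits coincide at some point.

  Two ingredients are of independent interest. Weak-star sequential compactness on a compact
  Hausdorff second countable space is reduced to Helly's selection theorem on the real line, through
  a coding of the points by reals with a continuous inverse. The manifold enters only through four
  facts about the volume and the Riemannian balls: the volume is finite, the balls have positive
  volume, they depend measurably on the centre, and small balls are uniformly small for the
  topology. The last one rests on bump functions that are Lipschitz for the Riemannian distance.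
\<close>

section \<open>Coding a compact space by real numbers\<close>

lemma ternary_weights_sums: "(\<lambda>l. 2 / 3 ^ Suc l :: real) sums 1"
proof -
  have "(\<lambda>l. (2 / 3) * (1 / 3) ^ l :: real) sums ((2 / 3) * (1 / (1 - 1 / 3)))"
    by (intro sums_mult geometric_sums) auto
  then show ?thesis
    by (simp add: field_simps)
qed

text \<open>If the first differing digit has index \<open>j\<close>, it contributes \<open>2 / 3 ^ (j + 1)\<close> to the difference,
  while all later digits together can compensate at most half of that.\<close>
lemma ternary_digits_eq:
  fixes a b :: "nat \<Rightarrow> real"
  assumes a: "\<And>i. a i \<in> {0, 1}" and b: "\<And>i. b i \<in> {0, 1}"
    and close: "\<bar>(\<Sum>i. 2 * a i / 3 ^ Suc i) - (\<Sum>i. 2 * b i / 3 ^ Suc i)\<bar> < 1 / 3 ^ k"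
    and "i < k"
  shows "a i = b i"
proof (rule ccontr)
  assume "a i \<noteq> b i"
  define j where "j = (LEAST j. a j \<noteq> b j)"
  have j: "a j \<noteq> b j" "j \<le> i"
    unfolding j_def using LeastI[of "\<lambda>j. a j \<noteq> b j" i] Least_le[of "\<lambda>j. a j \<noteq> b j" i] \<open>a i \<noteq> b i\<close>
    by auto
  have before: "a l = b l" if "l < j" for l
    using not_less_Least[of l "\<lambda>j. a j \<noteq> b j"] that by (auto simp: j_def)
  define c where "c l = 2 * (a l - b l) / 3 ^ Suc l" for l
  have geo: "(\<lambda>l. 2 / 3 ^ (l + Suc (Suc n)) :: real) sums (1 / 3 ^ Suc n)" for n
  proof -
    have "(\<lambda>l. (2 / 3 ^ Suc (Suc n)) * (1 / 3) ^ l :: real) sums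
        ((2 / 3 ^ Suc (Suc n)) * (1 / (1 - 1 / 3)))"
      by (intro sums_mult geometric_sums) auto
    then show ?thesis
      by (simp add: field_simps power_add)
  qed
  have bd: "\<bar>2 * a l / 3 ^ Suc l\<bar> \<le> 2 / 3 ^ Suc l" "\<bar>2 * b l / 3 ^ Suc l\<bar> \<le> 2 / 3 ^ Suc l"
    "\<bar>c l\<bar> \<le> 2 / 3 ^ Suc l" for l
    using a[of l] b[of l] by (auto simp: c_def abs_mult)
  have sma: "summable (\<lambda>l. 2 * a l / 3 ^ Suc l)" and smb: "summable (\<lambda>l. 2 * b l / 3 ^ Suc l)"
    and smc: "summable c"
    by (rule summable_comparison_test[OF _ sums_summable[OF ternary_weights_sums]]; use bd in auto)+
  have "(\<Sum>l. 2 * a l / 3 ^ Suc l) - (\<Sum>l. 2 * b l / 3 ^ Suc l) = suminf c"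
    unfolding suminf_diff[OF sma smb] c_def by (simp add: diff_divide_distrib right_diff_distrib)
  also have "\<dots> = (\<Sum>l. c (l + Suc j)) + (\<Sum>l<Suc j. c l)"
    by (rule suminf_split_initial_segment[OF smc])
  also have "(\<Sum>l<Suc j. c l) = c j"
    using before by (auto simp: c_def)
  finally have split: "(\<Sum>l. 2 * a l / 3 ^ Suc l) - (\<Sum>l. 2 * b l / 3 ^ Suc l)
      = (\<Sum>l. c (l + Suc j)) + c j" .
  have "\<bar>\<Sum>l. c (l + Suc j)\<bar> \<le> (\<Sum>l. 2 / 3 ^ (l + Suc (Suc j)))"
    unfolding real_norm_def[symmetric]
    by (rule norm_suminf_le) (use bd(3)[of "_ + Suc j"] sums_summable[OF geo[of j]] in auto)
  also have "\<dots> = 1 / 3 ^ Suc j"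
    using geo[of j] by (simp add: sums_iff)
  finally have tail: "\<bar>\<Sum>l. c (l + Suc j)\<bar> \<le> 1 / 3 ^ Suc j" .
  have "\<bar>c j\<bar> = 2 / 3 ^ Suc j"
    using j(1) a[of j] b[of j] by (auto simp: c_def)
  with tail split close have "1 / 3 ^ Suc j < (1 / 3 ^ k :: real)"
    by (simp add: abs_if split: if_splits)
  moreover have "(1 / 3 ^ k :: real) \<le> 1 / 3 ^ Suc j"
    using j(2) \<open>i < k\<close> by (intro divide_left_mono power_increasing) auto
  ultimately show False
    by simp
qed

lemma compact_nested_nonempty:
  fixes F :: "nat \<Rightarrow> 'a::topological_space set"
  assumes "compact (UNIV :: 'a set)" "\<And>k. closed (F k)" "\<And>k. F k \<noteq> {}" "decseq F"
  shows "(\<Inter>k. F k) \<noteq> {}"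
proof -
  have "UNIV \<inter> (\<Inter>k\<in>UNIV. F k) \<noteq> {}"
  proof (rule compact_imp_fip_image[OF assms(1,2)])
    fix I :: "nat set" assume "finite I" "I \<subseteq> UNIV"
    then have "F (Max (insert 0 I)) \<subseteq> (\<Inter>k\<in>I. F k)"
      by (intro INT_greatest decseqD[OF \<open>decseq F\<close>]) simp
    then show "UNIV \<inter> (\<Inter>k\<in>I. F k) \<noteq> {}"
      using assms(3) by blast
  qed
  then show ?thesis by simp
qed

text \<open>A point \<open>x\<close> is coded by the ternary number whose \<open>i\<close>-th digit tells whether \<open>x\<close> lies in the
  \<open>i\<close>-th set of a countable base. The coding \<open>s\<close> is only Borel, but decoding is continuous: nearby
  codes share many digits, and two different accumulation points of points with almost equal codes
  would be separated by two disjoint basic sets, which the common digits forbid. Decoding extends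
  to the closure \<open>K\<close> of the codes by compactness.\<close>
lemma compact_space_continuous_image_of_real_set:
  assumes cpt: "compact (UNIV :: 'a::{t2_space, second_countable_topology} set)"
  obtains s :: "'a::{t2_space, second_countable_topology} \<Rightarrow> real" and K :: "real set"
    and q :: "real \<Rightarrow> 'a::{t2_space, second_countable_topology}"
  where "s \<in> borel_measurable borel" "closed K" "K \<subseteq> {0..1}" "range s \<subseteq> K"
    "continuous_on K q" "\<And>x. q (s x) = x"
proof -
  obtain \<B> :: "'a set set" where cB: "countable \<B>" and tB: "topological_basis \<B>"
    using ex_countable_basis by blast
  then have ne: "\<B> \<noteq> {}"
    by (metis UNIV_I UNIV_not_empty empty_iff open_UNIV topological_basisE)
  define U where "U = from_nat_into \<B>"
  have rU: "range U = \<B>"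
    using cB ne by (simp add: U_def range_from_nat_into)
  have oU: "open (U i)" for i
    using rU tB topological_basis_open by blast
  define s :: "'a \<Rightarrow> real" where "s x = (\<Sum>i. 2 * indicator (U i) x / 3 ^ Suc i)" for x
  have [measurable]: "U i \<in> sets borel" for i using oU by simp
  have smeas: "s \<in> borel_measurable borel"
    unfolding s_def by measurable
  define K where "K = closure (range s)"
  have s01: "s x \<in> {0..1}" for x
  proof -
    have sm: "summable (\<lambda>i. 2 * indicator (U i) x / 3 ^ Suc i :: real)"
      by (rule summable_comparison_test[OF _ sums_summable[OF ternary_weights_sums]])
        (auto simp: indicator_def)
    have "s x \<le> (\<Sum>l. 2 / 3 ^ Suc l)"
      unfolding s_def by (rule suminf_le[OF _ sm sums_summable[OF ternary_weights_sums]]) (auto simp: indicator_def)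
    moreover have "0 \<le> s x"
      unfolding s_def by (rule suminf_nonneg[OF sm]) (auto simp: indicator_def)
    ultimately show ?thesis
      using ternary_weights_sums by (simp add: sums_iff)
  qed
  have K01: "K \<subseteq> {0..1}"
    unfolding K_def using s01 by (intro closure_minimal) auto
  \<comment> \<open>Half the distance that forces \<open>k\<close> common digits, so that two codes within \<open>\<delta> k\<close> of the same
    number share their first \<open>k\<close> digits.\<close>
  define \<delta> :: "nat \<Rightarrow> real" where "\<delta> k = 1 / 3 ^ k / 2" for k
  have \<delta>: "0 < \<delta> k" "\<delta> (Suc k) < \<delta> k" for k
    by (auto simp: \<delta>_def field_simps)
  define E where "E c k = closure {x. \<bar>s x - c\<bar> < \<delta> k}" for c k
  have agree: "x \<in> U i \<longleftrightarrow> y \<in> U i"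
    if "\<bar>s x - c\<bar> < \<delta> (Suc i)" "\<bar>s y - c\<bar> < \<delta> (Suc i)" for x y c i
  proof -
    have "\<bar>s x - s y\<bar> < 1 / 3 ^ Suc i"
    proof -
      have "2 * \<delta> (Suc i) = 1 / 3 ^ Suc i"
        by (simp add: \<delta>_def)
      then show ?thesis
        using that by linarith
    qed
    then have "(indicator (U i) x :: real) = indicator (U i) y"
      unfolding s_def by (intro ternary_digits_eq[of _ _ "Suc i"]) (auto simp: indicator_def)
    then show ?thesis
      by (auto simp: indicator_def split: if_splits)
  qed
  have Edec: "decseq (E c)" for c
    unfolding decseq_Suc_iff E_def using \<delta>(2) by (auto intro!: closure_mono intro: less_trans)
  have Ene: "E c k \<noteq> {}" if "c \<in> K" for c k
  proof -
    obtain y where "y \<in> range s" "dist y c < \<delta> k"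
      using \<open>c \<in> K\<close> \<delta>(1)[of k] unfolding K_def closure_approachable by blast
    then show ?thesis
      unfolding E_def using closure_subset by (fastforce simp: dist_real_def)
  qed
  have unique: "z = w" if z: "\<And>k. z \<in> E c k" and w: "\<And>k. w \<in> E c k" for z w c
  proof (rule ccontr)
    assume "z \<noteq> w"
    then obtain O1 O2 where O: "open O1" "open O2" "z \<in> O1" "w \<in> O2" "O1 \<inter> O2 = {}"
      using hausdorff[of z w] by blast
    obtain i where i: "z \<in> U i" "U i \<subseteq> O1"
      using topological_basisE[OF tB O(1) O(3)] rU by (metis rangeE)
    obtain j where j: "w \<in> U j" "U j \<subseteq> O2"
      using topological_basisE[OF tB O(2) O(4)] rU by (metis rangeE)
    define k where "k = max (Suc i) (Suc j)"
    have mono: "\<delta> k \<le> \<delta> (Suc i)" "\<delta> k \<le> \<delta> (Suc j)"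
      using decseq_SucI[of \<delta>] \<delta>(2) by (auto simp: k_def decseq_def less_imp_le)
    obtain x where x: "x \<in> U i" "\<bar>s x - c\<bar> < \<delta> k"
      using z[of k] oU i(1) unfolding E_def closure_iff_nhds_not_empty by blast
    obtain y where y: "y \<in> U j" "\<bar>s y - c\<bar> < \<delta> k"
      using w[of k] oU j(1) unfolding E_def closure_iff_nhds_not_empty by blast
    have "y \<in> U i"
      using agree[of x c i y] x y mono by auto
    then show False
      using y(1) i j O by blast
  qed
  have small: "\<exists>k. E c k \<subseteq> W" if W: "open W" "z \<in> W" and z: "\<And>k. z \<in> E c k" for c z W
  proof (rule ccontr)
    assume "\<nexists>k. E c k \<subseteq> W"
    then have "(\<Inter>k. E c k \<inter> - W) \<noteq> {}"
      using W Edec[of c] by (intro compact_nested_nonempty[OF cpt]) (auto simp: E_def decseq_def)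
    then show False
      using unique[OF z] W by auto
  qed
  define q where "q c = (SOME z. \<forall>k. z \<in> E c k)" for c
  have q: "q c \<in> E c k" if "c \<in> K" for c k
  proof -
    have "(\<Inter>k. E c k) \<noteq> {}"
      using Ene[OF that] by (intro compact_nested_nonempty[OF cpt] Edec) (auto simp: E_def)
    then have "\<exists>z. \<forall>k. z \<in> E c k" by auto
    from someI_ex[OF this] show ?thesis by (simp add: q_def)
  qed
  have sK: "range s \<subseteq> K"
    unfolding K_def by (rule closure_subset)
  have "q (s x) = x" for x
  proof (rule unique[of _ "s x"])
    show "q (s x) \<in> E (s x) k" for k using q sK by blast
    show "x \<in> E (s x) k" for k
      unfolding E_def using \<delta>(1)[of k] closure_subset by fastforce
  qed
  moreover have "continuous_on K q"
    unfolding continuous_on_topological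
  proof (intro ballI allI impI)
    fix c W assume "c \<in> K" "open W" "q c \<in> W"
    then obtain k where k: "E c k \<subseteq> W"
      using small q by blast
    have "q c' \<in> W" if "c' \<in> K" "c' \<in> ball c (\<delta> k - \<delta> (Suc k))" for c'
    proof -
      have "E c' (Suc k) \<subseteq> E c k"
        unfolding E_def using that by (intro closure_mono) (auto simp: dist_real_def)
      then show ?thesis
        using q[OF that(1)] k by blast
    qed
    then show "\<exists>A. open A \<and> c \<in> A \<and> (\<forall>y\<in>K. y \<in> A \<longrightarrow> q y \<in> W)"
      using \<delta>(2)[of k] by (intro exI[of _ "ball c (\<delta> k - \<delta> (Suc k))"]) auto
  qed
  ultimately show thesis
    using that[of s K q] smeas K01 sK by (simp add: K_def)
qed

section \<open>Weak-star compactness of the space of probability measures\<close>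

lemma prob_measures_iff: "\<mu> \<in> prob_measures \<longleftrightarrow> sets \<mu> = sets borel \<and> prob_space \<mu>"
  by (simp add: prob_measures_def)

lemma measurable_prob_measures:
  "\<mu> \<in> prob_measures \<Longrightarrow> f \<in> borel_measurable borel \<Longrightarrow> f \<in> borel_measurable \<mu>"
  by (simp add: prob_measures_iff cong: measurable_cong_sets)

lemma bounded_continuous_compact_space:
  fixes \<phi> :: "'a::topological_space \<Rightarrow> 'b::real_normed_vector"
  assumes "compact (UNIV :: 'a set)" "continuous_on UNIV \<phi>"
  obtains C where "C > 0" "\<And>x. norm (\<phi> x) \<le> C"
  using compact_imp_bounded[OF compact_continuous_image[OF assms(2,1)]] that
  unfolding bounded_pos by auto

lemma integrable_continuous_prob_measure:
  fixes \<phi> :: "'a::topological_space \<Rightarrow> 'b::{banach, second_countable_topology}"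
  assumes "compact (UNIV :: 'a set)" "\<mu> \<in> prob_measures" "continuous_on UNIV \<phi>"
  shows "integrable \<mu> \<phi>"
proof -
  interpret prob_space \<mu> using assms(2) by (simp add: prob_measures_iff)
  obtain C where "\<And>x. norm (\<phi> x) \<le> C"
    using bounded_continuous_compact_space[OF assms(1,3)] by blast
  then show ?thesis
    using assms by (intro integrable_const_bound[of _ C])
      (auto intro!: measurable_prob_measures borel_measurable_continuous_onI)
qed

lemma topspace_weak_star [simp]: "topspace weak_star = prob_measures"
  unfolding weak_star_def topology_generated_by_topspace
proof (intro equalityI subsetI)
  fix \<mu> :: "'a measure" assume \<mu>: "\<mu> \<in> prob_measures"
  show "\<mu> \<in> \<Union> {{\<mu> \<in> prob_measures. (\<integral>x. \<phi> x \<partial>\<mu>) \<in> V} |(\<phi> :: 'a \<Rightarrow> complex) V.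
      continuous_on UNIV \<phi> \<and> open V}"
    by (rule UnionI[of "{\<mu> \<in> prob_measures. (\<integral>x. (0 :: complex) \<partial>\<mu>) \<in> UNIV}"])
      (use \<mu> in \<open>blast intro: continuous_on_const open_UNIV\<close>, use \<mu> in simp)
qed blast

lemma limitin_weak_star_iff:
  fixes \<mu> :: "'i \<Rightarrow> 'a::topological_space measure"
  assumes "\<forall>\<^sub>F n in F. \<mu> n \<in> prob_measures"
  shows "limitin weak_star \<mu> l F \<longleftrightarrow> l \<in> prob_measures \<and>
    (\<forall>\<phi> :: 'a \<Rightarrow> complex. continuous_on UNIV \<phi> \<longrightarrow> ((\<lambda>n. \<integral>x. \<phi> x \<partial>\<mu> n) \<longlongrightarrow> (\<integral>x. \<phi> x \<partial>l)) F)"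
    (is "_ \<longleftrightarrow> ?R")
proof
  assume L: "limitin weak_star \<mu> l F"
  have "((\<lambda>n. \<integral>x. \<phi> x \<partial>\<mu> n) \<longlongrightarrow> (\<integral>x. \<phi> x \<partial>l)) F"
    if \<phi>: "continuous_on UNIV \<phi>" for \<phi> :: "'a \<Rightarrow> complex"
  proof (rule topological_tendstoI)
    fix V :: "complex set" assume V: "open V" "(\<integral>x. \<phi> x \<partial>l) \<in> V"
    have "openin weak_star {\<nu> \<in> prob_measures. (\<integral>x. \<phi> x \<partial>\<nu>) \<in> V}"
      unfolding weak_star_def using \<phi> V by (intro topology_generated_by_Basis) blast
    then have "\<forall>\<^sub>F n in F. \<mu> n \<in> {\<nu> \<in> prob_measures. (\<integral>x. \<phi> x \<partial>\<nu>) \<in> V}"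
      using L V unfolding limitin_def by auto
    then show "\<forall>\<^sub>F n in F. (\<integral>x. \<phi> x \<partial>\<mu> n) \<in> V"
      by eventually_elim simp
  qed
  then show ?R
    using L by (auto simp: limitin_def)
next
  assume R: ?R
  have "l \<in> W \<longrightarrow> (\<forall>\<^sub>F n in F. \<mu> n \<in> W)"
    if "generate_topology_on {{\<mu> \<in> prob_measures. (\<integral>x. \<phi> x \<partial>\<mu>) \<in> V} | (\<phi> :: 'a \<Rightarrow> complex) V.
        continuous_on UNIV \<phi> \<and> open V} W" for W
    using that
  proof induction
    case (Int a b)
    then show ?case by (auto intro: eventually_conj)
  next
    case (UN K)
    show ?case
    proof
      assume "l \<in> \<Union> K"
      then obtain k where "k \<in> K" "l \<in> k" by blast
      with UN have "\<forall>\<^sub>F n in F. \<mu> n \<in> k" by blast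
      then show "\<forall>\<^sub>F n in F. \<mu> n \<in> \<Union> K"
        by eventually_elim (use \<open>k \<in> K\<close> in blast)
    qed
  next
    case (Basis W)
    then obtain \<phi> :: "'a \<Rightarrow> complex" and V where "W = {\<mu> \<in> prob_measures. (\<integral>x. \<phi> x \<partial>\<mu>) \<in> V}"
      "continuous_on UNIV \<phi>" "open V" by blast
    with R have "((\<lambda>n. \<integral>x. \<phi> x \<partial>\<mu> n) \<longlongrightarrow> (\<integral>x. \<phi> x \<partial>l)) F" by blast
    from topological_tendstoD[OF this \<open>open V\<close>] show ?case
      using assms by (simp add: \<open>W = _\<close> eventually_conj_iff)
  qed simp
  then show "limitin weak_star \<mu> l F"
    using R unfolding limitin_def topspace_weak_star
    unfolding weak_star_def openin_topology_generated_by_iff by blast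
qed

text \<open>The images of the measures under the coding \<open>s\<close> live on a compact set \<open>K\<close> of reals, so they
  are tight and Helly's theorem gives a weakly convergent subsequence. Its limit charges only \<open>K\<close>
  and is carried back by the decoding map \<open>q\<close>; Tietze's theorem makes \<open>\<phi> \<circ> q\<close> a test function on
  the real line.\<close>
lemma prob_measures_sequentially_compact:
  fixes \<mu> :: "nat \<Rightarrow> 'a::{t2_space, second_countable_topology} measure"
  assumes cpt: "compact (UNIV :: 'a set)" and \<mu>: "\<And>n. \<mu> n \<in> prob_measures"
  obtains r l where "strict_mono r" "limitin weak_star (\<mu> \<circ> r) l sequentially"
proof -
  obtain s :: "'a \<Rightarrow> real" and K and q :: "real \<Rightarrow> 'a"
    where s: "s \<in> borel_measurable borel" and K: "closed K" "K \<subseteq> {0..1}" "range s \<subseteq> K"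
      and q: "continuous_on K q" "\<And>x. q (s x) = x"
    using compact_space_continuous_image_of_real_set[OF cpt] by blast
  have Kc: "compact K"
    using K by (meson bounded_closed_interval bounded_subset compact_eq_bounded_closed)
  have Kne: "K \<noteq> {}" using K by auto
  define \<nu> where "\<nu> n = distr (\<mu> n) borel s" for n
  have s\<mu> [measurable]: "s \<in> borel_measurable (\<mu> n)" for n
    using \<mu> s by (rule measurable_prob_measures)
  have ps: "prob_space (\<mu> n)" for n
    using \<mu> by (simp add: prob_measures_iff)
  have rd: "real_distribution (\<nu> n)" for n
    unfolding \<nu>_def by (rule prob_space.real_distribution_distr[OF ps]) simp
  have "measure (\<nu> n) {-1<..1} = 1" for n
  proof -
    have "s -` {-1<..1} \<inter> space (\<mu> n) = space (\<mu> n)"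
      using K by fastforce
    then show ?thesis
      unfolding \<nu>_def by (simp add: measure_distr prob_space.prob_space[OF ps])
  qed
  then have "\<exists>a b. a < b \<and> (\<forall>n. 1 - e < measure (\<nu> n) {a<..b})" if "e > 0" for e :: real
    using that by (intro exI[of _ "-1::real"] exI[of _ "1::real"]) simp
  then have "tight \<nu>"
    unfolding tight_def using rd by blast
  then obtain r M where r: "strict_mono r" and M: "real_distribution M"
    and wc: "weak_conv_m (\<nu> \<circ> r) M"
    using tight_imp_convergent_subsubsequence[of \<nu> id] by (auto simp: strict_mono_def)
  interpret M: real_distribution M by fact
  have conv: "(\<lambda>n. \<integral>x. h x \<partial>\<nu> (r n)) \<longlonglongrightarrow> (\<integral>x. h x \<partial>M)"
    if "\<And>x. isCont h x" "\<And>x. norm (h x) \<le> C"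
    for h :: "real \<Rightarrow> 'b::{banach, second_countable_topology}" and C
    using weak_conv_imp_integral_bdd_continuous_conv[of "\<nu> \<circ> r" M h C] wc M rd that by simp
  have MK: "AE x in M. x \<in> K"
  proof -
    \<comment> \<open>A bounded continuous function that vanishes exactly on \<open>K\<close>.\<close>
    define h where "h x = min 1 (infdist x K)" for x :: real
    have hc: "isCont h x" for x unfolding h_def by (intro continuous_intros)
    have hm [measurable]: "h \<in> borel_measurable borel"
      using hc by (intro borel_measurable_continuous_onI continuous_at_imp_continuous_on) auto
    have hb: "norm (h x) \<le> 1" "0 \<le> h x" for x unfolding h_def by (auto simp: infdist_nonneg)
    have "(\<integral>x. h x \<partial>\<nu> n) = 0" for n
    proof -
      have "h (s x) = 0" for x
        using infdist_zero[of "s x" K] K(3) by (simp add: h_def range_subsetD)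
      then show ?thesis
        unfolding \<nu>_def by (subst integral_distr) auto
    qed
    then have "(\<integral>x. h x \<partial>M) = 0"
      using conv[OF hc hb(1)] by (simp add: LIMSEQ_const_iff)
    moreover have "integrable M h"
      using hb by (intro M.integrable_const_bound[of _ 1]) auto
    ultimately have "AE x in M. h x = 0"
      using integral_nonneg_eq_0_iff_AE[of M h] hb by auto
    then show ?thesis
      by eventually_elim (use K(1) Kne in \<open>auto simp: h_def in_closed_iff_infdist_zero min_def split: if_splits\<close>)
  qed
  \<comment> \<open>The constant off \<open>K\<close> is arbitrary; it makes the decoding map Borel on the whole line.\<close>
  define Q where "Q c = (if c \<in> K then q c else q 0)" for c
  have Kb [measurable]: "K \<in> sets borel" using K(1) by simp
  have Qm: "Q \<in> borel_measurable borel"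
    unfolding Q_def using borel_measurable_continuous_on_if[OF Kb q(1) continuous_on_const] by simp
  define l where "l = distr M borel Q"
  have QM: "Q \<in> borel_measurable M" using Qm by simp
  have l: "l \<in> prob_measures"
    unfolding l_def prob_measures_iff using QM by (auto intro: M.prob_space_distr)
  have "(\<lambda>n. \<integral>x. \<phi> x \<partial>\<mu> (r n)) \<longlonglongrightarrow> (\<integral>x. \<phi> x \<partial>l)"
    if \<phi>: "continuous_on UNIV \<phi>" for \<phi> :: "'a \<Rightarrow> complex"
  proof -
    obtain C where C: "C > 0" "\<And>x. norm (\<phi> x) \<le> C"
      using bounded_continuous_compact_space[OF cpt \<phi>] by blast
    have "continuous_on K (\<lambda>c. \<phi> (q c))"
      using continuous_on_compose2[OF \<phi> q(1)] by simp
    then obtain \<Phi> where \<Phi>: "continuous_on UNIV \<Phi>" "\<And>c. c \<in> K \<Longrightarrow> \<Phi> c = \<phi> (q c)"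
      "\<And>c. norm (\<Phi> c) \<le> C"
      by (rule Tietze[of K "\<lambda>c. \<phi> (q c)" UNIV C]) (use K(1) C in \<open>simp_all add: less_imp_le\<close>)
    have \<Phi>m [measurable]: "\<Phi> \<in> borel_measurable borel"
      using \<Phi>(1) by (rule borel_measurable_continuous_onI)
    have \<phi>m [measurable]: "\<phi> \<in> borel_measurable borel"
      using \<phi> by (rule borel_measurable_continuous_onI)
    have "(\<integral>x. \<Phi> x \<partial>\<nu> n) = (\<integral>x. \<phi> x \<partial>\<mu> n)" for n
    proof -
      have "\<Phi> (s x) = \<phi> x" for x
        using \<Phi>(2)[of "s x"] K(3) q(2) by auto
      then show ?thesis
        unfolding \<nu>_def by (subst integral_distr) auto
    qed
    moreover have "(\<integral>x. \<Phi> x \<partial>M) = (\<integral>x. \<phi> x \<partial>l)"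
    proof -
      have "(\<integral>x. \<phi> x \<partial>l) = (\<integral>x. \<phi> (Q x) \<partial>M)"
        unfolding l_def using QM by (subst integral_distr) auto
      also have "\<dots> = (\<integral>x. \<Phi> x \<partial>M)"
      proof (rule integral_cong_AE)
        show "(\<lambda>x. \<phi> (Q x)) \<in> borel_measurable M"
          by (rule measurable_compose[OF QM \<phi>m])
        show "AE x in M. \<phi> (Q x) = \<Phi> x"
          using MK by eventually_elim (simp add: Q_def \<Phi>(2))
      qed simp
      finally show ?thesis ..
    qed
    ultimately show ?thesis
      using conv[of \<Phi> C] \<Phi> by (simp add: continuous_on_eq_continuous_at)
  qed
  then have "limitin weak_star (\<mu> \<circ> r) l sequentially"
    using \<mu> l by (subst limitin_weak_star_iff) auto
  with r show thesis by (rule that)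
qed

section \<open>Mixtures and averages of probability measures\<close>

lemma (in prob_space) norm_integral_le_const:
  fixes h :: "'a \<Rightarrow> 'b::{banach, second_countable_topology}"
  assumes "AE x in M. norm (h x) \<le> c" "0 \<le> c"
  shows "norm (\<integral>x. h x \<partial>M) \<le> c"
proof (cases "integrable M h")
  case True
  have "norm (\<integral>x. h x \<partial>M) \<le> (\<integral>x. norm (h x) \<partial>M)"
    by (rule integral_norm_bound)
  also have "\<dots> \<le> c"
    using assms True by (intro integral_le_const) auto
  finally show ?thesis .
next
  case False
  then show ?thesis using assms by (simp add: not_integrable_integral_eq)
qed

text \<open>Integration against a mixture, for complex integrands: real and imaginary parts are treated
  separately.\<close>
lemma integral_bind_complex:
  fixes h :: "'b \<Rightarrow> complex"
  assumes h [measurable]: "h \<in> borel_measurable K" and C: "\<And>x. norm (h x) \<le> C"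
    and N: "N \<in> M \<rightarrow>\<^sub>M prob_algebra K" and M: "prob_space M"
  shows "(\<integral>x. h x \<partial>(M \<bind> N)) = (\<integral>x. (\<integral>y. h y \<partial>N x) \<partial>M)"
proof -
  interpret M: prob_space M by fact
  have C0: "0 \<le> C" using C[of undefined] norm_ge_zero order_trans by blast
  have N' [measurable]: "N \<in> M \<rightarrow>\<^sub>M subprob_algebra K"
    using N by (rule measurable_prob_algebraD)
  have Nx: "prob_space (N x)" "sets (N x) = sets K" if "x \<in> space M" for x
    using measurable_space[OF N that] by (auto simp: space_prob_algebra)
  have pb: "prob_space (M \<bind> N)"
    using Nx by (intro M.prob_space_bind[OF _ N'] AE_I2) auto
  have sb: "sets (M \<bind> N) = sets K"
    using Nx M.not_empty by (intro sets_bind) auto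
  have ib: "integrable (M \<bind> N) h"
    using C sb by (intro finite_measure.integrable_const_bound[of _ _ C])
      (auto intro: prob_space.finite_measure pb simp: measurable_cong_sets[OF sb refl])
  have iN: "integrable (N x) h" if "x \<in> space M" for x
    using C Nx[OF that] by (intro finite_measure.integrable_const_bound[of _ _ C])
      (auto intro: prob_space.finite_measure simp: measurable_cong_sets[OF Nx(2)[OF that] refl])
  have m: "(\<lambda>x. \<integral>y. h y \<partial>N x) \<in> borel_measurable M"
    by (rule measurable_compose[OF N' integral_measurable_subprob_algebra]) simp
  have i2: "integrable M (\<lambda>x. \<integral>y. h y \<partial>N x)"
    using C C0 Nx by (intro M.integrable_const_bound[of _ C] m)
      (auto intro!: AE_I2 prob_space.norm_integral_le_const)
  have part: "(\<integral>x. p x \<partial>(M \<bind> N)) = (\<integral>x. (\<integral>y. p y \<partial>N x) \<partial>M)"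
    if "p \<in> borel_measurable K" "\<And>x. \<bar>p x\<bar> \<le> C" for p :: "'b \<Rightarrow> real"
    using that N' Nx by (intro integral_bind[where B = C and B' = 1 and K = K])
      (auto intro!: AE_I2 M.finite_measure prob_space.emeasure_space_1[THEN eq_refl])
  show ?thesis
  proof (rule complex_eqI)
    have "Re (\<integral>x. h x \<partial>(M \<bind> N)) = (\<integral>x. Re (h x) \<partial>(M \<bind> N))"
      using ib by simp
    also have "\<dots> = (\<integral>x. (\<integral>y. Re (h y) \<partial>N x) \<partial>M)"
      using order_trans[OF abs_Re_le_cmod C] by (intro part) auto
    also have "\<dots> = (\<integral>x. Re (\<integral>y. h y \<partial>N x) \<partial>M)"
      using iN by (intro Bochner_Integration.integral_cong) auto
    also have "\<dots> = Re (\<integral>x. (\<integral>y. h y \<partial>N x) \<partial>M)"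
      using i2 by simp
    finally show "Re (\<integral>x. h x \<partial>(M \<bind> N)) = Re (\<integral>x. (\<integral>y. h y \<partial>N x) \<partial>M)" .
  next
    have "Im (\<integral>x. h x \<partial>(M \<bind> N)) = (\<integral>x. Im (h x) \<partial>(M \<bind> N))"
      using ib by simp
    also have "\<dots> = (\<integral>x. (\<integral>y. Im (h y) \<partial>N x) \<partial>M)"
      using order_trans[OF abs_Im_le_cmod C] by (intro part) auto
    also have "\<dots> = (\<integral>x. Im (\<integral>y. h y \<partial>N x) \<partial>M)"
      using iN by (intro Bochner_Integration.integral_cong) auto
    also have "\<dots> = Im (\<integral>x. (\<integral>y. h y \<partial>N x) \<partial>M)"
      using i2 by simp
    finally show "Im (\<integral>x. h x \<partial>(M \<bind> N)) = Im (\<integral>x. (\<integral>y. h y \<partial>N x) \<partial>M)" .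
  qed
qed

text \<open>The average is the mixture of the measures over a uniformly chosen index; this makes it a
  probability measure and computes its integrals.\<close>
lemma
  fixes \<mu> :: "nat \<Rightarrow> 'a::topological_space measure"
  assumes n: "1 \<le> n" and \<mu>: "\<And>j. \<mu> j \<in> prob_measures"
  shows average_prob_measures: "average n \<mu> \<in> prob_measures"
    and integral_average: "\<And>h :: 'a \<Rightarrow> complex. h \<in> borel_measurable borel \<Longrightarrow> (\<And>x. norm (h x) \<le> C) \<Longrightarrow>
      (\<integral>x. h x \<partial>average n \<mu>) = (\<Sum>j=1..n. \<integral>x. h x \<partial>\<mu> j) / of_nat n"
proof -
  define I where "I = measure_pmf (pmf_of_set {1..n})"
  have ne: "{1..n} \<noteq> {}" using n by simp
  have \<mu>m: "\<mu> \<in> I \<rightarrow>\<^sub>M prob_algebra borel"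
    using \<mu> by (auto simp: I_def measurable_def prob_measures_iff space_prob_algebra)
  have pI: "prob_space I"
    unfolding I_def by (rule measure_pmf.prob_space_axioms)
  have Ip: "I \<in> space (prob_algebra I)"
    using pI by (simp add: space_prob_algebra)
  have sets_b: "sets (I \<bind> \<mu>) = sets borel"
    by (rule sets_bind'[OF Ip \<mu>m])
  have "emeasure (I \<bind> \<mu>) A = (\<Sum>j=1..n. emeasure (\<mu> j) A) / of_nat n" if "A \<in> sets borel" for A
    unfolding emeasure_bind_prob_algebra[OF Ip \<mu>m that]
    unfolding I_def by (subst nn_integral_pmf_of_set[OF ne]) auto
  then have "average n \<mu> = measure_of UNIV (sets borel) (emeasure (I \<bind> \<mu>))"
    unfolding average_def by (intro measure_of_eq) (auto simp: sets.sigma_sets_eq[of borel, simplified])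
  also have "\<dots> = I \<bind> \<mu>"
    using measure_of_of_measure[of "I \<bind> \<mu>"] sets_eq_imp_space_eq[OF sets_b] sets_b by simp
  finally have eq: "average n \<mu> = I \<bind> \<mu>" .
  show "average n \<mu> \<in> prob_measures"
    unfolding eq prob_measures_iff using sets_b prob_space_bind'[OF Ip \<mu>m] by simp
  fix h :: "'a \<Rightarrow> complex" assume h: "h \<in> borel_measurable borel" "\<And>x. norm (h x) \<le> C"
  have "(\<integral>x. h x \<partial>average n \<mu>) = (\<integral>j. (\<integral>x. h x \<partial>\<mu> j) \<partial>I)"
    unfolding eq by (rule integral_bind_complex[OF h \<mu>m pI])
  also have "\<dots> = (\<Sum>j=1..n. (\<integral>x. h x \<partial>\<mu> j) * of_real (pmf (pmf_of_set {1..n}) j))"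
    unfolding I_def using ne
    by (subst integral_measure_pmf[of "{1..n}"]) (auto simp: set_pmf_of_set scaleR_conv_of_real mult.commute)
  also have "\<dots> = (\<Sum>j=1..n. \<integral>x. h x \<partial>\<mu> j) / of_nat n"
    using ne n by (simp add: sum_divide_distrib)
  finally show "(\<integral>x. h x \<partial>average n \<mu>) = (\<Sum>j=1..n. \<integral>x. h x \<partial>\<mu> j) / of_nat n" .
qed

text \<open>The part of Egorov's theorem that is needed here: \<open>A\<close> arises by removing, for each \<open>k\<close>, a set
  of measure at most a fraction \<open>1 / 2 ^ (k + 2)\<close> of the whole, on which \<open>h n\<close> exceeds
  \<open>1 / (k + 1)\<close> for some late \<open>n\<close>; at least half of the measure remains.\<close>
lemma (in finite_measure) uniform_convergence_on_positive_set:
  fixes h :: "nat \<Rightarrow> 'a \<Rightarrow> real"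
  assumes h [measurable]: "\<And>n. h n \<in> borel_measurable M"
    and lim: "AE x in M. (\<lambda>n. h n x) \<longlonglongrightarrow> 0" and pos: "0 < measure M (space M)"
  obtains A where "A \<in> sets M" "0 < emeasure M A"
    "\<And>\<rho>. 0 < \<rho> \<Longrightarrow> \<exists>N. \<forall>n\<ge>N. \<forall>x\<in>A. h n x < \<rho>"
proof -
  define G where "G k N = {x \<in> space M. \<exists>n\<ge>N. 1 / real (Suc k) \<le> h n x}" for k N
  have G [measurable]: "G k N \<in> sets M" for k N
    unfolding G_def by measurable
  have "\<exists>N. measure M (G k N) < measure M (space M) * (1 / 2) ^ Suc (Suc k)" for k
  proof -
    have dec: "decseq (G k)"
      unfolding decseq_def G_def by (auto intro: order_trans)
    have "AE x in M. x \<notin> (\<Inter>N. G k N)"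
      using lim
    proof eventually_elim
      case (elim x)
      from order_tendstoD(2)[OF this, of "1 / real (Suc k)"]
      obtain N where "\<forall>n\<ge>N. h n x < 1 / real (Suc k)"
        by (auto simp: eventually_sequentially)
      then have "x \<notin> G k N" by (auto simp: G_def not_le)
      then show ?case by blast
    qed
    then have "measure M (\<Inter>N. G k N) = 0"
      by (subst measure_eq_0_null_sets) (auto intro!: AE_iff_null_sets[THEN iffD2])
    then have "(\<lambda>N. measure M (G k N)) \<longlonglongrightarrow> 0"
      using finite_Lim_measure_decseq[OF _ dec] by (simp add: image_subset_iff)
    then have "\<forall>\<^sub>F N in sequentially. measure M (G k N) < measure M (space M) * (1 / 2) ^ Suc (Suc k)"
      using pos by (intro order_tendstoD(2)) auto
    then show ?thesis by (auto simp: eventually_sequentially)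
  qed
  then obtain N where N: "\<And>k. measure M (G k (N k)) < measure M (space M) * (1 / 2) ^ Suc (Suc k)"
    by metis
  define A where "A = space M - (\<Union>k. G k (N k))"
  have half: "(\<lambda>k. measure M (space M) * (1 / 2) ^ Suc (Suc k)) sums (measure M (space M) / 2)"
  proof -
    have "(\<lambda>k. (measure M (space M) / 4) * (1 / 2) ^ k) sums ((measure M (space M) / 4) * (1 / (1 - 1 / 2)))"
      by (intro sums_mult geometric_sums) auto
    then show ?thesis by (simp add: field_simps)
  qed
  have smG: "summable (\<lambda>k. measure M (G k (N k)))"
    by (rule summable_comparison_test'[OF sums_summable[OF half]]) (use N in \<open>auto intro: less_imp_le\<close>)
  have "measure M (\<Union>k. G k (N k)) \<le> (\<Sum>k. measure M (G k (N k)))"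
    by (rule finite_measure_subadditive_countably[OF _ smG]) auto
  also have "\<dots> \<le> (\<Sum>k. measure M (space M) * (1 / 2) ^ Suc (Suc k))"
    using N by (intro suminf_le smG sums_summable[OF half]) (auto intro: less_imp_le)
  also have "\<dots> = measure M (space M) / 2"
    using half by (simp add: sums_iff)
  finally have "measure M (\<Union>k. G k (N k)) \<le> measure M (space M) / 2" .
  moreover have "measure M A = measure M (space M) - measure M (\<Union>k. G k (N k))"
    unfolding A_def by (rule finite_measure_compl) auto
  ultimately have "0 < measure M A"
    using pos by linarith
  then have "0 < emeasure M A"
    by (simp add: emeasure_eq_measure)
  moreover have "A \<in> sets M" unfolding A_def by measurable
  moreover have "\<exists>N. \<forall>n\<ge>N. \<forall>x\<in>A. h n x < \<rho>" if \<rho>: "0 < \<rho>" for \<rho>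
  proof -
    obtain k where k: "1 / real (Suc k) < \<rho>"
      using nat_approx_posE[OF \<rho>] by (auto simp: inverse_eq_divide)
    have "h n x < \<rho>" if "n \<ge> N k" "x \<in> A" for n x
    proof -
      have "x \<notin> G k (N k)" "x \<in> space M" using that(2) by (auto simp: A_def)
      then have "h n x < 1 / real (Suc k)"
        using that(1) unfolding G_def by (metis (mono_tags, lifting) mem_Collect_eq not_le)
      then show ?thesis using k by linarith
    qed
    then show ?thesis by blast
  qed
  ultimately show thesis using that by blast
qed

section \<open>Maps with small random perturbations\<close>

text \<open>The facts about a manifold, its volume and its balls on which the dynamical argument
  depends. In \<open>ball_small\<close>, uniform smallness is expressed by continuous functions and not by a
  metric, which fits the weak-star topology.\<close>

locale noisy_map =
  fixes m :: "'a::{t2_space, second_countable_topology} measure"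
    and B :: "'a balls" and f :: "'a \<Rightarrow> 'a" and d :: "'a measure \<Rightarrow> 'a measure \<Rightarrow> real"
  assumes compact_space: "compact (UNIV :: 'a set)"
    and sets_m [measurable_cong]: "sets m = sets borel"
    and finite_m: "finite_measure m"
    and cont_f: "continuous_on UNIV f"
    and metric: "weak_star_metric d"
    and ball_graph: "\<And>\<epsilon>. 0 < \<epsilon> \<Longrightarrow> {(x, y). y \<in> B \<epsilon> x} \<in> sets (borel \<Otimes>\<^sub>M borel)"
    and ball_pos: "\<And>\<epsilon> x. 0 < \<epsilon> \<Longrightarrow> 0 < emeasure m (B \<epsilon> x)"
    and ball_small: "\<And>(\<phi> :: 'a \<Rightarrow> complex) \<eta>. continuous_on UNIV \<phi> \<Longrightarrow> 0 < \<eta> \<Longrightarrow>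
      \<exists>\<epsilon>\<^sub>0>0. \<forall>\<epsilon>. 0 < \<epsilon> \<and> \<epsilon> \<le> \<epsilon>\<^sub>0 \<longrightarrow> (\<forall>x. \<forall>y\<in>B \<epsilon> x. norm (\<phi> y - \<phi> x) < \<eta>)"
begin

sublocale m: finite_measure m by (rule finite_m)

sublocale W: Metric_space prob_measures d
  using metric by (simp add: weak_star_metric_def)

lemma mtopology_eq: "W.mtopology = weak_star"
  using metric by (simp add: weak_star_metric_def)

lemma space_m [simp]: "space m = UNIV"
  using sets_eq_imp_space_eq[OF sets_m] by simp

lemma f_measurable [measurable]: "f \<in> borel \<rightarrow>\<^sub>M borel"
  using cont_f by (rule borel_measurable_continuous_onI)

lemma dist_tendsto_iff:
  assumes "\<forall>\<^sub>F n in F. \<mu> n \<in> prob_measures" "l \<in> prob_measures"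
  shows "((\<lambda>n. d (\<mu> n) l) \<longlongrightarrow> 0) F \<longleftrightarrow>
    (\<forall>\<phi> :: 'a \<Rightarrow> complex. continuous_on UNIV \<phi> \<longrightarrow> ((\<lambda>n. \<integral>x. \<phi> x \<partial>\<mu> n) \<longlongrightarrow> (\<integral>x. \<phi> x \<partial>l)) F)"
  using W.limitin_metric_dist_null[of \<mu> l F] limitin_weak_star_iff[of \<mu> F l] assms
  by (simp add: mtopology_eq)

text \<open>Measures with the same integrals are topologically indistinguishable, and the topology is
  metrizable by assumption.\<close>
lemma prob_measures_eqI:
  assumes \<mu>: "\<mu> \<in> prob_measures" "\<nu> \<in> prob_measures"
    and "\<And>\<phi> :: 'a \<Rightarrow> complex. continuous_on UNIV \<phi> \<Longrightarrow> (\<integral>x. \<phi> x \<partial>\<mu>) = (\<integral>x. \<phi> x \<partial>\<nu>)"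
  shows "\<mu> = \<nu>"
proof -
  have "((\<lambda>n. d \<mu> \<nu>) \<longlongrightarrow> 0) sequentially"
    using assms by (subst dist_tendsto_iff) auto
  then have "d \<mu> \<nu> = 0" by (simp add: LIMSEQ_const_iff)
  then show ?thesis using \<mu> by simp
qed

lemma ball_measurable [measurable]: "0 < \<epsilon> \<Longrightarrow> B \<epsilon> x \<in> sets borel"
  using sets_Pair1[OF ball_graph, of \<epsilon> x] by (simp add: vimage_def)

text \<open>Fubini's theorem, applied to the graph of the balls.\<close>
lemma transition_measurable:
  assumes "0 < \<epsilon>"
  shows "transition m B f \<epsilon> \<in> borel \<rightarrow>\<^sub>M prob_algebra borel"
proof -
  have fin: "emeasure m (B \<epsilon> x) \<noteq> \<infinity>" for x by simp
  have p: "prob_space (uniform_measure m (B \<epsilon> x))" for x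
    using ball_pos[OF assms, of x] by (intro prob_space_uniform_measure) auto
  have "(\<lambda>x. uniform_measure m (B \<epsilon> x)) \<in> borel \<rightarrow>\<^sub>M prob_algebra borel"
  proof (intro measurable_prob_algebraI measurable_subprob_algebra p prob_space_imp_subprob_space)
    fix A :: "'a set" assume A [measurable]: "A \<in> sets borel"
    have "{(x, y). y \<in> B \<epsilon> x} \<inter> (UNIV \<times> A) \<in> sets (borel \<Otimes>\<^sub>M m)"
      using ball_graph[OF assms] by (simp cong: sets_pair_measure_cong add: sets_m)
    then have "(\<lambda>x. emeasure m (Pair x -` ({(x, y). y \<in> B \<epsilon> x} \<inter> (UNIV \<times> A)))) \<in> borel_measurable borel"
      by (rule m.measurable_emeasure_Pair)
    moreover have "{(x, y). y \<in> B \<epsilon> x} \<in> sets (borel \<Otimes>\<^sub>M m)"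
      using ball_graph[OF assms] by (simp cong: sets_pair_measure_cong add: sets_m)
    then have "(\<lambda>x. emeasure m (Pair x -` {(x, y). y \<in> B \<epsilon> x})) \<in> borel_measurable borel"
      by (rule m.measurable_emeasure_Pair)
    ultimately have "(\<lambda>x. emeasure m (B \<epsilon> x \<inter> A) / emeasure m (B \<epsilon> x)) \<in> borel_measurable borel"
      by (simp add: vimage_def Int_def conj_commute)
    then show "(\<lambda>x. emeasure (uniform_measure m (B \<epsilon> x)) A) \<in> borel_measurable borel"
      using assms by (simp add: sets_m)
  qed (simp_all add: sets_m)
  from measurable_compose[OF f_measurable this] show ?thesis
    by (simp add: transition_def[abs_def])
qed

lemma
  assumes "0 < \<epsilon>"
  shows prob_space_transition: "prob_space (transition m B f \<epsilon> x)"
    and sets_transition: "sets (transition m B f \<epsilon> x) = sets borel"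
  using measurable_space[OF transition_measurable[OF assms], of x] by (auto simp: space_prob_algebra)

lemma transfer_measurable:
  assumes "0 < \<epsilon>" "\<phi> \<in> borel_measurable borel"
  shows "transfer m B f \<epsilon> \<phi> \<in> borel_measurable borel"
  unfolding transfer_def[abs_def]
  by (rule measurable_compose[OF measurable_prob_algebraD[OF transition_measurable]
        integral_measurable_subprob_algebra]) fact+

text \<open>The measure characterized by duality exists: it is the mixture of the transition
  probabilities over \<open>\<mu>\<close>.\<close>
lemma
  assumes \<epsilon>: "0 < \<epsilon>" and \<mu>: "\<mu> \<in> prob_measures"
  shows dual_transfer_prob_measures: "dual_transfer m B f \<epsilon> \<mu> \<in> prob_measures"
    and integral_dual_transfer: "\<And>\<phi>. continuous_on UNIV \<phi> \<Longrightarrow>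
      (\<integral>x. \<phi> x \<partial>dual_transfer m B f \<epsilon> \<mu>) = (\<integral>x. transfer m B f \<epsilon> \<phi> x \<partial>\<mu>)"
proof -
  define P where "P \<nu> \<longleftrightarrow> \<nu> \<in> prob_measures \<and>
     (\<forall>\<phi>. continuous_on UNIV \<phi> \<longrightarrow> (\<integral>x. \<phi> x \<partial>\<nu>) = (\<integral>x. transfer m B f \<epsilon> \<phi> x \<partial>\<mu>))" for \<nu>
  have p\<mu>: "prob_space \<mu>" and T: "transition m B f \<epsilon> \<in> \<mu> \<rightarrow>\<^sub>M prob_algebra borel"
    using \<mu> transition_measurable[OF \<epsilon>] by (auto simp: prob_measures_iff cong: measurable_cong_sets)
  have \<mu>p: "\<mu> \<in> space (prob_algebra \<mu>)"
    using p\<mu> by (simp add: space_prob_algebra)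
  have "P (\<mu> \<bind> transition m B f \<epsilon>)"
    unfolding P_def
  proof (intro conjI allI impI)
    show "\<mu> \<bind> transition m B f \<epsilon> \<in> prob_measures"
      unfolding prob_measures_iff using prob_space_bind'[OF \<mu>p T] sets_bind'[OF \<mu>p T] by simp
    fix \<phi> :: "'a \<Rightarrow> complex" assume \<phi>: "continuous_on UNIV \<phi>"
    obtain C where C: "\<And>x. norm (\<phi> x) \<le> C"
      using bounded_continuous_compact_space[OF compact_space \<phi>] by blast
    show "(\<integral>x. \<phi> x \<partial>(\<mu> \<bind> transition m B f \<epsilon>)) = (\<integral>x. transfer m B f \<epsilon> \<phi> x \<partial>\<mu>)"
      unfolding transfer_def
      by (rule integral_bind_complex[OF borel_measurable_continuous_onI[OF \<phi>] C T p\<mu>])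
  qed
  moreover have "\<nu> = \<nu>'" if "P \<nu>" "P \<nu>'" for \<nu> \<nu>'
    using that by (intro prob_measures_eqI) (auto simp: P_def)
  ultimately have "P (THE \<nu>. P \<nu>)"
    by (metis theI)
  then show "dual_transfer m B f \<epsilon> \<mu> \<in> prob_measures"
    "\<And>\<phi>. continuous_on UNIV \<phi> \<Longrightarrow>
      (\<integral>x. \<phi> x \<partial>dual_transfer m B f \<epsilon> \<mu>) = (\<integral>x. transfer m B f \<epsilon> \<phi> x \<partial>\<mu>)"
    by (auto simp: P_def dual_transfer_def)
qed

lemma transfer_near:
  fixes \<phi> :: "'a \<Rightarrow> complex"
  assumes \<epsilon>: "0 < \<epsilon>" and \<phi>: "continuous_on UNIV \<phi>"
    and near: "\<And>x y. y \<in> B \<epsilon> x \<Longrightarrow> norm (\<phi> y - \<phi> x) \<le> \<eta>" and "0 \<le> \<eta>"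
  shows "norm (transfer m B f \<epsilon> \<phi> x - \<phi> (f x)) \<le> \<eta>"
proof -
  interpret T: prob_space "transition m B f \<epsilon> x"
    by (rule prob_space_transition[OF \<epsilon>])
  have "integrable (transition m B f \<epsilon> x) \<phi>"
    using \<phi> \<epsilon> T.prob_space_axioms sets_transition
    by (intro integrable_continuous_prob_measure[OF compact_space]) (auto simp: prob_measures_iff)
  then have "transfer m B f \<epsilon> \<phi> x - \<phi> (f x) = (\<integral>y. \<phi> y - \<phi> (f x) \<partial>transition m B f \<epsilon> x)"
    unfolding transfer_def by (simp add: T.prob_space)
  also have "norm \<dots> \<le> \<eta>"
  proof (rule T.norm_integral_le_const[OF _ \<open>0 \<le> \<eta>\<close>])
    show "AE y in transition m B f \<epsilon> x. norm (\<phi> y - \<phi> (f x)) \<le> \<eta>"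
      unfolding transition_def using near \<epsilon> by (intro AE_uniform_measureI) (auto simp: sets_m)
  qed
  finally show ?thesis .
qed

lemma return_prob_measures: "return borel x \<in> prob_measures"
  by (simp add: prob_measures_iff prob_space_return)

lemma integral_return_continuous:
  "continuous_on UNIV (\<phi> :: 'a \<Rightarrow> complex) \<Longrightarrow> (\<integral>y. \<phi> y \<partial>return borel x) = \<phi> x"
  by (intro integral_return borel_measurable_continuous_onI) auto

lemma dual_iterate_prob_measures:
  "0 < \<epsilon> \<Longrightarrow> (dual_transfer m B f \<epsilon> ^^ j) (return borel x) \<in> prob_measures"
  by (induction j) (auto simp: return_prob_measures dual_transfer_prob_measures)

lemma continuous_iterate: "continuous_on UNIV (f ^^ j)"
proof (induction j)
  case (Suc j)
  then show ?case
    using continuous_on_compose[OF Suc, of f] cont_f by (simp add: continuous_on_subset)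
qed (simp add: id_def)

text \<open>One step of the noisy chain differs little from one step of \<open>f\<close>, uniformly in the starting
  point, so the claim for \<open>\<phi>\<close> and \<open>j + 1\<close> steps reduces to the claim for \<open>\<phi> \<circ> f\<close> and \<open>j\<close> steps.\<close>
lemma dual_iterate_near_orbit:
  fixes \<phi> :: "'a \<Rightarrow> complex"
  assumes "continuous_on UNIV \<phi>" "0 < \<eta>"
  shows "\<exists>\<epsilon>\<^sub>0>0. \<forall>\<epsilon>. 0 < \<epsilon> \<and> \<epsilon> \<le> \<epsilon>\<^sub>0 \<longrightarrow>
    (\<forall>x. norm ((\<integral>y. \<phi> y \<partial>(dual_transfer m B f \<epsilon> ^^ j) (return borel x)) - \<phi> ((f ^^ j) x)) < \<eta>)"
  using assms
proof (induction j arbitrary: \<phi> \<eta>)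
  case 0
  then show ?case by (intro exI[of _ 1]) (simp add: integral_return_continuous)
next
  case (Suc j)
  have \<phi>f: "continuous_on UNIV (\<lambda>x. \<phi> (f x))"
    using continuous_on_compose2[OF Suc.prems(1) cont_f] by simp
  obtain e1 where e1: "e1 > 0" "\<And>\<epsilon> x. 0 < \<epsilon> \<Longrightarrow> \<epsilon> \<le> e1 \<Longrightarrow>
      norm ((\<integral>y. \<phi> (f y) \<partial>(dual_transfer m B f \<epsilon> ^^ j) (return borel x)) - \<phi> (f ((f ^^ j) x))) < \<eta> / 2"
    using Suc.IH[OF \<phi>f half_gt_zero[OF Suc.prems(2)]] by blast
  obtain e2 where e2: "e2 > 0" "\<And>\<epsilon> x y. 0 < \<epsilon> \<Longrightarrow> \<epsilon> \<le> e2 \<Longrightarrow> y \<in> B \<epsilon> x \<Longrightarrow> norm (\<phi> y - \<phi> x) < \<eta> / 2"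
    using ball_small[OF Suc.prems(1) half_gt_zero[OF Suc.prems(2)]] by blast
  have "norm ((\<integral>y. \<phi> y \<partial>(dual_transfer m B f \<epsilon> ^^ Suc j) (return borel x)) - \<phi> ((f ^^ Suc j) x)) < \<eta>"
    if \<epsilon>: "0 < \<epsilon>" "\<epsilon> \<le> min e1 e2" for \<epsilon> x
  proof -
    define \<mu> where "\<mu> = (dual_transfer m B f \<epsilon> ^^ j) (return borel x)"
    have \<mu>: "\<mu> \<in> prob_measures"
      unfolding \<mu>_def by (rule dual_iterate_prob_measures[OF \<epsilon>(1)])
    then interpret \<mu>: prob_space \<mu> by (simp add: prob_measures_iff)
    have near: "norm (transfer m B f \<epsilon> \<phi> y - \<phi> (f y)) \<le> \<eta> / 2" for y
    proof (rule transfer_near[OF \<epsilon>(1) Suc.prems(1)])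
      show "norm (\<phi> z - \<phi> y) \<le> \<eta> / 2" if "z \<in> B \<epsilon> y" for y z
        using e2(2)[OF \<epsilon>(1) _ that] \<epsilon>(2) by simp
    qed (use Suc.prems(2) in simp)
    have if1: "integrable \<mu> (\<lambda>y. \<phi> (f y))"
      by (rule integrable_continuous_prob_measure[OF compact_space \<mu> \<phi>f])
    have "integrable \<mu> (\<lambda>y. transfer m B f \<epsilon> \<phi> y - \<phi> (f y))"
      by (intro \<mu>.integrable_const_bound[of _ "\<eta> / 2"] measurable_prob_measures[OF \<mu>]
          borel_measurable_diff transfer_measurable[OF \<epsilon>(1)] borel_measurable_continuous_onI
          \<phi>f Suc.prems(1) AE_I2 near)
    then have "integrable \<mu> (transfer m B f \<epsilon> \<phi>)"
      using Bochner_Integration.integrable_add[OF _ if1, of "\<lambda>y. transfer m B f \<epsilon> \<phi> y - \<phi> (f y)"]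
      by simp
    then have "(\<integral>y. transfer m B f \<epsilon> \<phi> y \<partial>\<mu>) - (\<integral>y. \<phi> (f y) \<partial>\<mu>)
        = (\<integral>y. transfer m B f \<epsilon> \<phi> y - \<phi> (f y) \<partial>\<mu>)"
      using if1 by simp
    also have "norm \<dots> \<le> \<eta> / 2"
      using near Suc.prems by (intro \<mu>.norm_integral_le_const) auto
    finally have "norm ((\<integral>y. transfer m B f \<epsilon> \<phi> y \<partial>\<mu>) - (\<integral>y. \<phi> (f y) \<partial>\<mu>)) \<le> \<eta> / 2" .
    moreover have "norm ((\<integral>y. \<phi> (f y) \<partial>\<mu>) - \<phi> (f ((f ^^ j) x))) < \<eta> / 2"
      using e1(2)[of \<epsilon> x] \<epsilon> by (simp add: \<mu>_def)
    ultimately have "norm ((\<integral>y. transfer m B f \<epsilon> \<phi> y \<partial>\<mu>) - \<phi> (f ((f ^^ j) x))) < \<eta>"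
      using norm_triangle_ineq[of "(\<integral>y. transfer m B f \<epsilon> \<phi> y \<partial>\<mu>) - (\<integral>y. \<phi> (f y) \<partial>\<mu>)"
          "(\<integral>y. \<phi> (f y) \<partial>\<mu>) - \<phi> (f ((f ^^ j) x))"] by simp
    then show ?thesis
      using integral_dual_transfer[OF \<epsilon>(1) \<mu> Suc.prems(1)] by (simp add: \<mu>_def)
  qed
  then show ?case
    using e1(1) e2(1) by (intro exI[of _ "min e1 e2"] conjI allI impI) (simp_all only: min_less_iff_conj)
qed


abbreviation \<sigma> :: "nat \<Rightarrow> 'a \<Rightarrow> 'a measure" where
  "\<sigma> n x \<equiv> empiric f n x"

abbreviation \<sigma>\<^sub>\<epsilon> :: "real \<Rightarrow> nat \<Rightarrow> 'a \<Rightarrow> 'a measure" where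
  "\<sigma>\<^sub>\<epsilon> \<epsilon> n x \<equiv> empiric_stochastic m B f \<epsilon> n x"

lemma empiric_prob_measures: "1 \<le> n \<Longrightarrow> \<sigma> n x \<in> prob_measures"
  unfolding empiric_def by (intro average_prob_measures return_prob_measures)

lemma empiric_stochastic_prob_measures: "1 \<le> n \<Longrightarrow> 0 < \<epsilon> \<Longrightarrow> \<sigma>\<^sub>\<epsilon> \<epsilon> n x \<in> prob_measures"
  unfolding empiric_stochastic_def by (intro average_prob_measures dual_iterate_prob_measures)

lemma integral_empiric:
  fixes \<phi> :: "'a \<Rightarrow> complex"
  assumes "1 \<le> n" and \<phi>: "continuous_on UNIV \<phi>"
  shows "(\<integral>y. \<phi> y \<partial>\<sigma> n x) = (\<Sum>j=1..n. \<phi> ((f ^^ j) x)) / of_nat n"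
proof -
  obtain C where "\<And>x. norm (\<phi> x) \<le> C"
    using bounded_continuous_compact_space[OF compact_space \<phi>] by blast
  then show ?thesis
    unfolding empiric_def using assms
    by (subst integral_average[where C = C])
      (auto simp: return_prob_measures integral_return_continuous intro: borel_measurable_continuous_onI)
qed

lemma integral_empiric_stochastic:
  fixes \<phi> :: "'a \<Rightarrow> complex"
  assumes "1 \<le> n" "0 < \<epsilon>" and \<phi>: "continuous_on UNIV \<phi>"
  shows "(\<integral>y. \<phi> y \<partial>\<sigma>\<^sub>\<epsilon> \<epsilon> n x) =
    (\<Sum>j=1..n. \<integral>y. \<phi> y \<partial>(dual_transfer m B f \<epsilon> ^^ j) (return borel x)) / of_nat n"
proof -
  obtain C where "\<And>x. norm (\<phi> x) \<le> C"
    using bounded_continuous_compact_space[OF compact_space \<phi>] by blast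
  then show ?thesis
    unfolding empiric_stochastic_def using assms
    by (intro integral_average[where C = C] dual_iterate_prob_measures borel_measurable_continuous_onI)
qed

lemma dist_empiric_tendsto:
  assumes n: "1 \<le> n" and x: "(x \<longlongrightarrow> y) F"
  shows "((\<lambda>i. d (\<sigma> n (x i)) (\<sigma> n y)) \<longlongrightarrow> 0) F"
proof (subst dist_tendsto_iff)
  show "\<forall>\<phi> :: 'a \<Rightarrow> complex. continuous_on UNIV \<phi> \<longrightarrow>
    ((\<lambda>i. \<integral>z. \<phi> z \<partial>\<sigma> n (x i)) \<longlongrightarrow> (\<integral>z. \<phi> z \<partial>\<sigma> n y)) F"
  proof (intro allI impI)
    fix \<phi> :: "'a \<Rightarrow> complex" assume \<phi>: "continuous_on UNIV \<phi>"
    have "((\<lambda>i. \<phi> ((f ^^ j) (x i))) \<longlongrightarrow> \<phi> ((f ^^ j) y)) F" for j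
    proof -
      have "continuous_on UNIV (\<lambda>x. \<phi> ((f ^^ j) x))"
        using continuous_on_compose2[OF \<phi> continuous_iterate] by simp
      from continuous_on_tendsto_compose[OF this x] show ?thesis by simp
    qed
    then show "((\<lambda>i. \<integral>z. \<phi> z \<partial>\<sigma> n (x i)) \<longlongrightarrow> (\<integral>z. \<phi> z \<partial>\<sigma> n y)) F"
      unfolding integral_empiric[OF n \<phi>] by (intro tendsto_divide tendsto_sum) (use n in auto)
  qed
qed (simp_all add: empiric_prob_measures[OF n])

lemma dist_empiric_measurable [measurable]:
  assumes n: "1 \<le> n" and \<nu>: "\<nu> \<in> prob_measures"
  shows "(\<lambda>x. d (\<sigma> n x) \<nu>) \<in> borel_measurable borel"
proof (intro borel_measurable_continuous_onI continuous_at_imp_continuous_on ballI)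
  fix x
  have "((\<lambda>y. d (\<sigma> n y) (\<sigma> n x)) \<longlongrightarrow> 0) (at x)"
    by (rule dist_empiric_tendsto[OF n]) (rule tendsto_ident_at)
  then have "((\<lambda>y. d (\<sigma> n y) \<nu> - d (\<sigma> n x) \<nu>) \<longlongrightarrow> 0) (at x)"
  proof (rule Lim_null_comparison[rotated])
    have "norm (d (\<sigma> n y) \<nu> - d (\<sigma> n x) \<nu>) \<le> d (\<sigma> n y) (\<sigma> n x)" for y
      using W.mdist_reverse_triangle[of "\<sigma> n y" \<nu> "\<sigma> n x"] \<nu> empiric_prob_measures[OF n]
      by (simp add: W.commute)
    then show "\<forall>\<^sub>F y in at x. norm (d (\<sigma> n y) \<nu> - d (\<sigma> n x) \<nu>) \<le> d (\<sigma> n y) (\<sigma> n x)"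
      by simp
  qed
  then show "isCont (\<lambda>y. d (\<sigma> n y) \<nu>) x"
    unfolding isCont_def by (subst (asm) Lim_null[symmetric])
qed

text \<open>The passage from integrals of test functions to the metric, uniformly in \<open>x\<close>, is by
  contradiction: along a sequence of bad points that converges to \<open>y\<close>, both the noisy and the
  noiseless averages converge to \<open>\<sigma> n y\<close>.\<close>
lemma empiric_stochastic_uniformly_near_empiric:
  assumes n: "1 \<le> n" and \<rho>: "0 < \<rho>"
  shows "\<exists>\<epsilon>\<^sub>0>0. \<forall>\<epsilon>. 0 < \<epsilon> \<and> \<epsilon> \<le> \<epsilon>\<^sub>0 \<longrightarrow> (\<forall>x. d (\<sigma>\<^sub>\<epsilon> \<epsilon> n x) (\<sigma> n x) < \<rho>)"
proof (rule ccontr)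
  assume "\<not> ?thesis"
  then have "\<forall>\<epsilon>\<^sub>0>0. \<exists>\<epsilon> x. 0 < \<epsilon> \<and> \<epsilon> \<le> \<epsilon>\<^sub>0 \<and> \<rho> \<le> d (\<sigma>\<^sub>\<epsilon> \<epsilon> n x) (\<sigma> n x)"
    by (meson not_less)
  then have "\<forall>k. \<exists>\<epsilon> x. 0 < \<epsilon> \<and> \<epsilon> \<le> 1 / real (Suc k) \<and> \<rho> \<le> d (\<sigma>\<^sub>\<epsilon> \<epsilon> n x) (\<sigma> n x)"
    by simp
  then obtain e x where e: "\<And>k. 0 < e k" "\<And>k. e k \<le> 1 / real (Suc k)"
    and far: "\<And>k. \<rho> \<le> d (\<sigma>\<^sub>\<epsilon> (e k) n (x k)) (\<sigma> n (x k))"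
    by metis
  have elim: "e \<longlonglongrightarrow> 0"
    using e by (intro tendsto_sandwich[OF _ _ tendsto_const LIMSEQ_Suc[OF lim_1_over_n]])
      (auto intro!: eventuallyI less_imp_le)
  obtain y r where r: "strict_mono r" and y: "(x \<circ> r) \<longlonglongrightarrow> y"
    using compact_imp_seq_compact[OF compact_space] unfolding seq_compact_def by blast
  have orbit: "(\<lambda>k. d (\<sigma> n (x (r k))) (\<sigma> n y)) \<longlonglongrightarrow> 0"
    using y by (intro dist_empiric_tendsto[OF n]) (simp add: o_def)
  have "(\<lambda>k. d (\<sigma>\<^sub>\<epsilon> (e (r k)) n (x (r k))) (\<sigma> n y)) \<longlonglongrightarrow> 0"
  proof (subst dist_tendsto_iff)
    show "\<forall>\<phi> :: 'a \<Rightarrow> complex. continuous_on UNIV \<phi> \<longrightarrow>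
      (\<lambda>k. \<integral>z. \<phi> z \<partial>\<sigma>\<^sub>\<epsilon> (e (r k)) n (x (r k))) \<longlonglongrightarrow> (\<integral>z. \<phi> z \<partial>\<sigma> n y)"
    proof (intro allI impI)
      fix \<phi> :: "'a \<Rightarrow> complex" assume \<phi>: "continuous_on UNIV \<phi>"
      have "(\<lambda>k. \<integral>z. \<phi> z \<partial>(dual_transfer m B f (e (r k)) ^^ j) (return borel (x (r k))))
          \<longlonglongrightarrow> \<phi> ((f ^^ j) y)" for j
      proof -
        have "continuous_on UNIV (\<lambda>x. \<phi> ((f ^^ j) x))"
          using continuous_on_compose2[OF \<phi> continuous_iterate] by simp
        from continuous_on_tendsto_compose[OF this y]
        have 1: "(\<lambda>k. \<phi> ((f ^^ j) (x (r k)))) \<longlonglongrightarrow> \<phi> ((f ^^ j) y)"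
          by (simp add: o_def)
        have "(\<lambda>k. (\<integral>z. \<phi> z \<partial>(dual_transfer m B f (e (r k)) ^^ j) (return borel (x (r k))))
            - \<phi> ((f ^^ j) (x (r k)))) \<longlonglongrightarrow> 0"
        proof (rule tendstoI)
          fix \<eta> :: real assume "0 < \<eta>"
          from dual_iterate_near_orbit[OF \<phi> this, of j]
          obtain \<epsilon>\<^sub>0 where \<epsilon>\<^sub>0: "\<epsilon>\<^sub>0 > 0" "\<And>\<epsilon> x. 0 < \<epsilon> \<Longrightarrow> \<epsilon> \<le> \<epsilon>\<^sub>0 \<Longrightarrow>
            norm ((\<integral>y. \<phi> y \<partial>(dual_transfer m B f \<epsilon> ^^ j) (return borel x)) - \<phi> ((f ^^ j) x)) < \<eta>"
            by blast
          have "\<forall>\<^sub>F k in sequentially. e (r k) < \<epsilon>\<^sub>0"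
            using order_tendstoD(2)[OF LIMSEQ_subseq_LIMSEQ[OF elim r] \<epsilon>\<^sub>0(1)] by (simp add: o_def)
          then show "\<forall>\<^sub>F k in sequentially.
            dist ((\<integral>z. \<phi> z \<partial>(dual_transfer m B f (e (r k)) ^^ j) (return borel (x (r k))))
            - \<phi> ((f ^^ j) (x (r k)))) 0 < \<eta>"
            by eventually_elim (simp add: \<epsilon>\<^sub>0(2) e(1))
        qed
        from tendsto_add[OF this 1] show ?thesis by simp
      qed
      then show "(\<lambda>k. \<integral>z. \<phi> z \<partial>\<sigma>\<^sub>\<epsilon> (e (r k)) n (x (r k))) \<longlonglongrightarrow> (\<integral>z. \<phi> z \<partial>\<sigma> n y)"
        unfolding integral_empiric[OF n \<phi>] integral_empiric_stochastic[OF n e(1) \<phi>]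
        by (intro tendsto_divide tendsto_sum) (use n in auto)
    qed
  qed (simp_all add: empiric_prob_measures[OF n] empiric_stochastic_prob_measures[OF n e(1)])
  from tendsto_add[OF this orbit]
  have "\<forall>\<^sub>F k in sequentially. d (\<sigma>\<^sub>\<epsilon> (e (r k)) n (x (r k))) (\<sigma> n y) + d (\<sigma> n (x (r k))) (\<sigma> n y) < \<rho>"
    using \<rho> by (intro order_tendstoD(2)) auto
  then obtain k where "d (\<sigma>\<^sub>\<epsilon> (e (r k)) n (x (r k))) (\<sigma> n y) + d (\<sigma> n (x (r k))) (\<sigma> n y) < \<rho>"
    by (auto simp: eventually_sequentially)
  moreover have "d (\<sigma>\<^sub>\<epsilon> (e (r k)) n (x (r k))) (\<sigma> n (x (r k)))
      \<le> d (\<sigma>\<^sub>\<epsilon> (e (r k)) n (x (r k))) (\<sigma> n y) + d (\<sigma> n (x (r k))) (\<sigma> n y)"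
    using W.triangle'[of "\<sigma>\<^sub>\<epsilon> (e (r k)) n (x (r k))" "\<sigma> n y" "\<sigma> n (x (r k))"]
    by (simp add: empiric_prob_measures[OF n] empiric_stochastic_prob_measures[OF n e(1)])
  ultimately show False
    using far[of "r k"] by linarith
qed


section \<open>Basins and limit sets in terms of the noiseless averages\<close>

lemma m_UNIV_pos: "0 < emeasure m UNIV"
proof -
  have "emeasure m (B 1 undefined) \<le> emeasure m UNIV"
    by (intro emeasure_mono) (auto simp: sets_m)
  then show ?thesis
    using ball_pos[of 1 undefined] by simp
qed

lemma ex_AE:
  assumes "AE x in m. P x"
  shows "\<exists>x. P x"
proof -
  obtain N where N: "{x \<in> space m. \<not> P x} \<subseteq> N" "emeasure m N = 0"
    using AE_E[OF assms] by metis
  then have "N \<noteq> UNIV" using m_UNIV_pos by auto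
  with N(1) show ?thesis by auto
qed

definition attracted :: "'a \<Rightarrow> 'a measure \<Rightarrow> bool" where
  "attracted x \<mu> \<longleftrightarrow> (\<lambda>n. d (\<sigma> n x) \<mu>) \<longlonglongrightarrow> 0"

text \<open>The form with \<open>1 \<le> n\<close> matches the definitions of stability, where averages over no time steps
  are excluded.\<close>
lemma attracted_iff: "attracted x \<mu> \<longleftrightarrow> (\<forall>\<rho>>0. \<exists>N. \<forall>n\<ge>N. 1 \<le> n \<longrightarrow> d (\<sigma> n x) \<mu> < \<rho>)"
proof -
  have "attracted x \<mu> \<longleftrightarrow> (\<forall>\<rho>>0. \<exists>N. \<forall>n\<ge>N. d (\<sigma> n x) \<mu> < \<rho>)"
    by (simp add: attracted_def lim_sequentially)
  also have "\<dots> \<longleftrightarrow> (\<forall>\<rho>>0. \<exists>N. \<forall>n\<ge>N. 1 \<le> n \<longrightarrow> d (\<sigma> n x) \<mu> < \<rho>)"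
  proof (intro iffI allI impI)
    fix \<rho> :: real
    assume "\<forall>\<rho>>0. \<exists>N. \<forall>n\<ge>N. 1 \<le> n \<longrightarrow> d (\<sigma> n x) \<mu> < \<rho>" "0 < \<rho>"
    then obtain N where "\<forall>n\<ge>N. 1 \<le> n \<longrightarrow> d (\<sigma> n x) \<mu> < \<rho>" by blast
    then show "\<exists>N. \<forall>n\<ge>N. d (\<sigma> n x) \<mu> < \<rho>"
      by (intro exI[of _ "max 1 N"]) simp
  qed blast
  finally show ?thesis .
qed

lemma attracted_unique:
  assumes "attracted x \<mu>" "attracted x \<nu>" "\<mu> \<in> prob_measures" "\<nu> \<in> prob_measures"
  shows "\<mu> = \<nu>"
proof -
  have "(\<lambda>n. d (\<sigma> n x) \<mu> + d (\<sigma> n x) \<nu>) \<longlonglongrightarrow> 0 + 0"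
    using assms unfolding attracted_def by (intro tendsto_add)
  moreover have "\<forall>\<^sub>F n in sequentially. d \<mu> \<nu> \<le> d (\<sigma> n x) \<mu> + d (\<sigma> n x) \<nu>"
    using eventually_ge_at_top[of 1]
    by eventually_elim (use assms in \<open>auto intro!: W.triangle'' empiric_prob_measures\<close>)
  ultimately have "d \<mu> \<nu> \<le> 0"
    using tendsto_le[OF trivial_limit_sequentially _ tendsto_const] by fastforce
  then show ?thesis
    using assms W.nonneg[of \<mu> \<nu>] by (simp add: antisym)
qed

lemma set_dist_less_iff:
  assumes "K \<noteq> {}"
  shows "set_dist d K {\<nu>} < \<rho> \<longleftrightarrow> (\<exists>\<mu>\<in>K. d \<mu> \<nu> < \<rho>)"
    and "set_dist d {\<nu>} K < \<rho> \<longleftrightarrow> (\<exists>\<mu>\<in>K. d \<nu> \<mu> < \<rho>)"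
proof -
  have bdd: "bdd_below ((\<lambda>(\<mu>, \<nu>). d \<mu> \<nu>) ` A)" for A
    by (rule bdd_belowI[of _ 0]) auto
  show "set_dist d K {\<nu>} < \<rho> \<longleftrightarrow> (\<exists>\<mu>\<in>K. d \<mu> \<nu> < \<rho>)"
    unfolding set_dist_def using assms by (subst cInf_less_iff[OF _ bdd]) auto
  show "set_dist d {\<nu>} K < \<rho> \<longleftrightarrow> (\<exists>\<mu>\<in>K. d \<nu> \<mu> < \<rho>)"
    unfolding set_dist_def using assms by (subst cInf_less_iff[OF _ bdd]) auto
qed

text \<open>The threshold \<open>\<epsilon>\<^sub>0\<close> may depend on \<open>n\<close>, so at each time \<open>n\<close> the noise can be chosen small
  enough to replace \<open>\<sigma>\<^sub>\<epsilon>\<close> by \<open>\<sigma>\<close> at the cost of \<open>\<rho> / 2\<close>.\<close>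
lemma set_stability_basin_iff:
  assumes K: "K \<noteq> {}" "K \<subseteq> prob_measures"
  shows "x \<in> set_stability_basin m B f d K \<longleftrightarrow>
    (\<forall>\<rho>>0. \<exists>N. \<forall>n\<ge>N. 1 \<le> n \<longrightarrow> (\<exists>\<mu>\<in>K. d (\<sigma> n x) \<mu> < \<rho>))" (is "_ \<longleftrightarrow> ?R")
proof
  assume L: "x \<in> set_stability_basin m B f d K"
  show ?R
  proof (intro allI impI)
    fix \<rho> :: real assume "0 < \<rho>"
    then have "0 < \<rho> / 2" by simp
    with L obtain N where N: "\<And>n. n \<ge> N \<Longrightarrow> 1 \<le> n \<Longrightarrow> \<exists>\<epsilon>\<^sub>0>0. \<forall>\<epsilon>. 0 < \<epsilon> \<and> \<epsilon> \<le> \<epsilon>\<^sub>0 \<longrightarrow>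
        (\<exists>\<mu>\<in>K. d (\<sigma>\<^sub>\<epsilon> \<epsilon> n x) \<mu> < \<rho> / 2)"
      unfolding set_stability_basin_def set_dist_less_iff[OF K(1)] by blast
    have "\<exists>\<mu>\<in>K. d (\<sigma> n x) \<mu> < \<rho>" if n: "n \<ge> N" "1 \<le> n" for n
    proof -
      obtain e1 where e1: "e1 > 0" "\<And>\<epsilon>. 0 < \<epsilon> \<Longrightarrow> \<epsilon> \<le> e1 \<Longrightarrow> \<exists>\<mu>\<in>K. d (\<sigma>\<^sub>\<epsilon> \<epsilon> n x) \<mu> < \<rho> / 2"
        using N[OF n] by blast
      obtain e2 where e2: "e2 > 0" "\<And>\<epsilon>. 0 < \<epsilon> \<Longrightarrow> \<epsilon> \<le> e2 \<Longrightarrow> d (\<sigma>\<^sub>\<epsilon> \<epsilon> n x) (\<sigma> n x) < \<rho> / 2"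
        using empiric_stochastic_uniformly_near_empiric[OF n(2) \<open>0 < \<rho> / 2\<close>] by blast
      define \<epsilon> where "\<epsilon> = min e1 e2"
      have \<epsilon>: "0 < \<epsilon>" "\<epsilon> \<le> e1" "\<epsilon> \<le> e2" using e1(1) e2(1) by (auto simp: \<epsilon>_def)
      obtain \<mu> where \<mu>: "\<mu> \<in> K" "d (\<sigma>\<^sub>\<epsilon> \<epsilon> n x) \<mu> < \<rho> / 2" using e1(2)[OF \<epsilon>(1,2)] by blast
      have "d (\<sigma> n x) \<mu> \<le> d (\<sigma>\<^sub>\<epsilon> \<epsilon> n x) (\<sigma> n x) + d (\<sigma>\<^sub>\<epsilon> \<epsilon> n x) \<mu>"
        using \<mu>(1) K n \<epsilon> by (intro W.triangle'' empiric_prob_measures empiric_stochastic_prob_measures) auto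
      then have "d (\<sigma> n x) \<mu> < \<rho>"
        using \<mu>(2) e2(2)[OF \<epsilon>(1,3)] by linarith
      with \<mu>(1) show ?thesis by blast
    qed
    then show "\<exists>N. \<forall>n\<ge>N. 1 \<le> n \<longrightarrow> (\<exists>\<mu>\<in>K. d (\<sigma> n x) \<mu> < \<rho>)" by blast
  qed
next
  assume R: ?R
  have "\<exists>N. \<forall>n\<ge>N. 1 \<le> n \<longrightarrow> (\<exists>\<epsilon>\<^sub>0>0. \<forall>\<epsilon>. 0 < \<epsilon> \<and> \<epsilon> \<le> \<epsilon>\<^sub>0 \<longrightarrow>
        (\<exists>\<mu>\<in>K. d (\<sigma>\<^sub>\<epsilon> \<epsilon> n x) \<mu> < \<rho>))" if "0 < \<rho>" for \<rho> :: real
  proof -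
    have \<rho>2: "0 < \<rho> / 2" using that by simp
    with R obtain N where N: "\<And>n. n \<ge> N \<Longrightarrow> 1 \<le> n \<Longrightarrow> \<exists>\<mu>\<in>K. d (\<sigma> n x) \<mu> < \<rho> / 2" by blast
    have "\<exists>\<epsilon>\<^sub>0>0. \<forall>\<epsilon>. 0 < \<epsilon> \<and> \<epsilon> \<le> \<epsilon>\<^sub>0 \<longrightarrow> (\<exists>\<mu>\<in>K. d (\<sigma>\<^sub>\<epsilon> \<epsilon> n x) \<mu> < \<rho>)"
      if n: "n \<ge> N" "1 \<le> n" for n
    proof -
      obtain \<mu> where \<mu>: "\<mu> \<in> K" "d (\<sigma> n x) \<mu> < \<rho> / 2" using N[OF n] by blast
      obtain e2 where e2: "e2 > 0" "\<And>\<epsilon>. 0 < \<epsilon> \<Longrightarrow> \<epsilon> \<le> e2 \<Longrightarrow> d (\<sigma>\<^sub>\<epsilon> \<epsilon> n x) (\<sigma> n x) < \<rho> / 2"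
        using empiric_stochastic_uniformly_near_empiric[OF n(2) \<rho>2] by blast
      have "d (\<sigma>\<^sub>\<epsilon> \<epsilon> n x) \<mu> < \<rho>" if \<epsilon>: "0 < \<epsilon>" "\<epsilon> \<le> e2" for \<epsilon>
      proof -
        have "d (\<sigma>\<^sub>\<epsilon> \<epsilon> n x) \<mu> \<le> d (\<sigma>\<^sub>\<epsilon> \<epsilon> n x) (\<sigma> n x) + d (\<sigma> n x) \<mu>"
          using \<mu>(1) K n \<epsilon> by (intro W.triangle empiric_prob_measures empiric_stochastic_prob_measures) auto
        then show ?thesis
          using \<mu>(2) e2(2)[OF \<epsilon>] by linarith
      qed
      then show ?thesis using \<mu>(1) e2(1) by blast
    qed
    then show ?thesis by blast
  qed
  then show "x \<in> set_stability_basin m B f d K"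
    unfolding set_stability_basin_def set_dist_less_iff[OF K(1)] by blast
qed

lemma stability_basin_eq_set_stability_basin:
  "stability_basin m B f d \<mu> = set_stability_basin m B f d {\<mu>}"
  unfolding stability_basin_def set_stability_basin_def
  by (subst set_dist_less_iff) auto

lemma set_stability_basin_singleton:
  "\<mu> \<in> prob_measures \<Longrightarrow> x \<in> set_stability_basin m B f d {\<mu>} \<longleftrightarrow> attracted x \<mu>"
  by (subst set_stability_basin_iff) (auto simp: attracted_iff)

lemma p_omega_iff:
  "\<nu> \<in> p_omega f x \<longleftrightarrow> \<nu> \<in> prob_measures \<and> (\<exists>r. strict_mono r \<and> (\<lambda>i. d (\<sigma> (r i) x) \<nu>) \<longlonglongrightarrow> 0)"
proof -
  have ev: "\<forall>\<^sub>F i in sequentially. \<sigma> (r i) x \<in> prob_measures" if "strict_mono r" for r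
    using eventually_ge_at_top[of 1]
    by eventually_elim (use that in \<open>auto intro!: empiric_prob_measures intro: order_trans[OF _ seq_suble]\<close>)
  have "limitin weak_star (\<lambda>i. \<sigma> (r i) x) \<nu> sequentially \<longleftrightarrow>
      \<nu> \<in> prob_measures \<and> (\<lambda>i. d (\<sigma> (r i) x) \<nu>) \<longlonglongrightarrow> 0" if "strict_mono r" for r
    using W.limitin_metric_dist_null[of "\<lambda>i. \<sigma> (r i) x" \<nu> sequentially] ev[OF that]
    by (simp add: mtopology_eq)
  then show ?thesis
    unfolding p_omega_def by auto
qed

text \<open>Compactness, in the form that every subsequence of the averages accumulates in \<open>p_omega\<close>. The
  first term of the subsequence is dropped because \<open>\<sigma> 0 x\<close> is not a probability measure.\<close>
lemma p_omega_nonempty_subsequence: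
  fixes r :: "nat \<Rightarrow> nat"
  assumes "strict_mono r"
  obtains \<nu> s where "strict_mono s" "\<nu> \<in> p_omega f x" "(\<lambda>i. d (\<sigma> (r (s i)) x) \<nu>) \<longlonglongrightarrow> 0"
proof -
  have r1: "1 \<le> r (Suc i)" for i
    using seq_suble[OF assms, of "Suc i"] by linarith
  obtain s l where s: "strict_mono s"
    and l: "limitin weak_star ((\<lambda>i. \<sigma> (r (Suc i)) x) \<circ> s) l sequentially"
    using prob_measures_sequentially_compact[OF compact_space, of "\<lambda>i. \<sigma> (r (Suc i)) x"]
      empiric_prob_measures[OF r1] by blast
  have S: "strict_mono (\<lambda>i. Suc (s i))" using s by (simp add: strict_mono_def)
  have "l \<in> prob_measures" "(\<lambda>i. d (\<sigma> (r (Suc (s i))) x) l) \<longlonglongrightarrow> 0"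
    using l W.limitin_metric_dist_null[of "(\<lambda>i. \<sigma> (r (Suc i)) x) \<circ> s" l sequentially]
    by (auto simp: mtopology_eq o_def)
  moreover have "strict_mono (\<lambda>i. r (Suc (s i)))"
    using strict_mono_o[OF assms S] by (simp add: o_def)
  ultimately show thesis
    using that[OF S] p_omega_iff by blast
qed

lemma p_omega_prob_measures: "p_omega f x \<subseteq> prob_measures"
  by (auto simp: p_omega_iff)

lemma p_omega_nonempty: "p_omega f x \<noteq> {}"
  using p_omega_nonempty_subsequence[OF strict_mono_id, of x] by auto

text \<open>In a compact space a sequence with a single accumulation point converges.\<close>
lemma strong_basin_iff:
  assumes \<mu>: "\<mu> \<in> prob_measures"
  shows "x \<in> strong_basin f \<mu> \<longleftrightarrow> attracted x \<mu>"
proof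
  assume "attracted x \<mu>"
  have "\<nu> = \<mu>" if \<nu>p: "\<nu> \<in> p_omega f x" for \<nu>
  proof -
    obtain r where r: "strict_mono r" "(\<lambda>i. d (\<sigma> (r i) x) \<nu>) \<longlonglongrightarrow> 0" and \<nu>: "\<nu> \<in> prob_measures"
      using \<nu>p by (auto simp: p_omega_iff)
    have "(\<lambda>i. d (\<sigma> (r i) x) \<mu>) \<longlonglongrightarrow> 0"
      using LIMSEQ_subseq_LIMSEQ[OF \<open>attracted x \<mu>\<close>[unfolded attracted_def] r(1)] by (simp add: o_def)
    from tendsto_add[OF this r(2)] have "(\<lambda>i. d (\<sigma> (r i) x) \<mu> + d (\<sigma> (r i) x) \<nu>) \<longlonglongrightarrow> 0" by simp
    moreover have "\<forall>\<^sub>F i in sequentially. d \<mu> \<nu> \<le> d (\<sigma> (r i) x) \<mu> + d (\<sigma> (r i) x) \<nu>"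
      using eventually_ge_at_top[of 1]
    proof eventually_elim
      case (elim i)
      then have "1 \<le> r i" using seq_suble[OF r(1), of i] by linarith
      then show ?case using \<mu> \<nu> by (intro W.triangle'' empiric_prob_measures)
    qed
    ultimately have "d \<mu> \<nu> \<le> 0"
      by (rule tendsto_le[OF trivial_limit_sequentially _ tendsto_const])
    then show ?thesis
      using \<mu> \<nu> W.nonneg[of \<mu> \<nu>] by (simp add: antisym)
  qed
  then show "x \<in> strong_basin f \<mu>"
    using p_omega_nonempty[of x] by (auto simp: strong_basin_def)
next
  assume "x \<in> strong_basin f \<mu>"
  then have p: "p_omega f x = {\<mu>}" by (simp add: strong_basin_def)
  show "attracted x \<mu>"
  proof (rule ccontr)
    assume "\<not> attracted x \<mu>"
    then obtain \<rho> where \<rho>: "0 < \<rho>" "\<forall>N. \<exists>n\<ge>N. \<rho> \<le> d (\<sigma> n x) \<mu>"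
      unfolding attracted_iff by (meson not_less)
    then have "infinite {n. \<rho> \<le> d (\<sigma> n x) \<mu>}"
      unfolding infinite_nat_iff_unbounded_le by auto
    from infinite_enumerate[OF this] obtain r :: "nat \<Rightarrow> nat"
      where r: "strict_mono r" "\<And>i. \<rho> \<le> d (\<sigma> (r i) x) \<mu>" by auto
    obtain \<nu> s where "\<nu> \<in> p_omega f x" "(\<lambda>i. d (\<sigma> (r (s i)) x) \<nu>) \<longlonglongrightarrow> 0"
      using p_omega_nonempty_subsequence[OF r(1)] by blast
    with p have "(\<lambda>i. d (\<sigma> (r (s i)) x) \<mu>) \<longlonglongrightarrow> 0" by simp
    from order_tendstoD(2)[OF this \<rho>(1)] show False
      using r(2) by (auto simp: eventually_sequentially not_less[symmetric])
  qed
qed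

text \<open>The weak basin in terms of countably many conditions on the averages, for the sake of
  measurability. The margin \<open>1 / (k + 1)\<close> keeps the inequality strict in the limit, and \<open>Suc n\<close> skips
  the average over no time steps.\<close>
lemma weak_basin_iff:
  assumes \<nu>: "\<nu> \<in> prob_measures"
  shows "x \<in> weak_basin f d \<rho> \<nu> \<longleftrightarrow> (\<exists>k. \<forall>N. \<exists>n\<ge>N. d (\<sigma> (Suc n) x) \<nu> < \<rho> - 1 / real (Suc k))"
proof
  assume "x \<in> weak_basin f d \<rho> \<nu>"
  then obtain \<eta> where \<eta>: "\<eta> \<in> p_omega f x" "d \<eta> \<nu> < \<rho>"
    using set_dist_less_iff(1)[OF p_omega_nonempty] by (auto simp: weak_basin_def)
  then obtain r where r: "strict_mono r" "(\<lambda>i. d (\<sigma> (r i) x) \<eta>) \<longlonglongrightarrow> 0" and \<eta>p: "\<eta> \<in> prob_measures"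
    by (auto simp: p_omega_iff)
  obtain k where k: "1 / real (Suc k) < (\<rho> - d \<eta> \<nu>) / 2"
    using nat_approx_posE[of "(\<rho> - d \<eta> \<nu>) / 2"] \<eta>(2) by auto
  have "\<exists>n\<ge>N. d (\<sigma> (Suc n) x) \<nu> < \<rho> - 1 / real (Suc k)" for N
  proof -
    have "\<forall>\<^sub>F i in sequentially. d (\<sigma> (r i) x) \<eta> < (\<rho> - d \<eta> \<nu>) / 2"
      using r(2) \<eta>(2) by (intro order_tendstoD(2)) auto
    with eventually_ge_at_top[of "Suc N"]
    have "\<forall>\<^sub>F i in sequentially. Suc N \<le> i \<and> d (\<sigma> (r i) x) \<eta> < (\<rho> - d \<eta> \<nu>) / 2"
      by eventually_elim simp
    then obtain i where i: "Suc N \<le> i" "d (\<sigma> (r i) x) \<eta> < (\<rho> - d \<eta> \<nu>) / 2"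
      by (auto simp: eventually_sequentially)
    have ri: "Suc N \<le> r i" using i(1) seq_suble[OF r(1), of i] by linarith
    have "d (\<sigma> (r i) x) \<nu> \<le> d (\<sigma> (r i) x) \<eta> + d \<eta> \<nu>"
      using ri \<eta>p \<nu> by (intro W.triangle empiric_prob_measures) auto
    then have "d (\<sigma> (r i) x) \<nu> < \<rho> - 1 / real (Suc k)"
      using i(2) k unfolding less_divide_eq_numeral1 by argo
    then show ?thesis
      using ri by (intro exI[of _ "r i - 1"]) auto
  qed
  then show "\<exists>k. \<forall>N. \<exists>n\<ge>N. d (\<sigma> (Suc n) x) \<nu> < \<rho> - 1 / real (Suc k)" by blast
next
  assume "\<exists>k. \<forall>N. \<exists>n\<ge>N. d (\<sigma> (Suc n) x) \<nu> < \<rho> - 1 / real (Suc k)"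
  then obtain k where "\<forall>N. \<exists>n\<ge>N. d (\<sigma> (Suc n) x) \<nu> < \<rho> - 1 / real (Suc k)" by blast
  then have "infinite {n. d (\<sigma> (Suc n) x) \<nu> < \<rho> - 1 / real (Suc k)}"
    unfolding infinite_nat_iff_unbounded_le by auto
  from infinite_enumerate[OF this] obtain r :: "nat \<Rightarrow> nat"
    where r: "strict_mono r" "\<And>i. d (\<sigma> (Suc (r i)) x) \<nu> < \<rho> - 1 / real (Suc k)" by auto
  have "strict_mono (\<lambda>i. Suc (r i))" using r(1) by (simp add: strict_mono_def)
  then obtain \<eta> s where \<eta>: "\<eta> \<in> p_omega f x" "(\<lambda>i. d (\<sigma> (Suc (r (s i))) x) \<eta>) \<longlonglongrightarrow> 0"
    using p_omega_nonempty_subsequence by blast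
  have "(\<lambda>i. d (\<sigma> (Suc (r (s i))) x) \<eta> + (\<rho> - 1 / real (Suc k))) \<longlonglongrightarrow> 0 + (\<rho> - 1 / real (Suc k))"
    by (intro tendsto_add tendsto_const \<eta>(2))
  moreover have "d \<eta> \<nu> \<le> d (\<sigma> (Suc (r (s i))) x) \<eta> + (\<rho> - 1 / real (Suc k))" for i
    using W.triangle''[of \<eta> "\<sigma> (Suc (r (s i))) x" \<nu>] r(2)[of "s i"] \<eta>(1) p_omega_prob_measures \<nu>
      empiric_prob_measures[of "Suc (r (s i))" x] by fastforce
  ultimately have "d \<eta> \<nu> \<le> 0 + (\<rho> - 1 / real (Suc k))"
    by (intro tendsto_lowerbound[OF _ always_eventually]) auto
  also have "\<dots> < \<rho>" by simp
  finally show "x \<in> weak_basin f d \<rho> \<nu>"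
    using \<eta>(1) set_dist_less_iff(1)[OF p_omega_nonempty] by (auto simp: weak_basin_def)
qed

lemma weak_basin_sets [measurable]:
  assumes "\<nu> \<in> prob_measures"
  shows "weak_basin f d \<rho> \<nu> \<in> sets m"
proof -
  have [measurable]: "(\<lambda>x. d (\<sigma> (Suc n) x) \<nu>) \<in> borel_measurable borel" for n
    using assms by (intro dist_empiric_measurable) auto
  have "weak_basin f d \<rho> \<nu> = {x \<in> space borel. \<exists>k. \<forall>N. \<exists>n\<ge>N. d (\<sigma> (Suc n) x) \<nu> < \<rho> - 1 / real (Suc k)}"
    using weak_basin_iff[OF assms] by auto
  also have "\<dots> \<in> sets borel" by measurable
  finally show ?thesis by (simp add: sets_m)
qed

lemma strong_basin_sets:
  assumes "\<nu> \<in> prob_measures"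
  shows "strong_basin f \<nu> \<in> sets m"
proof -
  have [measurable]: "(\<lambda>x. d (\<sigma> (Suc n) x) \<nu>) \<in> borel_measurable borel" for n
    using assms by (intro dist_empiric_measurable) auto
  have "strong_basin f \<nu> = {x \<in> space borel. (\<lambda>n. d (\<sigma> (Suc n) x) \<nu>) \<longlonglongrightarrow> 0}"
    unfolding set_eq_iff mem_Collect_eq strong_basin_iff[OF assms] attracted_def
    using filterlim_sequentially_Suc[of "\<lambda>n. d (\<sigma> n _) \<nu>"] by simp
  also have "\<dots> \<in> sets borel" by measurable
  finally show ?thesis by (simp add: sets_m)
qed

text \<open>The integrals of \<open>\<phi> \<circ> f\<close> and \<open>\<phi>\<close> against \<open>\<sigma> n x\<close> differ by a telescoping sum divided by \<open>n\<close>.\<close>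
lemma p_omega_invariant: "p_omega f x \<subseteq> invariant_measures f"
proof
  fix \<nu> assume "\<nu> \<in> p_omega f x"
  then obtain r where r: "strict_mono r" "(\<lambda>i. d (\<sigma> (r i) x) \<nu>) \<longlonglongrightarrow> 0" and \<nu>: "\<nu> \<in> prob_measures"
    by (auto simp: p_omega_iff)
  have r1: "1 \<le> r i" if "1 \<le> i" for i
    using that seq_suble[OF r(1), of i] by linarith
  have ev: "\<forall>\<^sub>F i in sequentially. \<sigma> (r i) x \<in> prob_measures"
    using eventually_ge_at_top[of 1] by eventually_elim (intro empiric_prob_measures r1)
  have lim: "(\<lambda>i. \<integral>y. \<phi> y \<partial>\<sigma> (r i) x) \<longlonglongrightarrow> (\<integral>y. \<phi> y \<partial>\<nu>)"
    if "continuous_on UNIV \<phi>" for \<phi> :: "'a \<Rightarrow> complex"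
    using r(2) that dist_tendsto_iff[OF ev \<nu>] by blast
  have fm: "f \<in> \<nu> \<rightarrow>\<^sub>M borel"
    using \<nu> by (simp add: prob_measures_iff cong: measurable_cong_sets)
  have dp: "distr \<nu> borel f \<in> prob_measures"
    using \<nu> fm by (simp add: prob_measures_iff prob_space.prob_space_distr)
  have "distr \<nu> borel f = \<nu>"
  proof (rule prob_measures_eqI[OF dp \<nu>])
    fix \<phi> :: "'a \<Rightarrow> complex" assume \<phi>: "continuous_on UNIV \<phi>"
    obtain C where C: "C > 0" "\<And>x. norm (\<phi> x) \<le> C"
      using bounded_continuous_compact_space[OF compact_space \<phi>] by blast
    have \<phi>f: "continuous_on UNIV (\<lambda>x. \<phi> (f x))"
      using continuous_on_compose2[OF \<phi> cont_f] by simp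
    have "(\<lambda>i. (\<integral>y. \<phi> (f y) \<partial>\<sigma> (r i) x) - (\<integral>y. \<phi> y \<partial>\<sigma> (r i) x)) \<longlonglongrightarrow> 0"
    proof (rule Lim_null_comparison)
      show "\<forall>\<^sub>F i in sequentially. norm ((\<integral>y. \<phi> (f y) \<partial>\<sigma> (r i) x) - (\<integral>y. \<phi> y \<partial>\<sigma> (r i) x)) \<le> 2 * C * (1 / real (r i))"
        using eventually_ge_at_top[of 1]
      proof eventually_elim
        case (elim i)
        then have n: "1 \<le> r i" by (rule r1)
        have "(\<Sum>j=1..r i. \<phi> (f ((f ^^ j) x))) - (\<Sum>j=1..r i. \<phi> ((f ^^ j) x))
            = (\<Sum>j=1..r i. \<phi> ((f ^^ Suc j) x) - \<phi> ((f ^^ j) x))"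
          by (simp add: sum_subtractf)
        also have "\<dots> = \<phi> ((f ^^ Suc (r i)) x) - \<phi> ((f ^^ 1) x)"
          using n by (subst sum_Suc_diff) auto
        finally have eq: "(\<integral>y. \<phi> (f y) \<partial>\<sigma> (r i) x) - (\<integral>y. \<phi> y \<partial>\<sigma> (r i) x)
            = (\<phi> ((f ^^ Suc (r i)) x) - \<phi> ((f ^^ 1) x)) / of_nat (r i)"
          unfolding integral_empiric[OF n \<phi>f] integral_empiric[OF n \<phi>]
          by (simp add: diff_divide_distrib[symmetric])
        have "norm (\<phi> ((f ^^ Suc (r i)) x) - \<phi> ((f ^^ 1) x)) \<le> C + C"
          using norm_triangle_ineq4 C(2) add_mono by (metis order_trans)
        then show ?case
          unfolding eq by (simp add: norm_divide divide_right_mono)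
      qed
      have "(\<lambda>i. 1 / real (r i)) \<longlonglongrightarrow> 0"
        using LIMSEQ_subseq_LIMSEQ[OF lim_1_over_n r(1)] by (simp add: o_def)
      then show "(\<lambda>i. 2 * C * (1 / real (r i))) \<longlonglongrightarrow> 0"
        by (rule tendsto_mult_right_zero)
    qed
    moreover have "(\<lambda>i. (\<integral>y. \<phi> (f y) \<partial>\<sigma> (r i) x) - (\<integral>y. \<phi> y \<partial>\<sigma> (r i) x))
        \<longlonglongrightarrow> (\<integral>y. \<phi> (f y) \<partial>\<nu>) - (\<integral>y. \<phi> y \<partial>\<nu>)"
      by (intro tendsto_diff lim \<phi> \<phi>f)
    ultimately have "(\<integral>y. \<phi> (f y) \<partial>\<nu>) - (\<integral>y. \<phi> y \<partial>\<nu>) = 0"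
      using LIMSEQ_unique by blast
    then show "(\<integral>y. \<phi> y \<partial>distr \<nu> borel f) = (\<integral>y. \<phi> y \<partial>\<nu>)"
      using fm borel_measurable_continuous_onI[OF \<phi>] by (subst integral_distr) auto
  qed
  with \<nu> show "\<nu> \<in> invariant_measures f"
    by (simp add: invariant_measures_def)
qed


section \<open>Equivalence of the conditions\<close>

lemma invariant_prob_measures: "\<mu> \<in> invariant_measures f \<Longrightarrow> \<mu> \<in> prob_measures"
  by (simp add: invariant_measures_def)

lemma attracted_invariant: "\<mu> \<in> prob_measures \<Longrightarrow> attracted x \<mu> \<Longrightarrow> \<mu> \<in> invariant_measures f"
  using p_omega_invariant[of x] strong_basin_iff[of \<mu> x] by (auto simp: strong_basin_def)

text \<open>The second condition says that almost all points are attracted to \<open>\<mu>\<close>; a single such point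
  already makes \<open>\<mu>\<close> invariant.\<close>
lemma physical_full_iff:
  "physical m f \<mu> \<and> (AE x in m. x \<in> strong_basin f \<mu>) \<longleftrightarrow>
    \<mu> \<in> prob_measures \<and> (AE x in m. attracted x \<mu>)"
proof (intro iffI conjI)
  assume "physical m f \<mu> \<and> (AE x in m. x \<in> strong_basin f \<mu>)"
  then show "\<mu> \<in> prob_measures" "AE x in m. attracted x \<mu>"
    by (auto simp: physical_def invariant_prob_measures strong_basin_iff)
next
  assume R: "\<mu> \<in> prob_measures \<and> (AE x in m. attracted x \<mu>)"
  then show ae: "AE x in m. x \<in> strong_basin f \<mu>"
    by (simp add: strong_basin_iff)
  have "emeasure m (strong_basin f \<mu>) = emeasure m UNIV"
    using ae R strong_basin_sets by (intro emeasure_eq_AE) (auto simp: sets_m)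
  moreover obtain x where "attracted x \<mu>"
    using R ex_AE by blast
  ultimately show "physical m f \<mu>"
    using R m_UNIV_pos attracted_invariant by (auto simp: physical_def)
qed

text \<open>Egorov's theorem gives the common time \<open>N\<close> on a set of positive measure, and the uniform
  closeness of noisy and noiseless averages gives the common \<open>\<epsilon>\<^sub>0\<close>.\<close>
lemma uniformly_attracted_positive_set:
  assumes "\<mu> \<in> prob_measures" "AE x in m. attracted x \<mu>"
  shows "\<exists>A\<in>sets m. 0 < emeasure m A \<and>
    (\<forall>\<rho>>0. \<exists>N. \<forall>n\<ge>N. 1 \<le> n \<longrightarrow> (\<exists>\<epsilon>\<^sub>0>0. \<forall>\<epsilon>. 0 < \<epsilon> \<and> \<epsilon> \<le> \<epsilon>\<^sub>0 \<longrightarrow>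
       (\<forall>x\<in>A. d (\<sigma>\<^sub>\<epsilon> \<epsilon> n x) \<mu> < \<rho>)))"
proof -
  have [measurable]: "(\<lambda>x. d (\<sigma> (Suc n) x) \<mu>) \<in> borel_measurable m" for n
    using dist_empiric_measurable[OF _ assms(1), of "Suc n"]
    by (simp cong: measurable_cong_sets add: measurable_cong_sets[OF sets_m refl])
  have lim: "AE x in m. (\<lambda>n. d (\<sigma> (Suc n) x) \<mu>) \<longlonglongrightarrow> 0"
    using assms(2) unfolding attracted_def by eventually_elim (rule LIMSEQ_Suc)
  have "0 < measure m (space m)"
    using m_UNIV_pos by (simp add: m.emeasure_eq_measure)
  with lim obtain A where A: "A \<in> sets m" "0 < emeasure m A"
    "\<And>\<rho>. 0 < \<rho> \<Longrightarrow> \<exists>N. \<forall>n\<ge>N. \<forall>x\<in>A. d (\<sigma> (Suc n) x) \<mu> < \<rho>"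
    by (rule m.uniform_convergence_on_positive_set[rotated 1]) measurable
  have "\<exists>N. \<forall>n\<ge>N. 1 \<le> n \<longrightarrow> (\<exists>\<epsilon>\<^sub>0>0. \<forall>\<epsilon>. 0 < \<epsilon> \<and> \<epsilon> \<le> \<epsilon>\<^sub>0 \<longrightarrow> (\<forall>x\<in>A. d (\<sigma>\<^sub>\<epsilon> \<epsilon> n x) \<mu> < \<rho>))"
    if "0 < \<rho>" for \<rho> :: real
  proof -
    have \<rho>2: "0 < \<rho> / 2" using that by simp
    obtain N where N: "\<And>n x. n \<ge> N \<Longrightarrow> x \<in> A \<Longrightarrow> d (\<sigma> (Suc n) x) \<mu> < \<rho> / 2"
      using A(3)[OF \<rho>2] by blast
    have "\<exists>\<epsilon>\<^sub>0>0. \<forall>\<epsilon>. 0 < \<epsilon> \<and> \<epsilon> \<le> \<epsilon>\<^sub>0 \<longrightarrow> (\<forall>x\<in>A. d (\<sigma>\<^sub>\<epsilon> \<epsilon> n x) \<mu> < \<rho>)"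
      if n: "n \<ge> Suc N" for n
    proof -
      have n1: "1 \<le> n" using n by simp
      obtain e where e: "e > 0" "\<And>\<epsilon> x. 0 < \<epsilon> \<Longrightarrow> \<epsilon> \<le> e \<Longrightarrow> d (\<sigma>\<^sub>\<epsilon> \<epsilon> n x) (\<sigma> n x) < \<rho> / 2"
        using empiric_stochastic_uniformly_near_empiric[OF n1 \<rho>2] by blast
      have "d (\<sigma>\<^sub>\<epsilon> \<epsilon> n x) \<mu> < \<rho>" if \<epsilon>: "0 < \<epsilon>" "\<epsilon> \<le> e" and x: "x \<in> A" for \<epsilon> x
      proof -
        have "d (\<sigma>\<^sub>\<epsilon> \<epsilon> n x) \<mu> \<le> d (\<sigma>\<^sub>\<epsilon> \<epsilon> n x) (\<sigma> n x) + d (\<sigma> n x) \<mu>"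
          using assms(1) n1 \<epsilon> by (intro W.triangle empiric_prob_measures empiric_stochastic_prob_measures)
        moreover have "d (\<sigma> n x) \<mu> < \<rho> / 2"
          using N[of "n - 1" x] n x by simp
        ultimately show ?thesis
          using e(2)[OF \<epsilon>, of x] by linarith
      qed
      then show ?thesis using e(1) by blast
    qed
    then show ?thesis by blast
  qed
  with A(1,2) show ?thesis by blast
qed

lemma AE_ex_in_positive_set:
  assumes "AE x in m. P x" "A \<in> sets m" "0 < emeasure m A"
  shows "\<exists>x\<in>A. P x"
proof -
  obtain N where N: "{x \<in> space m. \<not> P x} \<subseteq> N" "emeasure m N = 0" "N \<in> sets m"
    using AE_E[OF assms(1)] by metis
  have "\<not> A \<subseteq> N"
    using emeasure_mono[OF _ N(3), of A] N(2) assms(3) by auto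
  with N(1) show ?thesis by auto
qed

text \<open>In the definition of stability the exceptional null set may depend on \<open>n\<close> and \<open>\<epsilon>\<close>. For each
  \<open>n\<close> one value of \<open>\<epsilon>\<close> suffices to control \<open>\<sigma> n x\<close>, so only countably many null sets occur.\<close>
lemma stable_measure_imp_attracted:
  assumes st: "stable_measure m B f d \<nu>"
  obtains A where "A \<in> sets m" "0 < emeasure m A" "AE x in m. x \<in> A \<longrightarrow> attracted x \<nu>"
proof -
  have \<nu>: "\<nu> \<in> prob_measures"
    using st by (simp add: stable_measure_def invariant_prob_measures)
  obtain A where A: "A \<in> sets m" "0 < emeasure m A"
    and stA: "\<And>\<rho>. 0 < \<rho> \<Longrightarrow> \<exists>N. \<forall>n\<ge>N. 1 \<le> n \<longrightarrow> (\<exists>\<epsilon>\<^sub>0>0. \<forall>\<epsilon>. 0 < \<epsilon> \<and> \<epsilon> \<le> \<epsilon>\<^sub>0 \<longrightarrow>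
           (AE x in m. x \<in> A \<longrightarrow> d (\<sigma>\<^sub>\<epsilon> \<epsilon> n x) \<nu> < \<rho>))"
    using st unfolding stable_measure_def by blast
  have "\<exists>N. \<forall>n\<ge>N. 1 \<le> n \<longrightarrow> (AE x in m. x \<in> A \<longrightarrow> d (\<sigma> n x) \<nu> < \<rho>)" if "0 < \<rho>" for \<rho> :: real
  proof -
    have \<rho>2: "0 < \<rho> / 2" using that by simp
    obtain N where N: "\<And>n. n \<ge> N \<Longrightarrow> 1 \<le> n \<Longrightarrow> (\<exists>\<epsilon>\<^sub>0>0. \<forall>\<epsilon>. 0 < \<epsilon> \<and> \<epsilon> \<le> \<epsilon>\<^sub>0 \<longrightarrow>
           (AE x in m. x \<in> A \<longrightarrow> d (\<sigma>\<^sub>\<epsilon> \<epsilon> n x) \<nu> < \<rho> / 2))"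
      using stA[OF \<rho>2] by blast
    have "AE x in m. x \<in> A \<longrightarrow> d (\<sigma> n x) \<nu> < \<rho>" if n: "n \<ge> N" "1 \<le> n" for n
    proof -
      obtain e1 where e1: "e1 > 0" "\<And>\<epsilon>. 0 < \<epsilon> \<Longrightarrow> \<epsilon> \<le> e1 \<Longrightarrow> AE x in m. x \<in> A \<longrightarrow> d (\<sigma>\<^sub>\<epsilon> \<epsilon> n x) \<nu> < \<rho> / 2"
        using N[OF n] by blast
      obtain e2 where e2: "e2 > 0" "\<And>\<epsilon> x. 0 < \<epsilon> \<Longrightarrow> \<epsilon> \<le> e2 \<Longrightarrow> d (\<sigma>\<^sub>\<epsilon> \<epsilon> n x) (\<sigma> n x) < \<rho> / 2"
        using empiric_stochastic_uniformly_near_empiric[OF n(2) \<rho>2] by blast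
      define \<epsilon> where "\<epsilon> = min e1 e2"
      have \<epsilon>: "0 < \<epsilon>" "\<epsilon> \<le> e1" "\<epsilon> \<le> e2" using e1(1) e2(1) by (auto simp: \<epsilon>_def)
      from e1(2)[OF \<epsilon>(1,2)] show ?thesis
      proof (rule eventually_mono, intro impI)
        fix x assume "x \<in> A \<longrightarrow> d (\<sigma>\<^sub>\<epsilon> \<epsilon> n x) \<nu> < \<rho> / 2" "x \<in> A"
        moreover have "d (\<sigma> n x) \<nu> \<le> d (\<sigma>\<^sub>\<epsilon> \<epsilon> n x) (\<sigma> n x) + d (\<sigma>\<^sub>\<epsilon> \<epsilon> n x) \<nu>"
          using \<nu> n \<epsilon> by (intro W.triangle'' empiric_prob_measures empiric_stochastic_prob_measures)
        ultimately show "d (\<sigma> n x) \<nu> < \<rho>"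
          using e2(2)[OF \<epsilon>(1,3), of x] by simp
      qed
    qed
    then show ?thesis by blast
  qed
  then have "\<forall>k. \<exists>N. \<forall>n\<ge>N. 1 \<le> n \<longrightarrow> (AE x in m. x \<in> A \<longrightarrow> d (\<sigma> n x) \<nu> < 1 / real (Suc k))"
    by simp
  then obtain N where N: "\<And>k n. n \<ge> N k \<Longrightarrow> 1 \<le> n \<Longrightarrow> AE x in m. x \<in> A \<longrightarrow> d (\<sigma> n x) \<nu> < 1 / real (Suc k)"
    by metis
  have "AE x in m. \<forall>k n. n \<ge> N k \<longrightarrow> 1 \<le> n \<longrightarrow> x \<in> A \<longrightarrow> d (\<sigma> n x) \<nu> < 1 / real (Suc k)"
    unfolding AE_all_countable using N by (auto simp: AE_all_countable)
  then have "AE x in m. x \<in> A \<longrightarrow> attracted x \<nu>"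
  proof (rule eventually_mono, intro impI)
    fix x assume H: "\<forall>k n. n \<ge> N k \<longrightarrow> 1 \<le> n \<longrightarrow> x \<in> A \<longrightarrow> d (\<sigma> n x) \<nu> < 1 / real (Suc k)" and x: "x \<in> A"
    show "attracted x \<nu>"
      unfolding attracted_iff
    proof (intro allI impI)
      fix \<rho> :: real assume "0 < \<rho>"
      then obtain k where "1 / real (Suc k) < \<rho>"
        using nat_approx_posE by blast
      then show "\<exists>N. \<forall>n\<ge>N. 1 \<le> n \<longrightarrow> d (\<sigma> n x) \<nu> < \<rho>"
        using H x by (meson less_trans)
    qed
  qed
  with A show thesis by (rule that)
qed

lemma globally_stable_iff:
  "globally_stable_measure m B f d \<mu> \<longleftrightarrow> \<mu> \<in> prob_measures \<and> (AE x in m. attracted x \<mu>)"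
proof (intro iffI conjI)
  assume "globally_stable_measure m B f d \<mu>"
  then have st: "stable_measure m B f d \<mu>" and ae: "AE x in m. x \<in> stability_basin m B f d \<mu>"
    by (auto simp: globally_stable_measure_def)
  from st show p: "\<mu> \<in> prob_measures"
    by (simp add: stable_measure_def invariant_prob_measures)
  from ae show "AE x in m. attracted x \<mu>"
    by (simp add: stability_basin_eq_set_stability_basin set_stability_basin_singleton[OF p])
next
  assume R: "\<mu> \<in> prob_measures \<and> (AE x in m. attracted x \<mu>)"
  then have "AE x in m. x \<in> stability_basin m B f d \<mu>"
    by (simp add: stability_basin_eq_set_stability_basin set_stability_basin_singleton)
  moreover have "\<mu> \<in> invariant_measures f"
    using R ex_AE attracted_invariant by blast
  moreover have "\<exists>A\<in>sets m. 0 < emeasure m A \<and>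
        (\<forall>\<rho>>0. \<exists>N. \<forall>n\<ge>N. 1 \<le> n \<longrightarrow> (\<exists>\<epsilon>\<^sub>0>0. \<forall>\<epsilon>. 0 < \<epsilon> \<and> \<epsilon> \<le> \<epsilon>\<^sub>0 \<longrightarrow>
           (AE x in m. x \<in> A \<longrightarrow> d (\<sigma>\<^sub>\<epsilon> \<epsilon> n x) \<mu> < \<rho>)))"
  proof -
    obtain A where A: "A \<in> sets m" "0 < emeasure m A" "\<forall>\<rho>>0. \<exists>N. \<forall>n\<ge>N. 1 \<le> n \<longrightarrow>
        (\<exists>\<epsilon>\<^sub>0>0. \<forall>\<epsilon>. 0 < \<epsilon> \<and> \<epsilon> \<le> \<epsilon>\<^sub>0 \<longrightarrow> (\<forall>x\<in>A. d (\<sigma>\<^sub>\<epsilon> \<epsilon> n x) \<mu> < \<rho>))"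
      using uniformly_attracted_positive_set R by blast
    have "\<forall>\<rho>>0. \<exists>N. \<forall>n\<ge>N. 1 \<le> n \<longrightarrow>
        (\<exists>\<epsilon>\<^sub>0>0. \<forall>\<epsilon>. 0 < \<epsilon> \<and> \<epsilon> \<le> \<epsilon>\<^sub>0 \<longrightarrow> (AE x in m. x \<in> A \<longrightarrow> d (\<sigma>\<^sub>\<epsilon> \<epsilon> n x) \<mu> < \<rho>))"
    proof (intro allI impI)
      fix \<rho> :: real assume "0 < \<rho>"
      with A(3) obtain N where N: "\<And>n. n \<ge> N \<Longrightarrow> 1 \<le> n \<Longrightarrow>
          \<exists>\<epsilon>\<^sub>0>0. \<forall>\<epsilon>. 0 < \<epsilon> \<and> \<epsilon> \<le> \<epsilon>\<^sub>0 \<longrightarrow> (\<forall>x\<in>A. d (\<sigma>\<^sub>\<epsilon> \<epsilon> n x) \<mu> < \<rho>)"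
        by blast
      have "\<exists>\<epsilon>\<^sub>0>0. \<forall>\<epsilon>. 0 < \<epsilon> \<and> \<epsilon> \<le> \<epsilon>\<^sub>0 \<longrightarrow> (AE x in m. x \<in> A \<longrightarrow> d (\<sigma>\<^sub>\<epsilon> \<epsilon> n x) \<mu> < \<rho>)"
        if n: "n \<ge> N" "1 \<le> n" for n
      proof -
        obtain e where e: "e > 0" "\<And>\<epsilon> x. 0 < \<epsilon> \<Longrightarrow> \<epsilon> \<le> e \<Longrightarrow> x \<in> A \<Longrightarrow> d (\<sigma>\<^sub>\<epsilon> \<epsilon> n x) \<mu> < \<rho>"
          using N[OF n] by blast
        show ?thesis
          by (intro exI[of _ e] conjI allI impI AE_I2 e) simp_all
      qed
      then show "\<exists>N. \<forall>n\<ge>N. 1 \<le> n \<longrightarrow>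
        (\<exists>\<epsilon>\<^sub>0>0. \<forall>\<epsilon>. 0 < \<epsilon> \<and> \<epsilon> \<le> \<epsilon>\<^sub>0 \<longrightarrow> (AE x in m. x \<in> A \<longrightarrow> d (\<sigma>\<^sub>\<epsilon> \<epsilon> n x) \<mu> < \<rho>))" by blast
    qed
    with A(1,2) show ?thesis by blast
  qed
  ultimately show "globally_stable_measure m B f d \<mu>"
    by (simp add: globally_stable_measure_def stable_measure_def)
qed

text \<open>Where \<open>p_omega f x = {\<mu>}\<close>, the point \<open>x\<close> lies in the \<open>\<rho>\<close>-weak basin of \<open>\<nu>\<close> exactly if
  \<open>d \<mu> \<nu> < \<rho>\<close>.\<close>
lemma pseudo_physical_iff:
  assumes \<mu>: "\<mu> \<in> prob_measures" and ae: "AE x in m. attracted x \<mu>"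
  shows "pseudo_physical m f d \<nu> \<longleftrightarrow> \<nu> = \<mu>"
proof
  assume "\<nu> = \<mu>"
  have inv: "\<mu> \<in> invariant_measures f"
    using ae ex_AE attracted_invariant[OF \<mu>] by blast
  have "0 < emeasure m (weak_basin f d \<rho> \<mu>)" if "0 < \<rho>" for \<rho>
  proof -
    have "AE x in m. x \<in> weak_basin f d \<rho> \<mu>"
      using ae
    proof eventually_elim
      case (elim x)
      then have "p_omega f x = {\<mu>}"
        using strong_basin_iff[OF \<mu>] by (simp add: strong_basin_def)
      then show ?case
        using that \<mu> by (simp add: weak_basin_def set_dist_less_iff)
    qed
    then have "emeasure m (weak_basin f d \<rho> \<mu>) = emeasure m UNIV"
      using weak_basin_sets[OF \<mu>] by (intro emeasure_eq_AE) (auto simp: sets_m)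
    then show ?thesis using m_UNIV_pos by simp
  qed
  with inv show "pseudo_physical m f d \<nu>"
    by (simp add: \<open>\<nu> = \<mu>\<close> pseudo_physical_def)
next
  assume pp: "pseudo_physical m f d \<nu>"
  then have \<nu>: "\<nu> \<in> prob_measures"
    by (simp add: pseudo_physical_def invariant_prob_measures)
  show "\<nu> = \<mu>"
  proof (rule ccontr)
    assume "\<nu> \<noteq> \<mu>"
    then have pos: "0 < d \<mu> \<nu>" using \<mu> \<nu> by auto
    with pp have "0 < emeasure m (weak_basin f d (d \<mu> \<nu>) \<nu>)"
      by (simp add: pseudo_physical_def)
    from AE_ex_in_positive_set[OF ae weak_basin_sets[OF \<nu>] this]
    obtain x where x: "x \<in> weak_basin f d (d \<mu> \<nu>) \<nu>" "attracted x \<mu>" by blast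
    then have "p_omega f x = {\<mu>}"
      using strong_basin_iff[OF \<mu>] by (simp add: strong_basin_def)
    with x(1) show False
      by (simp add: weak_basin_def set_dist_less_iff)
  qed
qed

text \<open>The weak basin of radius \<open>\<rho>\<close> of \<open>\<eta>\<close> consists of the points whose limit set meets the ball of
  radius \<open>\<rho>\<close> around \<open>\<eta>\<close>. If \<open>\<nu> \<noteq> \<mu>\<close> is invariant, some weak basin of \<open>\<nu>\<close> is null, hence so is that
  of a smaller ball that contains \<open>\<nu>\<close> and has its centre in a fixed countable dense set. There are
  only countably many such balls, and off their null basins \<open>p_omega f x\<close> can contain nothing but
  \<open>\<mu>\<close>.\<close>
lemma unique_pseudo_physical_imp_attracted:
  assumes pp: "pseudo_physical m f d \<mu>" and uniq: "\<And>\<nu>. pseudo_physical m f d \<nu> \<Longrightarrow> \<nu> = \<mu>"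
  shows "AE x in m. attracted x \<mu>"
proof -
  have \<mu>: "\<mu> \<in> prob_measures"
    using pp by (simp add: pseudo_physical_def invariant_prob_measures)
  have "compactin W.mtopology prob_measures"
    unfolding W.compactin_sequentially
  proof (intro conjI allI impI subset_refl)
    fix s :: "nat \<Rightarrow> 'a measure" assume "range s \<subseteq> prob_measures"
    then obtain r l where "strict_mono r" "limitin weak_star (s \<circ> r) l sequentially"
      using prob_measures_sequentially_compact[OF compact_space, of s] by blast
    then show "\<exists>l r. l \<in> prob_measures \<and> strict_mono r \<and> limitin W.mtopology (s \<circ> r) l sequentially"
      unfolding mtopology_eq by (metis limitin_topspace topspace_weak_star)
  qed
  then have "W.mtotally_bounded prob_measures"
    by (rule W.compactin_imp_mtotally_bounded)
  then have "\<forall>k. \<exists>D. finite D \<and> D \<subseteq> prob_measures \<and> prob_measures \<subseteq> (\<Union>\<eta>\<in>D. W.mball \<eta> (1 / real (Suc k)))"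
    unfolding W.mtotally_bounded_def by simp
  then obtain D where D: "\<And>k. finite (D k)" "\<And>k. D k \<subseteq> prob_measures"
    "\<And>k. prob_measures \<subseteq> (\<Union>\<eta>\<in>D k. W.mball \<eta> (1 / real (Suc k)))"
    by metis
  \<comment> \<open>The basins of the balls that almost no limit set meets.\<close>
  define Z where "Z k \<eta> = (if weak_basin f d (1 / real (Suc k)) \<eta> \<in> null_sets m
    then weak_basin f d (1 / real (Suc k)) \<eta> else {})" for k \<eta>
  have "(\<Union>k. \<Union>\<eta>\<in>D k. Z k \<eta>) \<in> null_sets m"
    using D(1) by (intro null_sets_UN null_sets_UN' countable_finite) (auto simp: Z_def)
  then have "AE x in m. x \<notin> (\<Union>k. \<Union>\<eta>\<in>D k. Z k \<eta>)"
    by (rule AE_not_in)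
  then show ?thesis
  proof (rule eventually_mono)
    fix x assume x: "x \<notin> (\<Union>k. \<Union>\<eta>\<in>D k. Z k \<eta>)"
    have "\<nu> = \<mu>" if \<nu>: "\<nu> \<in> p_omega f x" for \<nu>
    proof (rule ccontr)
      assume "\<nu> \<noteq> \<mu>"
      have \<nu>p: "\<nu> \<in> prob_measures" and \<nu>i: "\<nu> \<in> invariant_measures f"
        using \<nu> p_omega_prob_measures p_omega_invariant by auto
      obtain \<rho> where \<rho>: "0 < \<rho>" "emeasure m (weak_basin f d \<rho> \<nu>) = 0"
        using uniq[of \<nu>] \<open>\<nu> \<noteq> \<mu>\<close> \<nu>i unfolding pseudo_physical_def zero_less_iff_neq_zero by blast
      obtain k where k: "1 / real (Suc k) < \<rho> / 2"
        using nat_approx_posE[of "\<rho> / 2"] \<rho>(1) by auto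
      obtain \<eta> where \<eta>: "\<eta> \<in> D k" "d \<eta> \<nu> < 1 / real (Suc k)"
        using D(3)[of k] \<nu>p by auto
      have \<eta>p: "\<eta> \<in> prob_measures" using \<eta>(1) D(2) by blast
      have "weak_basin f d (1 / real (Suc k)) \<eta> \<subseteq> weak_basin f d \<rho> \<nu>"
      proof
        fix y assume "y \<in> weak_basin f d (1 / real (Suc k)) \<eta>"
        then obtain \<xi> where \<xi>: "\<xi> \<in> p_omega f y" "d \<xi> \<eta> < 1 / real (Suc k)"
          by (auto simp: weak_basin_def set_dist_less_iff[OF p_omega_nonempty])
        have "d \<xi> \<nu> \<le> d \<xi> \<eta> + d \<eta> \<nu>"
          using \<xi>(1) p_omega_prob_measures \<eta>p \<nu>p by (intro W.triangle) auto
        also have "\<dots> < \<rho> / 2 + \<rho> / 2"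
          by (intro add_strict_mono less_trans[OF \<xi>(2) k] less_trans[OF \<eta>(2) k])
        finally show "y \<in> weak_basin f d \<rho> \<nu>"
          using \<xi>(1) by (auto simp: weak_basin_def set_dist_less_iff[OF p_omega_nonempty])
      qed
      then have "weak_basin f d (1 / real (Suc k)) \<eta> \<in> null_sets m"
        using \<rho>(2) weak_basin_sets[OF \<nu>p] weak_basin_sets[OF \<eta>p]
        by (meson null_sets_subset null_setsI)
      moreover have "x \<in> weak_basin f d (1 / real (Suc k)) \<eta>"
        using \<nu> \<eta>(2) W.commute[of \<eta> \<nu>]
        by (auto simp: weak_basin_def set_dist_less_iff[OF p_omega_nonempty])
      ultimately show False
        using x \<eta>(1) by (auto simp: Z_def)
    qed
    then have "p_omega f x = {\<mu>}"
      using p_omega_nonempty[of x] by auto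
    then show "attracted x \<mu>"
      using strong_basin_iff[OF \<mu>] by (simp add: strong_basin_def)
  qed
qed

lemma stable_measure_iff:
  assumes \<mu>: "\<mu> \<in> prob_measures" and ae: "AE x in m. attracted x \<mu>"
  shows "stable_measure m B f d \<nu> \<longleftrightarrow> \<nu> = \<mu>"
proof
  assume "\<nu> = \<mu>"
  then show "stable_measure m B f d \<nu>"
    using globally_stable_iff[of \<mu>] \<mu> ae by (simp add: globally_stable_measure_def)
next
  assume st: "stable_measure m B f d \<nu>"
  then have \<nu>: "\<nu> \<in> prob_measures"
    by (simp add: stable_measure_def invariant_prob_measures)
  obtain A where A: "A \<in> sets m" "0 < emeasure m A" "AE x in m. x \<in> A \<longrightarrow> attracted x \<nu>"
    using stable_measure_imp_attracted[OF st] by blast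
  from A(3) ae have "AE x in m. (x \<in> A \<longrightarrow> attracted x \<nu>) \<and> attracted x \<mu>"
    by eventually_elim simp
  from AE_ex_in_positive_set[OF this A(1,2)] show "\<nu> = \<mu>"
    using attracted_unique \<mu> \<nu> by blast
qed

text \<open>The averages approach both \<open>\<mu>\<close> and \<open>K\<close>, and \<open>K\<close> is closed.\<close>
lemma attracted_mem_compact:
  assumes K: "K \<noteq> {}" "K \<subseteq> prob_measures" "compactin weak_star K"
    and x: "x \<in> set_stability_basin m B f d K" and c: "attracted x \<mu>" and \<mu>: "\<mu> \<in> prob_measures"
  shows "\<mu> \<in> K"
proof -
  have "\<exists>\<kappa>\<in>K. d \<mu> \<kappa> < \<rho>" if "0 < \<rho>" for \<rho> :: real
  proof -
    have \<rho>2: "0 < \<rho> / 2" using that by simp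
    obtain N where N: "\<And>n. n \<ge> N \<Longrightarrow> 1 \<le> n \<Longrightarrow> \<exists>\<kappa>\<in>K. d (\<sigma> n x) \<kappa> < \<rho> / 2"
      using x \<rho>2 unfolding set_stability_basin_iff[OF K(1,2)] by blast
    obtain N' where N': "\<And>n. n \<ge> N' \<Longrightarrow> 1 \<le> n \<Longrightarrow> d (\<sigma> n x) \<mu> < \<rho> / 2"
      using c \<rho>2 unfolding attracted_iff by blast
    define n where "n = Suc (max N N')"
    have n: "n \<ge> N" "n \<ge> N'" "1 \<le> n" by (auto simp: n_def)
    obtain \<kappa> where \<kappa>: "\<kappa> \<in> K" "d (\<sigma> n x) \<kappa> < \<rho> / 2" using N[OF n(1,3)] by blast
    have "d \<mu> \<kappa> \<le> d (\<sigma> n x) \<mu> + d (\<sigma> n x) \<kappa>"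
      using \<kappa>(1) K(2) \<mu> by (intro W.triangle'' empiric_prob_measures n) auto
    with \<kappa> N'[OF n(2,3)] show ?thesis
      by (intro bexI[of _ \<kappa>]) auto
  qed
  then have "\<mu> \<in> W.mtopology closure_of K"
    using \<mu> K(2) unfolding W.metric_closure_of by (fastforce simp: W.in_mball)
  moreover have "closedin W.mtopology K"
    using K(3) W.Hausdorff_space_mtopology compactin_imp_closedin by (metis mtopology_eq)
  ultimately show ?thesis
    by (simp add: closure_of_closedin)
qed

text \<open>A point of the set \<open>A\<close> in the definition of stability that is attracted to \<open>\<mu>\<close> shows
  \<open>\<mu> \<in> K\<close>; the minimality condition with \<open>K' = {\<mu>}\<close>, whose basin has full measure, gives the
  other inclusion.\<close>
lemma stable_set_iff:
  assumes \<mu>: "\<mu> \<in> prob_measures" and ae: "AE x in m. attracted x \<mu>"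
  shows "stable_set m B f d K \<longleftrightarrow> K = {\<mu>}"
proof
  have inv: "\<mu> \<in> invariant_measures f"
    using ae ex_AE attracted_invariant[OF \<mu>] by blast
  have comp: "compactin weak_star {\<mu>}"
    using \<mu> by simp
  have basin: "AE x in m. x \<in> set_stability_basin m B f d {\<mu>}"
    using ae by (simp add: set_stability_basin_singleton[OF \<mu>])
  {
    assume "K = {\<mu>}"
    have "{\<mu>} \<subseteq> K'" if K': "K' \<noteq> {}" "K' \<subseteq> invariant_measures f" "compactin weak_star K'"
      "AE x in m. x \<in> set_stability_basin m B f d {\<mu>} \<longrightarrow> x \<in> set_stability_basin m B f d K'" for K'
    proof -
      from K'(4) basin ae have "AE x in m. x \<in> set_stability_basin m B f d K' \<and> attracted x \<mu>"
        by eventually_elim simp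
      from ex_AE[OF this] show ?thesis
        using attracted_mem_compact[OF K'(1) _ K'(3)] K'(2) \<mu> invariant_prob_measures by blast
    qed
    moreover have "\<exists>A\<in>sets m. 0 < emeasure m A \<and>
        (\<forall>\<rho>>0. \<exists>N. \<forall>n\<ge>N. 1 \<le> n \<longrightarrow> (\<exists>\<epsilon>\<^sub>0>0. \<forall>\<epsilon>. 0 < \<epsilon> \<and> \<epsilon> \<le> \<epsilon>\<^sub>0 \<longrightarrow>
           (\<forall>x\<in>A. set_dist d {\<sigma>\<^sub>\<epsilon> \<epsilon> n x} {\<mu>} < \<rho>)))"
      using uniformly_attracted_positive_set[OF \<mu> ae] by (simp add: set_dist_less_iff)
    ultimately show "stable_set m B f d K"
      unfolding stable_set_def \<open>K = {\<mu>}\<close> using inv comp by blast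
  }
  {
    assume st: "stable_set m B f d K"
    then have K: "K \<noteq> {}" "K \<subseteq> invariant_measures f" "compactin weak_star K"
      by (auto simp: stable_set_def)
    have Kp: "K \<subseteq> prob_measures" using K(2) invariant_prob_measures by blast
    obtain A where A: "A \<in> sets m" "0 < emeasure m A" and stA: "\<And>\<rho>. 0 < \<rho> \<Longrightarrow>
        \<exists>N. \<forall>n\<ge>N. 1 \<le> n \<longrightarrow> (\<exists>\<epsilon>\<^sub>0>0. \<forall>\<epsilon>. 0 < \<epsilon> \<and> \<epsilon> \<le> \<epsilon>\<^sub>0 \<longrightarrow>
           (\<forall>x\<in>A. set_dist d {\<sigma>\<^sub>\<epsilon> \<epsilon> n x} K < \<rho>))"
      using st unfolding stable_set_def by blast
    obtain x where x: "x \<in> A" "attracted x \<mu>"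
      using AE_ex_in_positive_set[OF ae A] by blast
    have "x \<in> set_stability_basin m B f d K"
      unfolding set_stability_basin_def mem_Collect_eq
    proof (intro allI impI)
      fix \<rho> :: real assume "0 < \<rho>"
      from stA[OF this] show "\<exists>N. \<forall>n\<ge>N. 1 \<le> n \<longrightarrow> (\<exists>\<epsilon>\<^sub>0>0. \<forall>\<epsilon>. 0 < \<epsilon> \<and> \<epsilon> \<le> \<epsilon>\<^sub>0 \<longrightarrow>
        set_dist d {\<sigma>\<^sub>\<epsilon> \<epsilon> n x} K < \<rho>)"
        using x(1) by meson
    qed
    then have "\<mu> \<in> K"
      by (rule attracted_mem_compact[OF K(1) Kp K(3) _ x(2) \<mu>])
    moreover have "K \<subseteq> {\<mu>}"
    proof -
      have "AE x in m. x \<in> set_stability_basin m B f d K \<longrightarrow> x \<in> set_stability_basin m B f d {\<mu>}"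
        using basin by eventually_elim simp
      then show ?thesis
        using st inv comp unfolding stable_set_def by blast
    qed
    ultimately show "K = {\<mu>}" by auto
  }
qed

text \<open>Each of the three conditions is reduced to \<open>full \<mu>\<close>, that is, to the attraction of almost all
  points to \<open>\<mu>\<close>, which determines \<open>\<mu>\<close>.\<close>
theorem equivalences:
  defines "cond_i \<equiv> \<lambda>\<mu>\<^sub>1. globally_stable_measure m B f d \<mu>\<^sub>1"
    and "cond_ii \<equiv> \<lambda>\<mu>\<^sub>2. physical m f \<mu>\<^sub>2 \<and> (AE x in m. x \<in> strong_basin f \<mu>\<^sub>2)"
    and "cond_iii \<equiv> \<lambda>\<mu>\<^sub>3. pseudo_physical m f d \<mu>\<^sub>3"
  shows "((\<exists>\<mu>\<^sub>1. cond_i \<mu>\<^sub>1) \<longleftrightarrow> (\<exists>\<mu>\<^sub>2. cond_ii \<mu>\<^sub>2)) \<and>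
    ((\<exists>\<mu>\<^sub>2. cond_ii \<mu>\<^sub>2) \<longleftrightarrow> (\<exists>!\<mu>\<^sub>3. cond_iii \<mu>\<^sub>3)) \<and>
    ((\<exists>\<mu>\<^sub>1. cond_i \<mu>\<^sub>1) \<or> (\<exists>\<mu>\<^sub>2. cond_ii \<mu>\<^sub>2) \<or> (\<exists>!\<mu>\<^sub>3. cond_iii \<mu>\<^sub>3) \<longrightarrow>
      (\<exists>\<mu>. (\<forall>\<mu>\<^sub>1. cond_i \<mu>\<^sub>1 \<longleftrightarrow> \<mu>\<^sub>1 = \<mu>) \<and>
        (\<forall>\<mu>\<^sub>2. cond_ii \<mu>\<^sub>2 \<longleftrightarrow> \<mu>\<^sub>2 = \<mu>) \<and>
        (\<forall>\<mu>\<^sub>3. cond_iii \<mu>\<^sub>3 \<longleftrightarrow> \<mu>\<^sub>3 = \<mu>) \<and>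
        (\<forall>\<nu>. stable_measure m B f d \<nu> \<longleftrightarrow> \<nu> = \<mu>) \<and>
        (\<forall>K. stable_set m B f d K \<longleftrightarrow> K = {\<mu>})))"
proof -
  define full where "full \<mu> \<longleftrightarrow> \<mu> \<in> prob_measures \<and> (AE x in m. attracted x \<mu>)" for \<mu>
  have i: "cond_i \<mu> \<longleftrightarrow> full \<mu>" and ii: "cond_ii \<mu> \<longleftrightarrow> full \<mu>" for \<mu>
    unfolding cond_i_def cond_ii_def full_def by (rule globally_stable_iff, rule physical_full_iff)
  have iii: "cond_iii \<nu> \<longleftrightarrow> \<nu> = \<mu>" if "full \<mu>" for \<mu> \<nu>
    using that pseudo_physical_iff by (simp add: cond_iii_def full_def)
  have unique: "full \<nu> \<longleftrightarrow> \<nu> = \<mu>" if "full \<mu>" for \<mu> \<nu>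
    using that iii by blast
  have converse: "full \<mu>" if "cond_iii \<mu>" "\<And>\<nu>. cond_iii \<nu> \<Longrightarrow> \<nu> = \<mu>" for \<mu>
    unfolding full_def
  proof
    show "AE x in m. attracted x \<mu>"
      using that unfolding cond_iii_def by (rule unique_pseudo_physical_imp_attracted)
    show "\<mu> \<in> prob_measures"
      using that(1) by (simp add: cond_iii_def pseudo_physical_def invariant_prob_measures)
  qed
  have ex: "(\<exists>\<mu>. full \<mu>) \<longleftrightarrow> (\<exists>!\<mu>. cond_iii \<mu>)"
  proof
    assume "\<exists>\<mu>. full \<mu>"
    then obtain \<mu> where "full \<mu>" ..
    then show "\<exists>!\<mu>. cond_iii \<mu>" using iii by simp
  next
    assume "\<exists>!\<mu>. cond_iii \<mu>"
    then obtain \<mu> where "cond_iii \<mu>" "\<And>\<nu>. cond_iii \<nu> \<Longrightarrow> \<nu> = \<mu>" by blast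
    then have "full \<mu>" by (rule converse)
    then show "\<exists>\<mu>. full \<mu>" ..
  qed
  have "\<exists>\<mu>. (\<forall>\<mu>\<^sub>1. full \<mu>\<^sub>1 \<longleftrightarrow> \<mu>\<^sub>1 = \<mu>) \<and> (\<forall>\<mu>\<^sub>2. full \<mu>\<^sub>2 \<longleftrightarrow> \<mu>\<^sub>2 = \<mu>) \<and>
      (\<forall>\<mu>\<^sub>3. cond_iii \<mu>\<^sub>3 \<longleftrightarrow> \<mu>\<^sub>3 = \<mu>) \<and> (\<forall>\<nu>. stable_measure m B f d \<nu> \<longleftrightarrow> \<nu> = \<mu>) \<and>
      (\<forall>K. stable_set m B f d K \<longleftrightarrow> K = {\<mu>})" if "full \<mu>" for \<mu>
    using unique[OF that] iii[OF that] stable_measure_iff[of \<mu>] stable_set_iff[of \<mu>] that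
    unfolding full_def by (intro exI[of _ \<mu>]) simp
  then show ?thesis
    unfolding i ii ex[symmetric] by blast
qed

end

section \<open>Charts and metric matrices\<close>

lemma smooth_on_imp_continuous_on:
  assumes "smooth_on S h"
  shows "continuous_on S h"
  unfolding continuous_on_eq_continuous_within
proof
  fix x assume x: "x \<in> S"
  obtain W H where W: "open W" "x \<in> W" "\<forall>k. Ck_on k H W" "\<forall>y\<in>W \<inter> S. H y = h y"
    using bspec[OF assms[unfolded smooth_on_def] x] by blast
  have "isCont H x"
    using spec[OF W(3), of 0] W(1,2) by (simp add: continuous_on_eq_continuous_at)
  then have "(H \<longlongrightarrow> H x) (at x within S)"
    unfolding isCont_def by (rule tendsto_within_subset) simp
  moreover have "\<forall>\<^sub>F y in at x within S. H y = h y"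
    using W by (auto simp: eventually_at_topological)
  ultimately have "(h \<longlongrightarrow> H x) (at x within S)"
    using tendsto_cong by blast
  then show "continuous (at x within S) h"
    using W(2,4) x by (simp add: continuous_within)
qed

lemma smooth_on_imp_differentiable_within:
  assumes "smooth_on S h" "x \<in> S"
  obtains D where "(h has_derivative D) (at x within S)"
proof -
  obtain W H where W: "open W" "x \<in> W" "\<forall>k. Ck_on k H W" "\<forall>y\<in>W \<inter> S. H y = h y"
    using bspec[OF assms(1)[unfolded smooth_on_def] assms(2)] by blast
  have "H differentiable_on W"
    using spec[OF W(3), of 1] by simp
  then have "H differentiable (at x)"
    using W(1,2) by (simp add: differentiable_on_eq_differentiable_at)
  then obtain D where "(H has_derivative D) (at x)"
    by (auto simp: differentiable_def)
  then have "(H has_derivative D) (at x within S)"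
    by (rule has_derivative_at_withinI)
  then have "(h has_derivative D) (at x within S)"
  proof (rule has_derivative_transform_eventually)
    show "\<forall>\<^sub>F y in at x within S. H y = h y"
      using W by (auto simp: eventually_at_topological)
  qed (use W assms in auto)
  then show thesis by (rule that)
qed

lemma inner_matrix_vector_eq_sum:
  fixes G :: "real ^ 'n ^ 'n"
  shows "v \<bullet> (G *v w) = (\<Sum>i\<in>UNIV. v $ i * (\<Sum>j\<in>UNIV. G $ i $ j * w $ j))"
  by (simp add: inner_vec_def matrix_vector_mult_def)

lemma continuous_on_det:
  fixes G :: "'b::topological_space \<Rightarrow> real ^ 'n ^ 'n"
  assumes "continuous_on S G"
  shows "continuous_on S (\<lambda>y. det (G y))"
  unfolding det_def by (intro continuous_intros assms)

text \<open>Along the segment from the identity matrix to \<open>G\<close> all matrices are positive definite, hence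
  the determinant does not vanish there and keeps the sign it has at the identity.\<close>
lemma det_pos_definite:
  fixes G :: "real ^ 'n ^ 'n"
  assumes G: "\<And>v. v \<noteq> 0 \<Longrightarrow> 0 < v \<bullet> (G *v v)"
  shows "0 < det G"
proof -
  define H where "H t = (1 - t) *\<^sub>R mat 1 + t *\<^sub>R G" for t :: real
  have Hv: "H t *v v = (1 - t) *\<^sub>R v + t *\<^sub>R (G *v v)" for t v
    by (simp add: H_def matrix_vector_mult_add_rdistrib scaleR_matrix_vector_assoc[symmetric])
  have nz: "det (H t) \<noteq> 0" if "t \<in> {0..1}" for t
  proof -
    have "v = 0" if "H t *v v = 0" for v
    proof (rule ccontr)
      assume v: "v \<noteq> 0"
      have "v \<bullet> (H t *v v) = (1 - t) * (v \<bullet> v) + t * (v \<bullet> (G *v v))"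
        by (simp add: Hv inner_add_right)
      moreover have "0 < (1 - t) * (v \<bullet> v) + t * (v \<bullet> (G *v v))"
      proof (cases "t = 0")
        case False
        then have "0 < t * (v \<bullet> (G *v v))" "0 \<le> (1 - t) * (v \<bullet> v)"
          using G[OF v] \<open>t \<in> {0..1}\<close> by auto
        then show ?thesis by linarith
      qed (use v in simp)
      ultimately show False using \<open>H t *v v = 0\<close> by simp
    qed
    then show ?thesis
      using matrix_left_invertible_ker[of "H t"] invertible_left_inverse[of "H t"] invertible_det_nz by blast
  qed
  have cont: "continuous_on {0..1} (\<lambda>t. det (H t))"
    unfolding H_def by (intro continuous_on_det continuous_intros)
  show ?thesis
  proof (rule ccontr)
    assume "\<not> 0 < det G"
    then have "det (H 1) \<le> 0" "0 \<le> det (H 0)"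
      by (simp_all add: H_def)
    from IVT2'[OF this _ cont] show False
      using nz by auto
  qed
qed

text \<open>The extreme values of the form over \<open>Q\<close> and the unit sphere, extended by homogeneity.\<close>
lemma quadratic_form_bounds_on_compact:
  fixes G :: "real ^ 'n \<Rightarrow> real ^ 'n ^ 'n"
  assumes Q: "compact Q" and G: "continuous_on Q G"
    and pos: "\<And>y v. y \<in> Q \<Longrightarrow> v \<noteq> 0 \<Longrightarrow> 0 < v \<bullet> (G y *v v)"
  obtains c C where "0 < c" "0 < C"
    "\<And>y v. y \<in> Q \<Longrightarrow> c * (norm v)\<^sup>2 \<le> v \<bullet> (G y *v v)"
    "\<And>y v. y \<in> Q \<Longrightarrow> v \<bullet> (G y *v v) \<le> C * (norm v)\<^sup>2"
proof (cases "Q = {}")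
  case True
  then show thesis using that[of 1 1] by simp
next
  case False
  define q where "q p = snd p \<bullet> (G (fst p) *v snd p)" for p
  define K where "K = Q \<times> sphere (0 :: real ^ 'n) 1"
  have "compact K"
    unfolding K_def using Q by (intro compact_Times compact_sphere)
  moreover have "K \<noteq> {}"
    using False unfolding K_def by auto
  moreover have "continuous_on K q"
  proof -
    have "continuous_on K (\<lambda>p. G (fst p))"
      by (rule continuous_on_compose2[OF G continuous_on_fst[OF continuous_on_id]]) (auto simp: K_def)
    then show ?thesis
      unfolding q_def inner_matrix_vector_eq_sum by (intro continuous_intros)
  qed
  ultimately obtain p1 p2 where p: "p1 \<in> K" "\<And>p. p \<in> K \<Longrightarrow> q p1 \<le> q p"
    "p2 \<in> K" "\<And>p. p \<in> K \<Longrightarrow> q p \<le> q p2"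
    using continuous_attains_inf[of K q] continuous_attains_sup[of K q] by blast
  have scale: "v \<bullet> (G y *v v) = (norm v)\<^sup>2 * q (y, v /\<^sub>R norm v)" if "v \<noteq> 0" for y v
    using that by (simp add: q_def matrix_vector_mult_scaleR power2_eq_square field_simps)
  have inK: "(y, v /\<^sub>R norm v) \<in> K" if "y \<in> Q" "v \<noteq> 0" for y v
    using that by (simp add: K_def)
  have pos1: "0 < q p1" "0 < q p2"
    using p(1,3) by (auto simp: K_def q_def intro!: pos)
  show thesis
  proof (rule that[OF pos1])
    show "q p1 * (norm v)\<^sup>2 \<le> v \<bullet> (G y *v v)" if "y \<in> Q" for y v
    proof (cases "v = 0")
      case False
      then show ?thesis
        using p(2)[OF inK[OF that False]] by (simp add: scale mult.commute mult_left_mono)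
    qed simp
    show "v \<bullet> (G y *v v) \<le> q p2 * (norm v)\<^sup>2" if "y \<in> Q" for y v
    proof (cases "v = 0")
      case False
      then show ?thesis
        using p(4)[OF inK[OF that False]] by (simp add: scale mult.commute mult_left_mono)
    qed simp
  qed
qed

locale compact_riemannian =
  fixes \<A> :: "('a::{t2_space, second_countable_topology}, 'n::finite) chart set"
    and g :: "('a, 'n) metric_matrices"
  assumes crm: "compact_riemannian_manifold \<A> g"
begin

lemma compact_UNIV: "compact (UNIV :: 'a set)"
  using crm by (simp add: compact_riemannian_manifold_def)

lemma chart_exists: "\<exists>U \<phi>. (U, \<phi>) \<in> \<A> \<and> p \<in> U"
proof -
  have "(\<Union>(U, \<phi>)\<in>\<A>. U) = UNIV"
    using crm by (simp add: compact_riemannian_manifold_def smooth_atlas_def)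
  then show ?thesis by blast
qed

lemma
  assumes "(U, \<phi>) \<in> \<A>"
  shows chart_open: "open U"
    and chart_continuous: "continuous_on U \<phi>"
    and chart_inv_continuous: "continuous_on (\<phi> ` U) (inv_into U \<phi>)"
    and chart_inj: "inj_on \<phi> U"
    and chart_image: "\<exists>H. (H = UNIV \<or> (\<exists>k. H = {v. 0 \<le> v $ k})) \<and> openin (top_of_set H) (\<phi> ` U)"
proof -
  have "is_chart (U, \<phi>)"
    using assms crm by (auto simp: compact_riemannian_manifold_def smooth_atlas_def)
  then show "open U" "continuous_on U \<phi>" "continuous_on (\<phi> ` U) (inv_into U \<phi>)" "inj_on \<phi> U"
    "\<exists>H. (H = UNIV \<or> (\<exists>k. H = {v. 0 \<le> v $ k})) \<and> openin (top_of_set H) (\<phi> ` U)"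
    by (auto simp: is_chart_def homeomorphism_def intro: inj_on_inverseI)
qed

lemma transition_smooth:
  "(U, \<phi>) \<in> \<A> \<Longrightarrow> (V, \<psi>) \<in> \<A> \<Longrightarrow> smooth_on (\<phi> ` (U \<inter> V)) (\<psi> \<circ> inv_into U \<phi>)"
  using crm by (fastforce simp: compact_riemannian_manifold_def smooth_atlas_def)

lemma metric_continuous: "(U, \<phi>) \<in> \<A> \<Longrightarrow> continuous_on (\<phi> ` U) (g (U, \<phi>))"
  using crm by (auto simp: compact_riemannian_manifold_def riemannian_metric_def
      intro!: smooth_on_imp_continuous_on)

lemma metric_pos: "(U, \<phi>) \<in> \<A> \<Longrightarrow> y \<in> \<phi> ` U \<Longrightarrow> v \<noteq> 0 \<Longrightarrow> 0 < v \<bullet> (g (U, \<phi>) y *v v)"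
  using crm by (fastforce simp: compact_riemannian_manifold_def riemannian_metric_def)

lemma metric_change_of_chart:
  assumes "(U, \<phi>) \<in> \<A>" "(V, \<psi>) \<in> \<A>" "y \<in> \<phi> ` (U \<inter> V)"
    "((\<psi> \<circ> inv_into U \<phi>) has_derivative D) (at y within \<phi> ` (U \<inter> V))"
  shows "v \<bullet> (g (U, \<phi>) y *v w) = D v \<bullet> (g (V, \<psi>) (\<psi> (inv_into U \<phi> y)) *v D w)"
proof -
  have "\<forall>(U, \<phi>)\<in>\<A>. \<forall>(V, \<psi>)\<in>\<A>. \<forall>y\<in>\<phi> ` (U \<inter> V). \<forall>D.
        ((\<psi> \<circ> inv_into U \<phi>) has_derivative D) (at y within \<phi> ` (U \<inter> V)) \<longrightarrow>
        (\<forall>v w. v \<bullet> (g (U, \<phi>) y *v w) = D v \<bullet> (g (V, \<psi>) (\<psi> (inv_into U \<phi> y)) *v D w))"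
    using crm by (simp add: compact_riemannian_manifold_def riemannian_metric_def)
  from bspec[OF this assms(1)] have "\<forall>(V, \<psi>)\<in>\<A>. \<forall>y\<in>\<phi> ` (U \<inter> V). \<forall>D.
        ((\<psi> \<circ> inv_into U \<phi>) has_derivative D) (at y within \<phi> ` (U \<inter> V)) \<longrightarrow>
        (\<forall>v w. v \<bullet> (g (U, \<phi>) y *v w) = D v \<bullet> (g (V, \<psi>) (\<psi> (inv_into U \<phi> y)) *v D w))" by simp
  from bspec[OF this assms(2)] have "\<forall>y\<in>\<phi> ` (U \<inter> V). \<forall>D.
        ((\<psi> \<circ> inv_into U \<phi>) has_derivative D) (at y within \<phi> ` (U \<inter> V)) \<longrightarrow>
        (\<forall>v w. v \<bullet> (g (U, \<phi>) y *v w) = D v \<bullet> (g (V, \<psi>) (\<psi> (inv_into U \<phi> y)) *v D w))"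
    by (simp only: prod.case)
  from bspec[OF this assms(3)] show ?thesis
    using assms(4) by blast
qed

text \<open>A coordinate ball around \<open>p\<close>, or the part of one in the half-space if the chart is modelled on a
  half-space. It is convex, so that segments stay inside, and it contains a full ball of
  the coordinate space, so that it has positive volume.\<close>
lemma coordinate_ball:
  assumes ch: "(U, \<phi>) \<in> \<A>" and p: "p \<in> U" "p \<in> W" "open W"
  obtains r Q s q where "0 < r" "compact Q" "convex Q" "Q \<subseteq> \<phi> ` (U \<inter> W)"
    "\<And>x. x \<in> U \<Longrightarrow> norm (\<phi> x - \<phi> p) \<le> r \<Longrightarrow> \<phi> x \<in> Q"
    "0 < s" "cball q s \<subseteq> Q"
proof -
  obtain H where H: "H = UNIV \<or> (\<exists>k. H = {v. 0 \<le> v $ k})" "openin (top_of_set H) (\<phi> ` U)"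
    using chart_image[OF ch] by blast
  have "openin (top_of_set (\<phi> ` U)) (\<phi> ` (U \<inter> W))"
  proof -
    have "openin (top_of_set (\<phi> ` U)) (\<phi> ` U \<inter> inv_into U \<phi> -` W)"
      using chart_inv_continuous[OF ch] p(3) by (simp add: continuous_openin_preimage_gen)
    moreover have "\<phi> ` U \<inter> inv_into U \<phi> -` W = \<phi> ` (U \<inter> W)"
      using chart_inj[OF ch] by auto
    ultimately show ?thesis by simp
  qed
  then have op: "openin (top_of_set H) (\<phi> ` (U \<inter> W))"
    using H(2) by (rule openin_trans)
  moreover have "\<phi> p \<in> \<phi> ` (U \<inter> W)" using p by blast
  ultimately obtain r where r: "r > 0" "cball (\<phi> p) r \<inter> H \<subseteq> \<phi> ` (U \<inter> W)"
    unfolding openin_contains_cball by blast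
  have UH: "\<phi> ` U \<subseteq> H" using H(2) openin_imp_subset by blast
  have cH: "closed H" "convex H"
    using H(1) by (auto intro!: closed_Collect_le continuous_intros simp: convex_def)
  define Q where "Q = cball (\<phi> p) r \<inter> H"
  have "\<exists>q s. 0 < s \<and> cball q s \<subseteq> Q"
  proof (cases "H = UNIV")
    case True
    then show ?thesis using r(1) by (auto simp: Q_def intro!: exI[of _ "\<phi> p"] exI[of _ r])
  next
    case False
    then obtain k where k: "H = {v. 0 \<le> v $ k}" using H(1) by blast
    \<comment> \<open>Pushing the centre into the half-space by \<open>r / 2\<close> leaves room for a ball of that radius.\<close>
    define q where "q = \<phi> p + axis k (r / 2)"
    have "y \<in> Q" if "y \<in> cball q (r / 2)" for y
    proof -
      have d: "norm (y - q) \<le> r / 2" using that by (simp add: dist_norm norm_minus_commute)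
      have "norm (y - \<phi> p) \<le> norm (y - q) + norm (q - \<phi> p)"
        using norm_triangle_ineq[of "y - q" "q - \<phi> p"] by simp
      moreover have "axis k (r / 2) = (r / 2) *\<^sub>R (axis k 1 :: real ^ 'n)"
        by (simp add: axis_def vec_eq_iff)
      then have "norm (q - \<phi> p) = r / 2"
        using r(1) by (simp add: q_def)
      ultimately have yr: "norm (y - \<phi> p) \<le> r" using d by simp
      have "\<bar>(y - q) $ k\<bar> \<le> r / 2"
        using component_le_norm_cart[of "y - q" k] d by linarith
      moreover have "(y - q) $ k = y $ k - \<phi> p $ k - r / 2"
        by (simp add: q_def axis_def)
      ultimately have "\<phi> p $ k \<le> y $ k"
        by linarith
      then have "0 \<le> y $ k"
        using UH p(1) k by force
      with yr show ?thesis
        by (simp add: Q_def k dist_norm norm_minus_commute)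
    qed
    then show ?thesis using r(1) by (intro exI[of _ q] exI[of _ "r / 2"]) auto
  qed
  then obtain q s where "0 < s" "cball q s \<subseteq> Q" by blast
  moreover have "compact Q" "convex Q"
    unfolding Q_def using cH by (auto intro: compact_Int_closed convex_Int)
  moreover have "\<phi> x \<in> Q" if "x \<in> U" "norm (\<phi> x - \<phi> p) \<le> r" for x
    using that UH by (auto simp: Q_def dist_norm norm_minus_commute)
  ultimately show thesis
    using that[of r Q s q] r by (auto simp: Q_def)
qed

lemma coordinate_ball_open:
  assumes "(U, \<phi>) \<in> \<A>"
  shows "open {x \<in> U. norm (\<phi> x - z) < r}"
proof -
  have "continuous_on U (\<lambda>x. norm (\<phi> x - z))"
    using chart_continuous[OF assms] by (intro continuous_intros)
  from continuous_open_preimage[OF this chart_open[OF assms] open_lessThan]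
  have "open (U \<inter> (\<lambda>x. norm (\<phi> x - z)) -` {..<r})" .
  then show ?thesis
    by (simp add: vimage_def Int_def conj_commute)
qed

lemma metric_bounds:
  assumes ch: "(U, \<phi>) \<in> \<A>" and Q: "compact Q" "Q \<subseteq> \<phi> ` U"
  obtains c C where "0 < c" "0 < C"
    "\<And>y v. y \<in> Q \<Longrightarrow> c * (norm v)\<^sup>2 \<le> v \<bullet> (g (U, \<phi>) y *v v)"
    "\<And>y v. y \<in> Q \<Longrightarrow> v \<bullet> (g (U, \<phi>) y *v v) \<le> C * (norm v)\<^sup>2"
  by (rule quadratic_form_bounds_on_compact[OF Q(1)
        continuous_on_subset[OF metric_continuous[OF ch] Q(2)] metric_pos[OF ch subsetD[OF Q(2)]]])
    (assumption | rule that)+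

lemma volume_bounds:
  assumes ch: "(U, \<phi>) \<in> \<A>" and Q: "compact Q" "Q \<subseteq> \<phi> ` U"
  obtains c C where "0 < c" "\<And>y. y \<in> Q \<Longrightarrow> c \<le> sqrt (det (g (U, \<phi>) y))"
    "\<And>y. y \<in> Q \<Longrightarrow> sqrt (det (g (U, \<phi>) y)) \<le> C"
proof (cases "Q = {}")
  case True
  then show thesis using that[of 1] by simp
next
  case False
  define h where "h y = sqrt (det (g (U, \<phi>) y))" for y
  have "continuous_on Q h"
    unfolding h_def using continuous_on_subset[OF metric_continuous[OF ch] Q(2)]
    by (intro continuous_intros continuous_on_det)
  then obtain y1 y2 where y: "y1 \<in> Q" "\<And>y. y \<in> Q \<Longrightarrow> h y1 \<le> h y" "\<And>y. y \<in> Q \<Longrightarrow> h y \<le> h y2"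
    using continuous_attains_inf[OF Q(1) False] continuous_attains_sup[OF Q(1) False] by blast
  have "0 < h y1"
    using det_pos_definite[OF metric_pos[OF ch]] y(1) Q(2) by (auto simp: h_def)
  then show thesis
    using that[of "h y1" "h y2"] y by (simp add: h_def)
qed

end

section \<open>The Riemannian volume\<close>

locale compact_riemannian_volume = compact_riemannian \<A> g
  for \<A> :: "('a::{t2_space, second_countable_topology}, 'n::finite) chart set" and g +
  fixes m :: "'a measure"
  assumes vol: "riemannian_volume \<A> g m"
begin

lemma sets_volume: "sets m = sets borel"
  using vol by (simp add: riemannian_volume_def)

lemma volume_eq:
  "(U, \<phi>) \<in> \<A> \<Longrightarrow> S \<in> sets borel \<Longrightarrow> S \<subseteq> U \<Longrightarrow>
    emeasure m S = (\<integral>\<^sup>+y\<in>\<phi> ` S. ennreal (sqrt (det (g (U, \<phi>) y))) \<partial>lborel)"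
  using vol by (fastforce simp: riemannian_volume_def)

text \<open>Every point has a neighbourhood whose coordinate image lies in a compact set on which the density
  is bounded.\<close>
lemma finite_volume: "finite_measure m"
proof
  have sp: "space m = UNIV"
    using sets_eq_imp_space_eq[OF sets_volume] by simp
  have "\<exists>V. open V \<and> p \<in> V \<and> emeasure m V < \<infinity>" for p
  proof -
    obtain U \<phi> where ch: "(U, \<phi>) \<in> \<A>" "p \<in> U" using chart_exists by blast
    obtain r Q q s where r: "0 < r" "compact Q" "convex Q" "Q \<subseteq> \<phi> ` (U \<inter> UNIV)"
      "\<And>x. x \<in> U \<Longrightarrow> norm (\<phi> x - \<phi> p) \<le> r \<Longrightarrow> \<phi> x \<in> Q"
      "0 < s" "cball q s \<subseteq> Q"
      by (rule coordinate_ball[OF ch UNIV_I open_UNIV]) (rule that; blast)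
    have QU: "Q \<subseteq> \<phi> ` U" using r(4) by auto
    obtain c C where C: "0 < c" "\<And>y. y \<in> Q \<Longrightarrow> c \<le> sqrt (det (g (U, \<phi>) y))"
      "\<And>y. y \<in> Q \<Longrightarrow> sqrt (det (g (U, \<phi>) y)) \<le> C"
      by (rule volume_bounds[OF ch(1) r(2) QU]) (rule that; blast)
    define V where "V = {x \<in> U. norm (\<phi> x - \<phi> p) < r}"
    have V: "open V" "p \<in> V" "V \<subseteq> U"
      using coordinate_ball_open[OF ch(1)] ch(2) r(1) by (auto simp: V_def)
    have VQ: "\<phi> ` V \<subseteq> Q"
      using r(5) by (auto simp: V_def)
    have "emeasure m V = (\<integral>\<^sup>+y\<in>\<phi> ` V. ennreal (sqrt (det (g (U, \<phi>) y))) \<partial>lborel)"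
      using V by (intro volume_eq[OF ch(1)]) auto
    also have "\<dots> \<le> (\<integral>\<^sup>+y. ennreal C * indicator Q y \<partial>lborel)"
      using VQ C(3) by (intro nn_integral_mono) (auto simp: indicator_def intro!: ennreal_leI)
    also have "\<dots> = ennreal C * emeasure lborel Q"
      using r(2) by (intro nn_integral_cmult_indicator) (simp add: compact_imp_closed)
    also have "\<dots> < \<infinity>"
      using emeasure_compact_finite[OF r(2)] by (simp add: ennreal_mult_less_top)
    finally show ?thesis using V by blast
  qed
  then obtain V where V: "\<And>p. open (V p)" "\<And>p. p \<in> V p" "\<And>p. emeasure m (V p) < \<infinity>"
    by metis
  have "UNIV \<subseteq> (\<Union>p\<in>UNIV. V p)" using V(2) by blast
  with V(1) obtain F where F: "finite F" "UNIV \<subseteq> (\<Union>p\<in>F. V p)"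
    by (rule compactE_image[OF compact_UNIV])
  have "emeasure m (space m) \<le> emeasure m (\<Union>p\<in>F. V p)"
    using F V sp by (intro emeasure_mono) (auto simp: sets_volume)
  also have "\<dots> \<le> (\<Sum>p\<in>F. emeasure m (V p))"
    using F V by (intro emeasure_subadditive_finite) (auto simp: sets_volume)
  also have "\<dots> < \<infinity>"
    using F V by simp
  finally show "emeasure m (space m) \<noteq> \<infinity>" by simp
qed

lemma volume_open_pos:
  assumes "open V" "p \<in> V"
  shows "0 < emeasure m V"
proof -
  obtain U \<phi> where ch: "(U, \<phi>) \<in> \<A>" "p \<in> U" using chart_exists by blast
  obtain r Q q s where r: "0 < r" "compact Q" "convex Q" "Q \<subseteq> \<phi> ` (U \<inter> V)"
    "\<And>x. x \<in> U \<Longrightarrow> norm (\<phi> x - \<phi> p) \<le> r \<Longrightarrow> \<phi> x \<in> Q"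
    "0 < s" "cball q s \<subseteq> Q"
    by (rule coordinate_ball[OF ch assms(2,1)]) (rule that; blast)
  have QU: "Q \<subseteq> \<phi> ` U" using r(4) by auto
  obtain c C where c: "0 < c" "\<And>y. y \<in> Q \<Longrightarrow> c \<le> sqrt (det (g (U, \<phi>) y))"
    "\<And>y. y \<in> Q \<Longrightarrow> sqrt (det (g (U, \<phi>) y)) \<le> C"
    by (rule volume_bounds[OF ch(1) r(2) QU]) (rule that; blast)
  have "0 < emeasure lborel (cball q s)"
    using content_cball_pos[OF r(6), of q] emeasure_lborel_cball_finite[of q s]
    by (simp add: emeasure_eq_ennreal_measure measure_completion)
  then have "0 < ennreal c * emeasure lborel (cball q s)"
    using c(1) by (simp add: ennreal_zero_less_mult_iff)
  also have "\<dots> = (\<integral>\<^sup>+y. ennreal c * indicator (cball q s) y \<partial>lborel)"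
    by (rule nn_integral_cmult_indicator[symmetric]) simp
  also have "\<dots> \<le> (\<integral>\<^sup>+y\<in>\<phi> ` (U \<inter> V). ennreal (sqrt (det (g (U, \<phi>) y))) \<partial>lborel)"
    using r(4,7) c(2) by (intro nn_integral_mono) (auto simp: indicator_def intro!: ennreal_leI)
  also have "\<dots> = emeasure m (U \<inter> V)"
    using chart_open[OF ch(1)] assms(1) by (intro volume_eq[OF ch(1), symmetric]) auto
  also have "\<dots> \<le> emeasure m V"
    using assms(1) by (intro emeasure_mono) (auto simp: sets_volume)
  finally show ?thesis .
qed

end

section \<open>Riemannian balls\<close>

lemma has_real_derivative_square_max_0:
  "((\<lambda>u::real. (max 0 u)\<^sup>2) has_real_derivative 2 * max 0 u) (at u)"
proof -
  consider "0 < u" | "u < 0" | "u = 0" by linarith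
  then show ?thesis
  proof cases
    case 1
    have "((\<lambda>u. u\<^sup>2) has_real_derivative 2 * max 0 u) (at u)"
      using 1 by (auto intro!: derivative_eq_intros)
    then show ?thesis
      by (rule has_field_derivative_transform_within_open[of _ _ _ "{0<..}"]) (use 1 in auto)
  next
    case 2
    have "((\<lambda>u. 0) has_real_derivative 2 * max 0 u) (at u)"
      using 2 by (auto intro!: derivative_eq_intros)
    then show ?thesis
      by (rule has_field_derivative_transform_within_open[of _ _ _ "{..<0}"]) (use 2 in auto)
  next
    case 3
    have "((\<lambda>h. (max 0 h)\<^sup>2 / h) \<longlongrightarrow> 0) (at (0::real))"
    proof (rule Lim_null_comparison)
      have "norm ((max 0 h)\<^sup>2 / h) \<le> \<bar>h\<bar>" for h :: real
        by (cases "0 < h") (auto simp: power2_eq_square)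
      then show "\<forall>\<^sub>F h in at 0. norm ((max 0 h)\<^sup>2 / h) \<le> \<bar>h :: real\<bar>" by simp
      show "((\<lambda>h. \<bar>h :: real\<bar>) \<longlongrightarrow> 0) (at 0)"
        by (intro tendsto_eq_intros) auto
    qed
    then show ?thesis
      using 3 by (simp add: DERIV_def)
  qed
qed

text \<open>The positive part is squared to make the function differentiable across the sphere of
  radius \<open>r\<close>, where it becomes zero.\<close>
definition bump :: "'v::real_inner \<Rightarrow> real \<Rightarrow> 'v \<Rightarrow> real" where
  "bump z r y = (max 0 (r\<^sup>2 - (y - z) \<bullet> (y - z)))\<^sup>2"

lemma bump_eq_0: "r \<le> norm (y - z) \<Longrightarrow> 0 \<le> r \<Longrightarrow> bump z r y = 0"
  using power_mono[of r "norm (y - z)" 2] by (simp add: bump_def dot_square_norm)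

lemma bump_derivative:
  obtains w where "(bump z r has_derivative w) (at y)"
    "\<And>h. 0 \<le> r \<Longrightarrow> \<bar>w h\<bar> \<le> 4 * r ^ 3 * norm h"
proof
  define u where "u = r\<^sup>2 - (y - z) \<bullet> (y - z)"
  let ?w = "\<lambda>h. (2 * max 0 u) * (- (2 * ((y - z) \<bullet> h)))"
  have "((\<lambda>y. r\<^sup>2 - (y - z) \<bullet> (y - z)) has_derivative (\<lambda>h. - (2 * ((y - z) \<bullet> h)))) (at y)"
    by (auto intro!: derivative_eq_intros simp: inner_commute)
  moreover have "((\<lambda>u. (max 0 u)\<^sup>2) has_derivative (\<lambda>x. (2 * max 0 u) * x)) (at (r\<^sup>2 - (y - z) \<bullet> (y - z)))"
    using has_real_derivative_square_max_0[of u] by (simp add: has_field_derivative_def u_def)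
  ultimately show "(bump z r has_derivative ?w) (at y)"
    unfolding bump_def[abs_def] by (rule has_derivative_compose)
  fix h assume r: "0 \<le> r"
  show "\<bar>?w h\<bar> \<le> 4 * r ^ 3 * norm h"
  proof (cases "norm (y - z) \<le> r")
    case True
    have "max 0 u \<le> r\<^sup>2" by (simp add: u_def)
    moreover have "\<bar>(y - z) \<bullet> h\<bar> \<le> r * norm h"
      using Cauchy_Schwarz_ineq2[of "y - z" h] mult_right_mono[OF True, of "norm h"] by simp
    ultimately have "max 0 u * \<bar>(y - z) \<bullet> h\<bar> \<le> r\<^sup>2 * (r * norm h)"
      by (intro mult_mono) auto
    then show ?thesis
      by (simp add: abs_mult power2_eq_square power3_eq_cube)
  next
    case False
    then have "max 0 u = 0"
      using power_mono[of r "norm (y - z)" 2] r by (simp add: u_def dot_square_norm)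
    then show ?thesis using r by simp
  qed
qed

context compact_riemannian begin

lemma curve_length_trans:
  assumes "curve_length \<A> g y z l'" "curve_length \<A> g x y l"
  shows "curve_length \<A> g x z (l + l')"
  using assms
proof (induction rule: curve_length.induct)
  case (const y)
  then show ?case by simp
next
  case (arc y y' l' U \<phi> z c c')
  then have "curve_length \<A> g x y' (l + l')" by blast
  from curve_length.arc[OF this arc.hyps(2-9)] show ?case
    by (simp add: add.assoc)
qed

lemma riem_ball_iff: "y \<in> riem_ball \<A> g \<epsilon> x \<longleftrightarrow> (\<exists>l. curve_length \<A> g x y l \<and> l < \<epsilon>)"
  by (auto simp: riem_ball_def riem_dist_def INF_less_iff)

lemma speed_continuous:
  assumes "(U, \<phi>) \<in> \<A>" "c ` {0..1} \<subseteq> \<phi> ` U" "continuous_on {0..1::real} c" "continuous_on {0..1} c'"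
  shows "continuous_on {0..1} (\<lambda>t. sqrt (c' t \<bullet> (g (U, \<phi>) (c t) *v c' t)))"
proof -
  have "continuous_on {0..1} (\<lambda>t. g (U, \<phi>) (c t))"
    by (rule continuous_on_compose2[OF metric_continuous[OF assms(1)] assms(3,2)])
  then show ?thesis
    unfolding inner_matrix_vector_eq_sum by (intro continuous_intros assms(4))
qed

text \<open>The coordinate segment is a curve of the required length.\<close>
lemma segment_length:
  assumes ch: "(U, \<phi>) \<in> \<A>" and Q: "convex Q" "Q \<subseteq> \<phi> ` U" and C: "0 \<le> C"
    "\<And>y v. y \<in> Q \<Longrightarrow> v \<bullet> (g (U, \<phi>) y *v v) \<le> C * (norm v)\<^sup>2"
    and x: "x \<in> U" "\<phi> x \<in> Q" and y: "y \<in> U" "\<phi> y \<in> Q"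
  shows "\<exists>l. curve_length \<A> g x y l \<and> l \<le> sqrt C * norm (\<phi> y - \<phi> x)"
proof -
  define v where "v = \<phi> y - \<phi> x"
  define c where "c t = \<phi> x + t *\<^sub>R v" for t :: real
  define S where "S t = sqrt (v \<bullet> (g (U, \<phi>) (c t) *v v))" for t
  have cQ: "c t \<in> Q" if "t \<in> {0..1}" for t
  proof -
    have "c t = (1 - t) *\<^sub>R \<phi> x + t *\<^sub>R \<phi> y"
      by (simp add: c_def v_def algebra_simps)
    then show ?thesis
      using convexD[OF Q(1) x(2) y(2), of "1 - t" t] that by simp
  qed
  then have im: "c ` {0..1} \<subseteq> \<phi> ` U" using Q(2) by auto
  have "curve_length \<A> g x y (0 + integral {0..1} S)"
    unfolding S_def
  proof (rule curve_length.arc[OF curve_length.const ch x(1) y(1) _ _ im])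
    show "c 0 = \<phi> x" "c 1 = \<phi> y" by (simp_all add: c_def v_def)
    show "\<forall>t\<in>{0..1}. (c has_vector_derivative v) (at t within {0..1})"
      unfolding c_def[abs_def] by (auto intro!: derivative_eq_intros)
  qed (rule continuous_on_const)
  moreover have "integral {0..1} S \<le> sqrt C * norm v"
  proof -
    have "continuous_on {0..1} c"
      unfolding c_def by (intro continuous_intros)
    then have "continuous_on {0..1} S"
      unfolding S_def by (intro speed_continuous[OF ch im]) auto
    then have "S integrable_on {0..1}"
      by (rule integrable_continuous_real)
    moreover have "S t \<le> sqrt C * norm v" if "t \<in> {0..1}" for t
    proof -
      have "S t \<le> sqrt (C * (norm v)\<^sup>2)"
        unfolding S_def by (intro real_sqrt_le_mono C(2) cQ that)
      then show ?thesis by (simp add: real_sqrt_mult)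
    qed
    ultimately have "integral {0..1} S \<le> integral {0..1::real} (\<lambda>t. sqrt C * norm v)"
      by (intro integral_le) auto
    then show ?thesis by simp
  qed
  ultimately show ?thesis by (auto simp: v_def)
qed

lemma short_curves_nearby:
  assumes "0 < \<delta>"
  shows "\<exists>V. open V \<and> p \<in> V \<and> V \<subseteq> {x. p \<in> riem_ball \<A> g \<delta> x} \<and> V \<subseteq> riem_ball \<A> g \<delta> p"
proof -
  obtain U \<phi> where ch: "(U, \<phi>) \<in> \<A>" "p \<in> U" using chart_exists by blast
  obtain r Q q s where r: "0 < r" "compact Q" "convex Q" "Q \<subseteq> \<phi> ` (U \<inter> UNIV)"
    "\<And>x. x \<in> U \<Longrightarrow> norm (\<phi> x - \<phi> p) \<le> r \<Longrightarrow> \<phi> x \<in> Q"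
    "0 < s" "cball q s \<subseteq> Q"
    by (rule coordinate_ball[OF ch UNIV_I open_UNIV]) (rule that; blast)
  have QU: "Q \<subseteq> \<phi> ` U" using r(4) by auto
  obtain c C where C: "0 < c" "0 < C"
    "\<And>y v. y \<in> Q \<Longrightarrow> c * (norm v)\<^sup>2 \<le> v \<bullet> (g (U, \<phi>) y *v v)"
    "\<And>y v. y \<in> Q \<Longrightarrow> v \<bullet> (g (U, \<phi>) y *v v) \<le> C * (norm v)\<^sup>2"
    by (rule metric_bounds[OF ch(1) r(2) QU]) (rule that; blast)
  define \<eta> where "\<eta> = min r (\<delta> / sqrt C)"
  have \<eta>: "0 < \<eta>" using r(1) C(2) assms by (simp add: \<eta>_def)
  define V where "V = {x \<in> U. norm (\<phi> x - \<phi> p) < \<eta>}"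
  have near: "x \<in> U" "\<phi> x \<in> Q" "sqrt C * norm (\<phi> x - \<phi> p) < \<delta>" if "x \<in> V" for x
  proof -
    show "x \<in> U" using that by (simp add: V_def)
    then show "\<phi> x \<in> Q" using that by (intro r(5)) (auto simp: V_def \<eta>_def)
    have "norm (\<phi> x - \<phi> p) < \<delta> / sqrt C"
      using that by (simp add: V_def \<eta>_def)
    then show "sqrt C * norm (\<phi> x - \<phi> p) < \<delta>"
      using C(2) by (simp add: field_simps)
  qed
  have pQ: "\<phi> p \<in> Q" using r(1,5) ch(2) by simp
  note seg = segment_length[OF ch(1) r(3) QU less_imp_le[OF C(2)] C(4)]
  show ?thesis
  proof (intro exI[of _ V] conjI subsetI CollectI)
    show "open V" unfolding V_def by (rule coordinate_ball_open[OF ch(1)])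
    show "p \<in> V" using \<eta> ch(2) by (simp add: V_def)
    fix x assume x: "x \<in> V"
    obtain l where "curve_length \<A> g x p l" "l \<le> sqrt C * norm (\<phi> p - \<phi> x)"
      using seg[OF _ near(1,2)[OF x] ch(2) pQ] by blast
    then show "p \<in> riem_ball \<A> g \<delta> x"
      using near(3)[OF x] by (auto simp: riem_ball_iff norm_minus_commute intro!: exI[of _ l])
    obtain l where "curve_length \<A> g p x l" "l \<le> sqrt C * norm (\<phi> x - \<phi> p)"
      using seg[OF _ ch(2) pQ near(1,2)[OF x]] by blast
    then show "x \<in> riem_ball \<A> g \<delta> p"
      using near(3)[OF x] by (auto simp: riem_ball_iff intro!: exI[of _ l])
  qed
qed

text \<open>A curve shorter than \<open>\<epsilon>\<close> can be extended at both ends to all nearby points without reaching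
  length \<open>\<epsilon>\<close>. Openness in both variables makes the balls depend measurably on their centre.\<close>
lemma ball_graph_open: "open {(x, y). y \<in> riem_ball \<A> g \<epsilon> x}"
proof (subst open_subopen, intro ballI)
  fix z assume "z \<in> {(x, y). y \<in> riem_ball \<A> g \<epsilon> x}"
  then obtain x y l where z: "z = (x, y)" and l: "curve_length \<A> g x y l" "l < \<epsilon>"
    by (auto simp: riem_ball_iff)
  have \<delta>: "0 < (\<epsilon> - l) / 2" using l(2) by simp
  obtain V1 where V1: "open V1" "x \<in> V1" "V1 \<subseteq> {x'. x \<in> riem_ball \<A> g ((\<epsilon> - l) / 2) x'}"
    using short_curves_nearby[OF \<delta>, of x] by blast
  obtain V2 where V2: "open V2" "y \<in> V2" "V2 \<subseteq> riem_ball \<A> g ((\<epsilon> - l) / 2) y"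
    using short_curves_nearby[OF \<delta>, of y] by blast
  have "y' \<in> riem_ball \<A> g \<epsilon> x'" if xy: "x' \<in> V1" "y' \<in> V2" for x' y'
  proof -
    obtain l1 l2 where l1: "curve_length \<A> g x' x l1" "l1 < (\<epsilon> - l) / 2"
      and l2: "curve_length \<A> g y y' l2" "l2 < (\<epsilon> - l) / 2"
      using subsetD[OF V1(3) xy(1)] subsetD[OF V2(3) xy(2)] by (auto simp: riem_ball_iff)
    have "curve_length \<A> g x' y' (l1 + l + l2)"
      using curve_length_trans[OF l2(1) curve_length_trans[OF l(1) l1(1)]] .
    moreover have "l1 + l + l2 < \<epsilon>"
      using l1(2) l2(2) by (simp add: field_simps)
    ultimately show ?thesis
      by (auto simp: riem_ball_iff)
  qed
  then have "V1 \<times> V2 \<subseteq> {(x, y). y \<in> riem_ball \<A> g \<epsilon> x}" by auto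
  moreover have "open (V1 \<times> V2)" using V1(1) V2(1) by (rule open_Times)
  ultimately show "\<exists>T. open T \<and> z \<in> T \<and> T \<subseteq> {(x, y). y \<in> riem_ball \<A> g \<epsilon> x}"
    using V1(2) V2(2) z by blast
qed

lemma ball_open: "open (riem_ball \<A> g \<epsilon> x)"
proof -
  have "open ((\<lambda>y. (x, y)) -` {(x, y). y \<in> riem_ball \<A> g \<epsilon> x})"
    by (intro open_vimage ball_graph_open continuous_intros)
  then show ?thesis by (simp add: vimage_def)
qed

lemma centre_in_ball: "0 < \<epsilon> \<Longrightarrow> x \<in> riem_ball \<A> g \<epsilon> x"
  unfolding riem_ball_iff using curve_length.const by blast

text \<open>A bump function of one chart, extended by zero, is Lipschitz along all curves, also where these
  are given in other charts. Wherever the curve meets the compact coordinate ball \<open>D\<close>, its velocity can be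
  expressed in the chart of the bump, because the metric matrices define the same norm, and on the
  ball this norm is at least \<open>sqrt c\<close> times the Euclidean norm; elsewhere the bump is locally
  constant. Integrating the pointwise bound of the derivative by the speed gives the claim.\<close>
lemma curve_length_bump_bound:
  assumes ch: "(U, \<phi>) \<in> \<A>" and z: "z \<in> \<phi> ` U" and r: "0 \<le> r"
    and Q: "compact Q" "Q \<subseteq> \<phi> ` U" "\<And>x. x \<in> U \<Longrightarrow> norm (\<phi> x - z) \<le> r \<Longrightarrow> \<phi> x \<in> Q"
    and c: "0 < c" "\<And>y v. y \<in> Q \<Longrightarrow> c * (norm v)\<^sup>2 \<le> v \<bullet> (g (U, \<phi>) y *v v)"
    and F: "\<And>x. F x = (if x \<in> U then bump z r (\<phi> x) else 0)"
    and l: "curve_length \<A> g x y l"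
  shows "\<bar>F y - F x\<bar> \<le> 4 * r ^ 3 / sqrt c * l"
  using l
proof (induction rule: curve_length.induct)
  case (const x)
  then show ?case by simp
next
  case (arc x y l V \<psi> z' \<gamma> \<gamma>')
  define \<theta> where "\<theta> = inv_into V \<psi>"
  define S where "S t = sqrt (\<gamma>' t \<bullet> (g (V, \<psi>) (\<gamma> t) *v \<gamma>' t))" for t
  define L where "L = 4 * r ^ 3 / sqrt c"
  have L0: "0 \<le> L" using r c(1) by (simp add: L_def)
  define D where "D = inv_into U \<phi> ` Q"
  have "compact D"
    unfolding D_def using Q(1,2) chart_inv_continuous[OF ch]
    by (intro compact_continuous_image) (auto intro: continuous_on_subset)
  then have clD: "closed D" by (rule compact_imp_closed)
  have D_iff: "x \<in> D" if "x \<in> U" "\<phi> x \<in> Q" for x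
    unfolding D_def using that chart_inj[OF ch] by (metis imageI inv_into_f_f)
  have DU: "D \<subseteq> U" "\<And>x. x \<in> D \<Longrightarrow> \<phi> x \<in> Q"
    unfolding D_def using Q(2) by (auto intro: inv_into_into simp: f_inv_into_f subset_iff)
  have F0: "F x = 0" if "x \<notin> D" for x
  proof (cases "x \<in> U")
    case True
    then have "r \<le> norm (\<phi> x - z)"
      using D_iff Q(3) that by (meson linear)
    then show ?thesis using r by (simp add: F bump_eq_0)
  qed (simp add: F)
  have \<gamma>c: "continuous_on {0..1} \<gamma>"
    using arc.hyps(8) by (auto intro!: has_vector_derivative_continuous simp: continuous_on_eq_continuous_within)
  have \<theta>\<gamma>: "continuous_on {0..1} (\<lambda>t. \<theta> (\<gamma> t))"
    unfolding \<theta>_def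
    by (rule continuous_on_compose2[OF chart_inv_continuous[OF arc.hyps(2)] \<gamma>c arc.hyps(7)])
  have \<theta>V: "\<theta> (\<gamma> t) \<in> V" "\<psi> (\<theta> (\<gamma> t)) = \<gamma> t" if "t \<in> {0..1}" for t
  proof -
    have "\<gamma> t \<in> \<psi> ` V" using arc.hyps(7) that by blast
    then show "\<theta> (\<gamma> t) \<in> V" "\<psi> (\<theta> (\<gamma> t)) = \<gamma> t"
      unfolding \<theta>_def by (auto intro: inv_into_into simp: f_inv_into_f)
  qed
  have "\<exists>w. ((\<lambda>t. F (\<theta> (\<gamma> t))) has_vector_derivative w) (at t within {0..1}) \<and> \<bar>w\<bar> \<le> L * S t"
    if t: "t \<in> {0..1}" for t
  proof (cases "\<theta> (\<gamma> t) \<in> D")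
    case False
    have ev: "\<forall>\<^sub>F s in at t within {0..1}. 0 = F (\<theta> (\<gamma> s))"
    proof -
      have "\<forall>\<^sub>F s in at t within {0..1}. \<theta> (\<gamma> s) \<in> - D"
        using \<theta>\<gamma> t clD False unfolding continuous_on_def by (intro topological_tendstoD) auto
      then show ?thesis by eventually_elim (simp add: F0)
    qed
    have "((\<lambda>s. 0 :: real) has_vector_derivative 0) (at t within {0..1})"
      by (rule has_vector_derivative_const)
    then have "((\<lambda>t. F (\<theta> (\<gamma> t))) has_vector_derivative 0) (at t within {0..1})"
      unfolding has_vector_derivative_def
      by (rule has_derivative_transform_eventually[OF _ ev]) (use F0[OF False] t in auto)
    moreover have "0 \<le> S t"
    proof -
      have "0 \<le> \<gamma>' t \<bullet> (g (V, \<psi>) (\<gamma> t) *v \<gamma>' t)"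
        using metric_pos[OF arc.hyps(2), of "\<gamma> t" "\<gamma>' t"] arc.hyps(7) t
        by (cases "\<gamma>' t = 0") (auto simp: image_subset_iff)
      then show ?thesis by (simp add: S_def)
    qed
    ultimately show ?thesis using L0 by (intro exI[of _ 0]) simp
  next
    case True
    \<comment> \<open>The times at which the curve is visible in the chart of the bump: a relative neighbourhood
      of \<open>t\<close>, so derivatives within \<open>T\<close> and within the unit interval agree.\<close>
    define T where "T = {s \<in> {0..1}. \<theta> (\<gamma> s) \<in> U}"
    have tT: "t \<in> T" using t True DU by (auto simp: T_def)
    have "openin (top_of_set {0..1}) T"
    proof -
      have "openin (top_of_set {0..1}) ({0..1} \<inter> (\<lambda>s. \<theta> (\<gamma> s)) -` U)"
        by (rule continuous_openin_preimage_gen[OF \<theta>\<gamma> chart_open[OF ch]])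
      then show ?thesis by (simp add: T_def Int_def vimage_def)
    qed
    then obtain N where N: "open N" "T = {0..1} \<inter> N"
      by (auto simp: openin_open)
    have atT: "at t within {0..1} = at t within T"
      by (rule at_within_nhd[of t N]) (use N tT in auto)
    have inVU: "\<gamma> s \<in> \<psi> ` (V \<inter> U)" if "s \<in> T" for s
    proof -
      have "s \<in> {0..1}" "\<theta> (\<gamma> s) \<in> U" using that by (auto simp: T_def)
      then show ?thesis using \<theta>V[of s] by (metis IntI imageI)
    qed
    obtain D' where D': "((\<phi> \<circ> inv_into V \<psi>) has_derivative D') (at (\<gamma> t) within \<psi> ` (V \<inter> U))"
      using smooth_on_imp_differentiable_within[OF transition_smooth[OF arc.hyps(2) ch] inVU[OF tT]] by blast
    interpret D': bounded_linear D' using D' by (rule has_derivative_bounded_linear)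
    obtain w where w: "(bump z r has_derivative w) (at (\<phi> (\<theta> (\<gamma> t))))"
      "\<And>h. 0 \<le> r \<Longrightarrow> \<bar>w h\<bar> \<le> 4 * r ^ 3 * norm h"
      by (rule bump_derivative) (rule that; blast)
    interpret w: bounded_linear w using w(1) by (rule has_derivative_bounded_linear)
    have "(\<gamma> has_derivative (\<lambda>h. h *\<^sub>R \<gamma>' t)) (at t within T)"
      using arc.hyps(8) t unfolding has_vector_derivative_def atT[symmetric] by blast
    moreover have "((\<phi> \<circ> inv_into V \<psi>) has_derivative D') (at (\<gamma> t) within \<gamma> ` T)"
      using D' by (rule has_derivative_subset) (use inVU in blast)
    ultimately have "((\<lambda>s. (\<phi> \<circ> inv_into V \<psi>) (\<gamma> s)) has_derivative (\<lambda>h. D' (h *\<^sub>R \<gamma>' t))) (at t within T)"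
      by (rule has_derivative_in_compose)
    then have "((\<lambda>s. \<phi> (\<theta> (\<gamma> s))) has_derivative (\<lambda>h. D' (h *\<^sub>R \<gamma>' t))) (at t within T)"
      by (simp add: \<theta>_def)
    from has_derivative_compose[OF this w(1)]
    have "((\<lambda>s. bump z r (\<phi> (\<theta> (\<gamma> s)))) has_derivative (\<lambda>h. w (D' (h *\<^sub>R \<gamma>' t)))) (at t within T)" .
    then have "((\<lambda>s. F (\<theta> (\<gamma> s))) has_derivative (\<lambda>h. w (D' (h *\<^sub>R \<gamma>' t)))) (at t within T)"
      by (rule has_derivative_transform[OF tT, rotated]) (simp add: F T_def)
    then have "((\<lambda>t. F (\<theta> (\<gamma> t))) has_vector_derivative w (D' (\<gamma>' t))) (at t within {0..1})"
      unfolding has_vector_derivative_def atT by (simp add: D'.scaleR w.scaleR)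
    moreover have "\<bar>w (D' (\<gamma>' t))\<bar> \<le> L * S t"
    proof -
      define n where "n = norm (D' (\<gamma>' t))"
      have "c * n\<^sup>2 \<le> D' (\<gamma>' t) \<bullet> (g (U, \<phi>) (\<phi> (\<theta> (\<gamma> t))) *v D' (\<gamma>' t))"
        unfolding n_def by (rule c(2)[OF DU(2)[OF True]])
      also have "\<dots> = \<gamma>' t \<bullet> (g (V, \<psi>) (\<gamma> t) *v \<gamma>' t)"
        unfolding \<theta>_def by (rule metric_change_of_chart[OF arc.hyps(2) ch inVU[OF tT] D', symmetric])
      finally have "sqrt (c * n\<^sup>2) \<le> S t"
        unfolding S_def by (rule real_sqrt_le_mono)
      then have "sqrt c * n \<le> S t"
        by (simp add: real_sqrt_mult n_def)
      then have "n \<le> S t / sqrt c"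
        using c(1) by (simp add: field_simps)
      then have "4 * r ^ 3 * n \<le> 4 * r ^ 3 * (S t / sqrt c)"
        using r by (intro mult_left_mono) auto
      then show ?thesis
        using w(2)[OF r, of "D' (\<gamma>' t)"] by (simp add: L_def n_def)
    qed
    ultimately show ?thesis by blast
  qed
  then obtain w where w: "\<And>t. t \<in> {0..1} \<Longrightarrow> ((\<lambda>t. F (\<theta> (\<gamma> t))) has_vector_derivative w t) (at t within {0..1})"
    "\<And>t. t \<in> {0..1} \<Longrightarrow> \<bar>w t\<bar> \<le> L * S t"
    by metis
  have ends: "\<theta> (\<gamma> 0) = y" "\<theta> (\<gamma> 1) = z'"
    using arc.hyps(3-6) chart_inj[OF arc.hyps(2)] by (auto simp: \<theta>_def)
  have int: "(w has_integral (F z' - F y)) {0..1}"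
    using fundamental_theorem_of_calculus[of 0 1 "\<lambda>t. F (\<theta> (\<gamma> t))" w] w(1) by (simp add: ends)
  have Sint: "S integrable_on {0..1}"
    unfolding S_def by (intro integrable_continuous_real speed_continuous[OF arc.hyps(2,7) \<gamma>c arc.hyps(9)])
  have "(\<lambda>t. L * S t) integrable_on {0..1}"
    using integrable_cmul[OF Sint, of L] by simp
  then have "norm (integral {0..1} w) \<le> integral {0..1} (\<lambda>t. L * S t)"
    using int w(2) by (intro integral_norm_bound_integral) auto
  then have "\<bar>F z' - F y\<bar> \<le> L * integral {0..1} S"
    using int by (simp add: integral_unique)
  moreover have "\<bar>F y - F x\<bar> \<le> L * l"
    using arc.IH by (simp add: L_def)
  ultimately show ?case
    unfolding S_def[symmetric] L_def[symmetric] by (simp add: distrib_left)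
qed

text \<open>The bump at \<open>p\<close> is at least \<open>\<beta>\<close> on the coordinate ball of half radius and zero outside \<open>W\<close>. As it is
  Lipschitz with constant \<open>L\<close>, a curve from the former to the complement of the latter has length at
  least \<open>\<beta> / L\<close>.\<close>
lemma small_balls_locally_inside:
  assumes W: "open W" "p \<in> W"
  obtains V \<epsilon> where "open V" "p \<in> V" "0 < \<epsilon>" "\<And>x. x \<in> V \<Longrightarrow> riem_ball \<A> g \<epsilon> x \<subseteq> W"
proof -
  obtain U \<phi> where ch: "(U, \<phi>) \<in> \<A>" "p \<in> U" using chart_exists by blast
  obtain r Q q s where r: "0 < r" "compact Q" "convex Q" "Q \<subseteq> \<phi> ` (U \<inter> W)"
    "\<And>x. x \<in> U \<Longrightarrow> norm (\<phi> x - \<phi> p) \<le> r \<Longrightarrow> \<phi> x \<in> Q"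
    "0 < s" "cball q s \<subseteq> Q"
    by (rule coordinate_ball[OF ch W(2,1)]) (rule that; blast)
  have QU: "Q \<subseteq> \<phi> ` U" using r(4) by auto
  obtain c C where C: "0 < c" "0 < C"
    "\<And>y v. y \<in> Q \<Longrightarrow> c * (norm v)\<^sup>2 \<le> v \<bullet> (g (U, \<phi>) y *v v)"
    "\<And>y v. y \<in> Q \<Longrightarrow> v \<bullet> (g (U, \<phi>) y *v v) \<le> C * (norm v)\<^sup>2"
    by (rule metric_bounds[OF ch(1) r(2) QU]) (rule that; blast)
  define F where "F x = (if x \<in> U then bump (\<phi> p) r (\<phi> x) else 0)" for x
  define L where "L = 4 * r ^ 3 / sqrt c"
  have L: "0 < L" using r(1) C(1) by (simp add: L_def)
  \<comment> \<open>Within distance \<open>r / 2\<close> of the centre, the squared distance leaves at least half of \<open>r\<^sup>2\<close>.\<close>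
  define \<beta> where "\<beta> = (r\<^sup>2 / 2)\<^sup>2"
  have \<beta>: "0 < \<beta>" using r(1) by (simp add: \<beta>_def)
  define V where "V = {x \<in> U. norm (\<phi> x - \<phi> p) < r / 2}"
  have FV: "\<beta> \<le> F x" if "x \<in> V" for x
  proof -
    have "norm (\<phi> x - \<phi> p) ^ 2 \<le> (r / 2) ^ 2"
      using that by (intro power_mono) (auto simp: V_def)
    also have "\<dots> = r\<^sup>2 / 4" by (simp add: power_divide)
    finally have "r\<^sup>2 / 2 \<le> r\<^sup>2 - (\<phi> x - \<phi> p) \<bullet> (\<phi> x - \<phi> p)"
      unfolding dot_square_norm using zero_le_power2[of "norm (\<phi> x - \<phi> p)"]
      by linarith
    then have "r\<^sup>2 / 2 \<le> max 0 (r\<^sup>2 - (\<phi> x - \<phi> p) \<bullet> (\<phi> x - \<phi> p))"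
      by (rule max.coboundedI2)
    then show ?thesis
      using that unfolding \<beta>_def F_def bump_def V_def by (simp add: power_mono)
  qed
  have FW: "x \<in> W" if "F x \<noteq> 0" for x
  proof -
    have x: "x \<in> U" "norm (\<phi> x - \<phi> p) \<le> r"
      using that bump_eq_0[of r "\<phi> x" "\<phi> p"] r(1) by (force simp: F_def split: if_splits)+
    then have "\<phi> x \<in> \<phi> ` (U \<inter> W)" using r(4,5) by blast
    then show ?thesis using chart_inj[OF ch(1)] x(1) by (auto dest: inj_onD)
  qed
  show thesis
  proof (rule that[of V "\<beta> / L"])
    show "open V" unfolding V_def by (rule coordinate_ball_open[OF ch(1)])
    show "p \<in> V" using ch(2) r(1) by (simp add: V_def)
    show "0 < \<beta> / L" using \<beta> L by simp
    fix x assume x: "x \<in> V"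
    show "riem_ball \<A> g (\<beta> / L) x \<subseteq> W"
    proof
      fix y assume "y \<in> riem_ball \<A> g (\<beta> / L) x"
      then obtain l where l: "curve_length \<A> g x y l" "l < \<beta> / L"
        by (auto simp: riem_ball_iff)
      have "\<bar>F y - F x\<bar> \<le> L * l"
        unfolding L_def
        by (rule curve_length_bump_bound[OF ch(1) imageI[OF ch(2)] less_imp_le[OF r(1)] r(2) QU r(5) C(1,3) F_def l(1)])
      also have "L * l < \<beta>"
        using l(2) L by (simp add: field_simps)
      finally have "F y \<noteq> 0"
        using FV[OF x] by auto
      then show "y \<in> W" by (rule FW)
    qed
  qed
qed

text \<open>A finite subcover of the neighbourhoods provided by \<open>small_balls_locally_inside\<close> yields a
  common radius.\<close>
lemma balls_uniformly_small:
  fixes h :: "'a \<Rightarrow> complex"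
  assumes h: "continuous_on UNIV h" and \<eta>: "0 < \<eta>"
  shows "\<exists>\<epsilon>\<^sub>0>0. \<forall>\<epsilon>. 0 < \<epsilon> \<and> \<epsilon> \<le> \<epsilon>\<^sub>0 \<longrightarrow> (\<forall>x. \<forall>y\<in>riem_ball \<A> g \<epsilon> x. norm (h y - h x) < \<eta>)"
proof -
  define W where "W p = h -` ball (h p) (\<eta> / 2)" for p
  have W: "open (W p)" "p \<in> W p" for p
    using h \<eta> open_vimage[of "ball (h p) (\<eta> / 2)" h] by (auto simp: W_def)
  have "\<exists>V \<epsilon>. open V \<and> p \<in> V \<and> 0 < \<epsilon> \<and> (\<forall>x\<in>V. riem_ball \<A> g \<epsilon> x \<subseteq> W p)" for p
    by (rule small_balls_locally_inside[OF W(1) W(2)[of p]]) blast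
  then obtain V e where V: "\<And>p. open (V p)" "\<And>p. p \<in> V p" and e: "\<And>p. 0 < e p"
    and sub: "\<And>p x. x \<in> V p \<Longrightarrow> riem_ball \<A> g (e p) x \<subseteq> W p"
    by metis
  have "UNIV \<subseteq> (\<Union>p\<in>UNIV. V p)" using V(2) by blast
  with V(1) obtain P where P: "finite P" "UNIV \<subseteq> (\<Union>p\<in>P. V p)"
    by (rule compactE_image[OF compact_UNIV])
  have Pne: "P \<noteq> {}" using P(2) by auto
  define \<epsilon>\<^sub>0 where "\<epsilon>\<^sub>0 = Min (e ` P)"
  have pos: "0 < \<epsilon>\<^sub>0" using P(1) Pne e by (simp add: \<epsilon>\<^sub>0_def)
  have "norm (h y - h x) < \<eta>" if \<epsilon>: "0 < \<epsilon>" "\<epsilon> \<le> \<epsilon>\<^sub>0" and y: "y \<in> riem_ball \<A> g \<epsilon> x" for \<epsilon> x y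
  proof -
    obtain p where p: "p \<in> P" "x \<in> V p" using P(2) by auto
    have "\<epsilon>\<^sub>0 \<le> e p"
      unfolding \<epsilon>\<^sub>0_def using P(1) p(1) by (intro Min_le) auto
    with \<epsilon>(2) have "\<epsilon> \<le> e p" by simp
    then have sub': "riem_ball \<A> g \<epsilon> x \<subseteq> W p"
      using sub[OF p(2)] by (fastforce simp: riem_ball_iff)
    have "x \<in> riem_ball \<A> g \<epsilon> x"
      by (rule centre_in_ball[OF \<epsilon>(1)])
    then have "x \<in> W p" "y \<in> W p" using sub' y by auto
    then have "dist (h y) (h p) < \<eta> / 2" "dist (h x) (h p) < \<eta> / 2"
      by (auto simp: W_def dist_commute)
    then have "dist (h y) (h x) < \<eta>"
      by (rule dist_triangle_half_l)
    then show ?thesis by (simp add: dist_norm)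
  qed
  with pos show ?thesis by blast
qed

end

section \<open>Global empiric stochastic stability\<close>

theorem corollary1:
  fixes \<A> :: "('a::{t2_space, second_countable_topology}, 'n::finite) chart set"
    and g :: "('a, 'n) metric_matrices"
    and m :: "'a measure"
    and f :: "'a \<Rightarrow> 'a"
    and d :: "'a measure \<Rightarrow> 'a measure \<Rightarrow> real"
  assumes "compact_riemannian_manifold \<A> g"
    and "riemannian_volume \<A> g m"
    and "weak_star_metric d"
    and "continuous_on UNIV f"
  defines "B \<equiv> riem_ball \<A> g"
  defines "cond_i \<equiv> \<lambda>\<mu>\<^sub>1. globally_stable_measure m B f d \<mu>\<^sub>1"
    and "cond_ii \<equiv> \<lambda>\<mu>\<^sub>2. physical m f \<mu>\<^sub>2 \<and> (AE x in m. x \<in> strong_basin f \<mu>\<^sub>2)"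
    and "cond_iii \<equiv> \<lambda>\<mu>\<^sub>3. pseudo_physical m f d \<mu>\<^sub>3"
  shows "((\<exists>\<mu>\<^sub>1. cond_i \<mu>\<^sub>1) \<longleftrightarrow> (\<exists>\<mu>\<^sub>2. cond_ii \<mu>\<^sub>2)) \<and>
    ((\<exists>\<mu>\<^sub>2. cond_ii \<mu>\<^sub>2) \<longleftrightarrow> (\<exists>!\<mu>\<^sub>3. cond_iii \<mu>\<^sub>3)) \<and>
    ((\<exists>\<mu>\<^sub>1. cond_i \<mu>\<^sub>1) \<or> (\<exists>\<mu>\<^sub>2. cond_ii \<mu>\<^sub>2) \<or> (\<exists>!\<mu>\<^sub>3. cond_iii \<mu>\<^sub>3) \<longrightarrow>
      (\<exists>\<mu>. (\<forall>\<mu>\<^sub>1. cond_i \<mu>\<^sub>1 \<longleftrightarrow> \<mu>\<^sub>1 = \<mu>) \<and>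
        (\<forall>\<mu>\<^sub>2. cond_ii \<mu>\<^sub>2 \<longleftrightarrow> \<mu>\<^sub>2 = \<mu>) \<and>
        (\<forall>\<mu>\<^sub>3. cond_iii \<mu>\<^sub>3 \<longleftrightarrow> \<mu>\<^sub>3 = \<mu>) \<and>
        (\<forall>\<nu>. stable_measure m B f d \<nu> \<longleftrightarrow> \<nu> = \<mu>) \<and>
        (\<forall>K. stable_set m B f d K \<longleftrightarrow> K = {\<mu>})))"
proof -
  interpret R: compact_riemannian_volume \<A> g m
    using assms(1,2) by unfold_locales
  have "noisy_map m B f d"
  proof (rule noisy_map.intro)
    show "compact (UNIV :: 'a set)" by (rule R.compact_UNIV)
    show "sets m = sets borel" by (rule R.sets_volume)
    show "finite_measure m"
      by (rule R.finite_volume)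
    show "continuous_on UNIV f" "weak_star_metric d" by fact+
    fix \<epsilon> :: real assume \<epsilon>: "0 < \<epsilon>"
    show "{(x, y). y \<in> B \<epsilon> x} \<in> sets (borel \<Otimes>\<^sub>M borel)"
      unfolding borel_prod B_def using R.ball_graph_open by (rule borel_open)
    show "0 < emeasure m (B \<epsilon> x)" for x
      unfolding B_def using R.ball_open R.centre_in_ball[OF \<epsilon>] by (rule R.volume_open_pos)
  next
    fix \<phi> :: "'a \<Rightarrow> complex" and \<eta> :: real
    assume "continuous_on UNIV \<phi>" "0 < \<eta>"
    then show "\<exists>\<epsilon>\<^sub>0>0. \<forall>\<epsilon>. 0 < \<epsilon> \<and> \<epsilon> \<le> \<epsilon>\<^sub>0 \<longrightarrow> (\<forall>x. \<forall>y\<in>B \<epsilon> x. norm (\<phi> y - \<phi> x) < \<eta>)"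
      unfolding B_def by (rule R.balls_uniformly_small)
  qed
  then interpret noisy_map m B f d .
  show ?thesis
    unfolding cond_i_def cond_ii_def cond_iii_def by (rule equivalences)
qed

end
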